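(* For a finite group $G$ the following statements are equivalent: (1) $G$ is a $CD1$-group with $b_k=-1$; (2) $G$ is a $CD1$-group with $p\nmid a_k$; (3) $G$ is a doubly transitive Frobenius group with Frobenius kernel $F$; where $\{1\}\cup b^G=F$ (i.e. when these conditions hold, the Frobenius kernel $F$ of $G$ equals $\{1\}\cup b^G$).
   Context: All groups are finite. Let $\mathrm{Irr}(G)=\{\chi_1,\dots,\chi_k\}$ be the set of complex irreducible characters of $G$, with $\chi_1=1_G$ and $\chi_1(1)=1\le\chi_2(1)\le\dots\le\chi_k(1)$. A group $G$ is a $CD1$-group if $|G|>2$ and two columns of its character table differ by exactly one entry, i.e. there are non-conjugate $a,b\in G$ and an index $j$ with $\chi_j(a)\ne\chi_j(b)$ and $\chi_i(a)=\chi_i(b)$ for all $i\ne j$. For a $CD1$-group it is known that one of the two conjugacy classes is $\{1\}$, that the other one, denoted $b^G$, is uniquely determined, that the two columns differ exactly in the row of $\chi_k$, and that $b$ has prime order, denoted $p$. Put $a_k=\chi_k(1)$ and $b_k=\chi_k(b)$. A Frobenius group $G$ with Frobenius kernel $F$ and Frobenius complement $H$ is called doubly transitive if $|H|=|F|-1$. *)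

theory Defs
  imports
    Complex_Main
    "HOL-Library.FuncSet"
    "HOL-Algebra.Group_Action"
    "HOL-Algebra.Multiplicative_Group"
    "Jordan_Normal_Form.VS_Connect"
begin

section \<open>Complex irreducible characters\<close>

text \<open>The general linear group is the unit group of the matrix ring \<^const>\<open>ring_mat\<close>.\<close>

definition complex_rep :: "('a, 'c) monoid_scheme \<Rightarrow> nat \<Rightarrow> ('a \<Rightarrow> complex mat) \<Rightarrow> bool" where
  "complex_rep G n \<rho> \<longleftrightarrow> \<rho> \<in> hom G (units_of (ring_mat TYPE(complex) n ()))"

definition invariant_subspace ::
    "('a, 'c) monoid_scheme \<Rightarrow> nat \<Rightarrow> ('a \<Rightarrow> complex mat) \<Rightarrow> complex vec set \<Rightarrow> bool" where
  "invariant_subspace G n \<rho> W \<longleftrightarrow>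
     VectorSpace.subspace class_ring W (module_vec TYPE(complex) n) \<and>
     (\<forall>g\<in>carrier G. \<forall>w\<in>W. \<rho> g *\<^sub>v w \<in> W)"

definition irreducible_rep :: "('a, 'c) monoid_scheme \<Rightarrow> nat \<Rightarrow> ('a \<Rightarrow> complex mat) \<Rightarrow> bool" where
  "irreducible_rep G n \<rho> \<longleftrightarrow>
     complex_rep G n \<rho> \<and> n > 0 \<and>
     (\<forall>W. invariant_subspace G n \<rho> W \<longrightarrow> W = {0\<^sub>v n} \<or> W = carrier_vec n)"

definition mat_trace :: "complex mat \<Rightarrow> complex" where
  "mat_trace A = (\<Sum>i<dim_row A. A $$ (i, i))"

text \<open>Characters are restricted to the carrier, so that two of them are equal as functions iff
  they agree on the group.\<close>

definition character_of :: "('a, 'c) monoid_scheme \<Rightarrow> ('a \<Rightarrow> complex mat) \<Rightarrow> 'a \<Rightarrow> complex" where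
  "character_of G \<rho> = (\<lambda>g\<in>carrier G. mat_trace (\<rho> g))"

definition Irr :: "('a, 'c) monoid_scheme \<Rightarrow> ('a \<Rightarrow> complex) set" where
  "Irr G = {character_of G \<rho> | n \<rho>. irreducible_rep G n \<rho>}"

text \<open>The value at the identity of a character is the dimension of the representation, hence a
  natural number; it is needed as such for ordering and divisibility.\<close>

definition char_degree :: "('a, 'c) monoid_scheme \<Rightarrow> ('a \<Rightarrow> complex) \<Rightarrow> nat" where
  "char_degree G \<chi> = (THE d. \<chi> \<one>\<^bsub>G\<^esub> = of_nat d)"

definition irr_enumeration ::
    "('a, 'c) monoid_scheme \<Rightarrow> nat \<Rightarrow> (nat \<Rightarrow> 'a \<Rightarrow> complex) \<Rightarrow> bool" where
  "irr_enumeration G k \<chi> \<longleftrightarrow>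
     bij_betw \<chi> {1..k} (Irr G) \<and>
     \<chi> 1 = (\<lambda>g\<in>carrier G. 1) \<and>
     mono_on {1..k} (\<lambda>i. char_degree G (\<chi> i))"

section \<open>CD1-groups\<close>

definition conj_class :: "('a, 'c) monoid_scheme \<Rightarrow> 'a \<Rightarrow> 'a set" where
  "conj_class G x = orbit G (\<lambda>g y. g \<otimes>\<^bsub>G\<^esub> y \<otimes>\<^bsub>G\<^esub> inv\<^bsub>G\<^esub> g) x"

definition columns_differ_once :: "('a, 'c) monoid_scheme \<Rightarrow> 'a \<Rightarrow> 'a \<Rightarrow> bool" where
  "columns_differ_once G a b \<longleftrightarrow>
     a \<in> carrier G \<and> b \<in> carrier G \<and> b \<notin> conj_class G a \<and>
     (\<exists>\<chi>\<in>Irr G. \<chi> a \<noteq> \<chi> b \<and> (\<forall>\<psi>\<in>Irr G - {\<chi>}. \<psi> a = \<psi> b))"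

definition CD1_group :: "('a, 'c) monoid_scheme \<Rightarrow> bool" where
  "CD1_group G \<longleftrightarrow> group G \<and> finite (carrier G) \<and> Coset.order G > 2 \<and>
     (\<exists>a b. columns_differ_once G a b)"

text \<open>In a CD1-group, one of the two classes is that of the identity and the other one is uniquely
  determined; \<open>CD1_class\<close> denotes the latter. It is meaningful for CD1-groups only.\<close>

definition CD1_class :: "('a, 'c) monoid_scheme \<Rightarrow> 'a set" where
  "CD1_class G = (THE C. \<exists>b. columns_differ_once G \<one>\<^bsub>G\<^esub> b \<and> C = conj_class G b)"

section \<open>Frobenius groups\<close>

text \<open>The Frobenius kernel consists of the identity and the elements lying in no conjugate of
  the complement.\<close>

definition frobenius_group :: "('a, 'c) monoid_scheme \<Rightarrow> 'a set \<Rightarrow> 'a set \<Rightarrow> bool" where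
  "frobenius_group G F H \<longleftrightarrow>
     group G \<and> finite (carrier G) \<and>
     subgroup H G \<and> H \<noteq> {\<one>\<^bsub>G\<^esub>} \<and> H \<noteq> carrier G \<and>
     (\<forall>g\<in>carrier G - H. H \<inter> (g <#\<^bsub>G\<^esub> H #>\<^bsub>G\<^esub> inv\<^bsub>G\<^esub> g) = {\<one>\<^bsub>G\<^esub>}) \<and>
     F = insert \<one>\<^bsub>G\<^esub> (carrier G - (\<Union>g\<in>carrier G. g <#\<^bsub>G\<^esub> H #>\<^bsub>G\<^esub> inv\<^bsub>G\<^esub> g))"

definition doubly_transitive_frobenius :: "('a, 'c) monoid_scheme \<Rightarrow> 'a set \<Rightarrow> bool" where
  "doubly_transitive_frobenius G F \<longleftrightarrow> (\<exists>H. frobenius_group G F H \<and> card H = card F - 1)"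

end

theory Submission
  imports Defs "Jordan_Normal_Form.Spectral_Radius" "Jordan_Normal_Form.DL_Rank" "HOL-Algebra.Sylow"
begin

text \<open>Let \<open>\<chi>\<close> be the row in which the columns of \<open>1\<close> and \<open>b\<close> differ, let \<open>m\<close> be the size of the class of
\<open>b\<close> and let \<open>N\<close> be that class together with \<open>1\<close>. If the difference of the two columns is paired
with any column \<open>y\<close>, all rows but \<open>\<chi>\<close> cancel, and column orthogonality evaluates what is left
(\<open>column_difference\<close>). This yields that \<open>\<chi>\<close> vanishes outside \<open>N\<close>, that \<open>m \<chi>(b) = - \<chi>(1)\<close> and
that \<open>\<chi>(1)\<^sup>2\<close> is \<open>m\<close> times the sum of the squares of the other degrees. So \<open>\<chi>\<close> has the strictly
largest degree (\<open>degree_less_deg\<close>), which identifies it as the last row of the table and makes the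
class of \<open>b\<close> unique. The sum of the elements of \<open>N\<close> is central in the group algebra; it acts as
\<open>m + 1\<close> in every row but \<open>\<chi>\<close> and as \<open>0\<close> in the row \<open>\<chi>\<close>. Hence its square is \<open>m + 1\<close> times itself,
and comparing coefficients shows that \<open>N\<close> is closed under multiplication (\<open>N_subgroup\<close>). It is a
normal subgroup that every irreducible representation other than that of \<open>\<chi>\<close> maps to \<open>1\<close>.

If \<open>\<chi>(b) = -1\<close>, then \<open>\<chi>(1) = m\<close>, while the order \<open>p\<close> of \<open>b\<close> divides the order \<open>m + 1\<close>
of \<open>N\<close>; so \<open>p\<close> does not divide \<open>\<chi>(1)\<close>. In general the multiplicity of an eigenvalue of \<open>b\<close> shows
\<open>\<chi>(1) = m t\<close> and \<open>\<chi>(b) = - t\<close> for a natural number \<open>t\<close> (\<open>m_dvd_deg\<close>), and the centralizer of \<open>b\<close>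
then has order \<open>t\<^sup>2 (m + 1)\<close>. Suppose that \<open>p\<close> does not divide \<open>\<chi>(1)\<close> and that a prime \<open>q\<close> divides
\<open>t\<close>. By Cauchy the centralizer contains an element \<open>x\<close> of order \<open>q\<close>. Both \<open>x\<close> and \<open>b x\<close> lie outside
\<open>N\<close>, so they have the same column and are conjugate (\<open>same_column_outside_N\<close>); but the \<open>q\<close>-th power
of \<open>b x\<close> is that of \<open>b\<close> and is not \<open>1\<close>. Therefore \<open>t = 1\<close>.

If \<open>\<chi>(b) = -1\<close>, then \<open>G\<close> has order \<open>m (m + 1)\<close>. The conjugacy classes inside \<open>N\<close> of its nontrivial
elements all have the same size, which divides both \<open>m\<close> and \<open>m + 1\<close>; so \<open>N\<close> is abelian. It has a
complement \<open>H\<close>, because its order is prime to its index (\<open>abelian_normal_complement\<close>). A nontrivial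
element of \<open>N\<close> has a centralizer of order \<open>m + 1\<close>, which must be \<open>N\<close>; this makes \<open>G\<close> a Frobenius
group with kernel \<open>N\<close> and complement \<open>H\<close> (\<open>frobenius_of_minus_one\<close>).

Conversely, let \<open>G\<close> be a doubly transitive Frobenius group with kernel \<open>F\<close>. Counting shows that the
nontrivial elements of \<open>F\<close> form one conjugacy class. The multiplicities of the irreducible characters in the permutation character on the cosets
of the complement \<open>H\<close> are natural numbers whose squares add up to \<open>2\<close>. So this character is
\<open>1 + \<theta>\<close> with \<open>\<theta>\<close> irreducible; \<open>\<theta>\<close> takes the value \<open>|H|\<close> at \<open>1\<close>, the value \<open>-1\<close> on \<open>F - {1}\<close>, and \<open>0\<close>
elsewhere. Orthogonality to \<open>\<theta>\<close> forces every other row to agree at \<open>1\<close> and on \<open>F - {1}\<close>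
(\<open>doubly_transitive_frobenius_column\<close>).

The orthogonality relations are first derived from Schur's lemma. Rows are paired as
\<open>\<Sum>g. \<psi>(g) \<phi>(inv g)\<close> and columns as \<open>\<Sum>\<psi>. \<psi>(x) \<psi>(inv y)\<close>, so that complex conjugation and
unitary representations never occur.\<close>

section \<open>Sums and traces of matrices\<close>

text \<open>The dimensions are arguments because an empty sum does not determine them, and because
an entrywise sum lets finite sums of complex numbers be exchanged with matrix products.\<close>

definition mat_sum :: "nat \<Rightarrow> nat \<Rightarrow> 'i set \<Rightarrow> ('i \<Rightarrow> complex mat) \<Rightarrow> complex mat" where
  "mat_sum r c S A = mat r c (\<lambda>ij. \<Sum>s\<in>S. A s $$ ij)"

lemma mat_sum_carrier [simp]: "mat_sum r c S A \<in> carrier_mat r c"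
  by (simp add: mat_sum_def)

lemma mat_sum_dim [simp]: "dim_row (mat_sum r c S A) = r" "dim_col (mat_sum r c S A) = c"
  by (simp_all add: mat_sum_def)

lemma mat_sum_index: "i < r \<Longrightarrow> j < c \<Longrightarrow> mat_sum r c S A $$ (i, j) = (\<Sum>s\<in>S. A s $$ (i, j))"
  by (simp add: mat_sum_def)

lemma mat_sum_cong: "(\<And>s. s \<in> S \<Longrightarrow> A s = B s) \<Longrightarrow> mat_sum r c S A = mat_sum r c S B"
  by (auto simp: mat_sum_def intro!: eq_matI sum.cong)

lemma mat_sum_reindex_bij:
  assumes "bij_betw f S T"
  shows "mat_sum r c S (\<lambda>s. A (f s)) = mat_sum r c T A"
  unfolding mat_sum_def by (auto intro!: eq_matI simp: sum.reindex_bij_betw[OF assms, of "\<lambda>s. A s $$ _"])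

lemma mult_index:
  assumes "A \<in> carrier_mat r k" "B \<in> carrier_mat k c" "i < r" "j < c"
  shows "(A * B) $$ (i, j) = (\<Sum>l<k. A $$ (i, l) * B $$ (l, j))"
  using assms by (auto simp: times_mat_def scalar_prod_def lessThan_atLeast0 intro!: sum.cong)

lemma mult_mat_sum:
  assumes "B \<in> carrier_mat r k" "\<And>s. s \<in> S \<Longrightarrow> A s \<in> carrier_mat k c"
  shows "B * mat_sum k c S A = mat_sum r c S (\<lambda>s. B * A s)"
proof (rule eq_matI)
  fix i j assume "i < dim_row (mat_sum r c S (\<lambda>s. B * A s))" "j < dim_col (mat_sum r c S (\<lambda>s. B * A s))"
  then have ij: "i < r" "j < c" by auto
  have "(B * mat_sum k c S A) $$ (i, j) = (\<Sum>l<k. \<Sum>s\<in>S. B $$ (i, l) * A s $$ (l, j))"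
    using assms ij by (simp add: mult_index[of B r k _ c] mat_sum_index sum_distrib_left del: index_mult_mat(1))
  also have "\<dots> = (\<Sum>s\<in>S. \<Sum>l<k. B $$ (i, l) * A s $$ (l, j))"
    by (rule sum.swap)
  also have "\<dots> = mat_sum r c S (\<lambda>s. B * A s) $$ (i, j)"
    using ij assms mult_index[OF assms(1) assms(2) ij] by (auto simp: mat_sum_index intro!: sum.cong)
  finally show "(B * mat_sum k c S A) $$ (i, j) = mat_sum r c S (\<lambda>s. B * A s) $$ (i, j)" .
qed (use assms in auto)

lemma mat_sum_mult:
  assumes "B \<in> carrier_mat k c" "\<And>s. s \<in> S \<Longrightarrow> A s \<in> carrier_mat r k"
  shows "mat_sum r k S A * B = mat_sum r c S (\<lambda>s. A s * B)"
proof (rule eq_matI)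
  fix i j assume "i < dim_row (mat_sum r c S (\<lambda>s. A s * B))" "j < dim_col (mat_sum r c S (\<lambda>s. A s * B))"
  then have ij: "i < r" "j < c" by auto
  have "(mat_sum r k S A * B) $$ (i, j) = (\<Sum>l<k. \<Sum>s\<in>S. A s $$ (i, l) * B $$ (l, j))"
    using assms ij by (simp add: mult_index[of _ r k B c] mat_sum_index sum_distrib_right del: index_mult_mat(1))
  also have "\<dots> = (\<Sum>s\<in>S. \<Sum>l<k. A s $$ (i, l) * B $$ (l, j))"
    by (rule sum.swap)
  also have "\<dots> = mat_sum r c S (\<lambda>s. A s * B) $$ (i, j)"
    using ij assms mult_index[OF assms(2) assms(1) ij] by (auto simp: mat_sum_index intro!: sum.cong)
  finally show "(mat_sum r k S A * B) $$ (i, j) = mat_sum r c S (\<lambda>s. A s * B) $$ (i, j)" .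
qed (use assms in auto)

lemma trace_eq: "A \<in> carrier_mat n n \<Longrightarrow> mat_trace A = (\<Sum>i<n. A $$ (i, i))"
  by (auto simp: mat_trace_def)

lemma trace_mat_sum:
  assumes "\<And>s. s \<in> S \<Longrightarrow> A s \<in> carrier_mat n n"
  shows "mat_trace (mat_sum n n S A) = (\<Sum>s\<in>S. mat_trace (A s))"
proof -
  have "mat_trace (mat_sum n n S A) = (\<Sum>i<n. \<Sum>s\<in>S. A s $$ (i, i))"
    by (simp add: trace_eq[of _ n] mat_sum_index)
  also have "\<dots> = (\<Sum>s\<in>S. \<Sum>i<n. A s $$ (i, i))" by (rule sum.swap)
  also have "\<dots> = (\<Sum>s\<in>S. mat_trace (A s))" by (simp add: trace_eq[OF assms] cong: sum.cong)
  finally show ?thesis .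
qed

lemma trace_smult: "A \<in> carrier_mat n n \<Longrightarrow> mat_trace (c \<cdot>\<^sub>m A) = c * mat_trace A"
  by (simp add: trace_eq[of _ n] sum_distrib_left)

lemma trace_one: "mat_trace (1\<^sub>m n) = of_nat n"
  by (simp add: trace_eq[of _ n])

lemma trace_zero: "mat_trace (0\<^sub>m n n) = 0"
  by (simp add: trace_eq[of _ n])

text \<open>Schur's lemma produces scalar matrices in the form \<open>c \<cdot>\<^sub>m 1\<^sub>m n\<close>; these rules absorb them.\<close>

lemma scalar_mat_mult:
  fixes A :: "complex mat"
  assumes "A \<in> carrier_mat n m"
  shows "(c \<cdot>\<^sub>m 1\<^sub>m n) * A = c \<cdot>\<^sub>m A" "A * (c \<cdot>\<^sub>m 1\<^sub>m m) = c \<cdot>\<^sub>m A"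
  using assms mult_smult_assoc_mat[of "1\<^sub>m n" n n A m c] mult_smult_distrib[of A n m "1\<^sub>m m" m c] by auto

lemma smult_smult_mat: "a \<cdot>\<^sub>m (b \<cdot>\<^sub>m A) = (a * b :: complex) \<cdot>\<^sub>m A"
  by (rule eq_matI) auto

lemma trace_mult_comm:
  assumes "A \<in> carrier_mat n m" "B \<in> carrier_mat m n"
  shows "mat_trace (A * B) = mat_trace (B * A)"
proof -
  have "mat_trace (A * B) = (\<Sum>i<n. \<Sum>l<m. A $$ (i, l) * B $$ (l, i))"
    using assms by (simp add: trace_eq[of _ n] mult_index[of A n m B n] del: index_mult_mat(1))
  also have "\<dots> = (\<Sum>l<m. \<Sum>i<n. A $$ (i, l) * B $$ (l, i))" by (rule sum.swap)
  also have "\<dots> = mat_trace (B * A)"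
    using assms by (simp add: trace_eq[of _ m] mult_index[of B m n A m] mult.commute del: index_mult_mat(1))
  finally show ?thesis .
qed

lemma trace_conj:
  assumes "A \<in> carrier_mat n n" "P \<in> carrier_mat n n" "Q \<in> carrier_mat n n" "P * Q = 1\<^sub>m n"
  shows "mat_trace (Q * A * P) = mat_trace A"
proof -
  have "mat_trace (Q * A * P) = mat_trace (P * (Q * A))"
    using assms by (intro trace_mult_comm[of _ n n]) auto
  also have "P * (Q * A) = A" using assms by (simp flip: assoc_mult_mat[of P n n Q n A n])
  finally show ?thesis .
qed

lemma Nats_sum_closed:
  assumes "\<And>i. i \<in> I \<Longrightarrow> f i \<in> (\<nat> :: 'b :: semiring_1 set)"
  shows "sum f I \<in> \<nat>"
  using assms by (induction I rule: infinite_finite_induct) auto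

text \<open>Over the complex numbers an idempotent matrix is similar to an upper triangular one, whose
diagonal entries are idempotent numbers and hence \<open>0\<close> or \<open>1\<close>. All multiplicities below are
shown to be natural numbers in this way.\<close>

lemma idempotent_trace_Nats:
  assumes E: "E \<in> carrier_mat n n" and idem: "E * E = E"
  shows "mat_trace E \<in> \<nat>"
proof -
  obtain as where "char_poly E = (\<Prod>a\<leftarrow>as. [:- a, 1:])"
    using char_poly_factorized[OF E] by auto
  then obtain B where "upper_triangular B" "similar_mat E B"
    using schur_upper_triangular[OF E] by metis
  moreover from this obtain P Q where PQ: "similar_mat_wit E B P Q" by (auto simp: similar_mat_def)
  ultimately have ut: "upper_triangular B" by simp
  from similar_mat_witD2[OF E PQ] have c: "B \<in> carrier_mat n n" "P \<in> carrier_mat n n" "Q \<in> carrier_mat n n"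
    and pq: "P * Q = 1\<^sub>m n" "Q * P = 1\<^sub>m n" and EB: "E = P * B * Q" by auto
  have BE: "B = Q * E * P"
  proof -
    have "Q * E * P = Q * (P * B * Q) * P" by (simp add: EB)
    also have "\<dots> = (Q * P) * B * (Q * P)" using c by (simp add: assoc_mult_mat[of _ n n _ n _ n])
    finally show ?thesis using c pq by simp
  qed
  have "B * B = Q * E * (P * Q) * E * P"
    unfolding BE using c E by (simp add: assoc_mult_mat[of _ n n _ n _ n])
  also have "\<dots> = Q * (E * E) * P" using c E pq by (simp add: assoc_mult_mat[of _ n n _ n _ n])
  also have "\<dots> = B" by (simp add: idem BE)
  finally have BB: "B * B = B" .
  have diag: "B $$ (i, i) \<in> \<nat>" if i: "i < n" for i
  proof -
    have "B $$ (i, i) = (\<Sum>l<n. B $$ (i, l) * B $$ (l, i))"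
      using mult_index[OF c(1) c(1) i i] BB by simp
    also have "\<dots> = (\<Sum>l<n. if l = i then B $$ (i, i) * B $$ (i, i) else 0)"
    proof (rule sum.cong)
      fix l assume l: "l \<in> {..<n}"
      show "B $$ (i, l) * B $$ (l, i) = (if l = i then B $$ (i, i) * B $$ (i, i) else 0)"
        using ut c i l unfolding upper_triangular_def by (cases l i rule: linorder_cases) auto
    qed simp
    also have "\<dots> = B $$ (i, i) * B $$ (i, i)" using i by simp
    finally have "B $$ (i, i) = 0 \<or> B $$ (i, i) = 1" by auto
    then show ?thesis by auto
  qed
  have "mat_trace E = mat_trace B" unfolding BE using trace_conj[OF E c(2,3) pq(1)] by simp
  also have "\<dots> = (\<Sum>i<n. B $$ (i, i))" using c by (simp add: trace_eq)
  also have "\<dots> \<in> \<nat>" using diag by (intro Nats_sum_closed) auto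
  finally show ?thesis .
qed

section \<open>Bases adapted to a subspace\<close>

text \<open>A basis of \<open>W\<close> is extended to a basis of the whole space by the replacement theorem. The columns
of \<open>P\<close> are the vectors of that basis, those of \<open>W\<close> first; so the coordinates \<open>Q *\<^sub>v w\<close> of a vector
of \<open>W\<close> vanish from position \<open>d\<close> on.\<close>

lemma adapted_basis:
  assumes W: "VectorSpace.subspace class_ring W (module_vec TYPE(complex) n)"
    and nz: "W \<noteq> {0\<^sub>v n}" and nall: "W \<noteq> carrier_vec n"
  obtains P Q d where "P \<in> carrier_mat n n" "Q \<in> carrier_mat n n" "P * Q = 1\<^sub>m n" "Q * P = 1\<^sub>m n"
    "0 < d" "d < n"
    "\<And>w i. w \<in> W \<Longrightarrow> d \<le> i \<Longrightarrow> i < n \<Longrightarrow> (Q *\<^sub>v w) $ i = 0"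
    "\<And>j. j < d \<Longrightarrow> P *\<^sub>v unit_vec n j \<in> W"
proof -
  interpret vec_space "TYPE(complex)" n .
  have sub: "LinearCombinations.submodule class_ring W V" using W by (simp add: VectorSpace.subspace_def)
  have Wc: "W \<subseteq> carrier_vec n" using submodule.subset[OF sub] by simp
  have "\<exists>T. finite T \<and> maximal T (\<lambda>T. T \<subseteq> W \<and> lin_indpt T)"
  proof (rule maximal_exists[of _ n "{}"])
    show "finite T \<and> card T \<le> n" if "T \<subseteq> W \<and> lin_indpt T" for T
      using li_le_dim[OF fin_dim, of T] that Wc dim_is_n by auto
    show "{} \<subseteq> W \<and> lin_indpt {}" by (auto simp: lin_dep_def)
  qed
  then obtain T where fT: "finite T" and mT: "maximal T (\<lambda>T. T \<subseteq> W \<and> lin_indpt T)" by auto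
  have TW: "T \<subseteq> W" and liT: "lin_indpt T" using mT by (auto simp: maximal_def)
  have Tc: "T \<subseteq> carrier_vec n" using TW Wc by auto
  have spanT: "span T = W"
  proof
    show "span T \<subseteq> W" using span_is_subset[OF TW sub] .
    show "W \<subseteq> span T"
    proof
      fix w assume w: "w \<in> W"
      show "w \<in> span T"
      proof (cases "w \<in> T")
        case True then show ?thesis using in_own_span[of T] Tc by auto
      next
        case False
        then have "lin_dep (T \<union> {w})" using mT w TW unfolding maximal_def by blast
        then show ?thesis using lin_dep_iff_in_span[of T w] Tc liT w Wc False by auto
      qed
    qed
  qed
  have "T \<subseteq> span (set (unit_vecs n))" using Tc span_unit_vecs_is_carrier by metis
  from replacement[OF fT finite_set unit_vecs_carrier liT this]
  obtain C where C: "finite C" "C \<subseteq> carrier_vec n" "C \<inter> T = {}"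
      "int (card C) \<le> int (card (set (unit_vecs n) :: complex vec set)) - int (card T)"
      "span (T \<union> C) = span (set (unit_vecs n))"
    by blast
  note C(4,5)[unfolded span_unit_vecs_is_carrier distinct_card[OF unit_vecs_distinct]]
  then have C45: "int (card C) \<le> int n - int (card T)" "span (T \<union> C) = carrier_vec n" by simp_all
  have cTC: "card (T \<union> C) = card T + card C" using C fT by (simp add: card_Un_disjoint Int_commute)
  have bas: "basis (T \<union> C)"
    by (rule dim_gen_is_basis) (use C(1-3) C45 fT Tc cTC dim_is_n in auto)
  have cn: "card (T \<union> C) = n" using dim_basis[OF _ bas] C fT dim_is_n by simp
  obtain ts cs where ts: "set ts = T" "distinct ts" and cs: "set cs = C" "distinct cs"
    using finite_distinct_list fT C(1) by metis
  define xs where "xs = ts @ cs"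
  have xs: "set xs = T \<union> C" "distinct xs" using ts cs C by (auto simp: xs_def)
  then have lxs: "length xs = n" using cn distinct_card by metis
  have xc: "set xs \<subseteq> carrier_vec n" using xs Tc C by auto
  define P where "P = mat_of_cols n xs"
  have P: "P \<in> carrier_mat n n" unfolding P_def using mat_of_cols_carrier(1)[of n xs] lxs by simp
  have colsP: "cols P = xs" unfolding P_def using xc by simp
  have "det P \<noteq> 0"
    using lin_indpt_full_rank[OF P] det_rank_iff[OF P] bas xs colsP unfolding basis_def by simp
  from det_non_zero_imp_unit[OF P this] obtain Q where
    Q: "Q \<in> carrier_mat n n" "P * Q = 1\<^sub>m n" "Q * P = 1\<^sub>m n"
    unfolding Units_def by (auto simp: ring_mat_simps)
  define d where "d = card T"
  have dts: "length ts = d" using ts distinct_card unfolding d_def by metis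
  have "T \<noteq> {}"
  proof
    assume "T = {}"
    then have "W = {0\<^sub>v n}" using spanT by (auto simp: span_def lincomb_def)
    then show False using nz by simp
  qed
  then have d0: "0 < d" using fT by (simp add: d_def card_gt_0_iff)
  have dn: "d < n"
  proof (rule ccontr)
    assume "\<not> d < n"
    then have "card C = 0" using cTC cn by (simp add: d_def)
    then have "C = {}" using C by simp
    then show False using C45 spanT nall by simp
  qed
  have colP: "col P j = xs ! j" if "j < n" for j
    using that colsP P lxs by (metis carrier_matD(2) cols_nth)
  have unitP: "P *\<^sub>v unit_vec n j \<in> W" if "j < d" for j
  proof -
    have "P *\<^sub>v unit_vec n j = col P j" using P that dn by (auto simp: col_def)
    also have "\<dots> = ts ! j" using colP that dn dts by (simp add: xs_def nth_append)
    finally show ?thesis using that dts ts TW by (metis nth_mem subsetD)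
  qed
  have zero: "(Q *\<^sub>v w) $ i = 0" if w: "w \<in> W" and i: "d \<le> i" "i < n" for w i
  proof -
    obtain a where a: "w = lincomb a T"
    proof -
      have "w \<in> {lincomb a T |a. a \<in> T \<rightarrow> carrier class_ring}"
        using w spanT finite_span[OF fT] Tc by simp
      then show thesis using that by blast
    qed
    define a' where "a' x = (if x \<in> T then a x else 0)" for x
    have "w = lincomb a' (T \<union> C)"
    proof (rule eq_vecI)
      have "dim_vec w = n" using w Wc by auto
      then show "dim_vec w = dim_vec (lincomb a' (T \<union> C))"
        using lincomb_dim[of "T \<union> C" a'] C Tc fT by (metis finite_UnI le_sup_iff)
      fix l assume "l < dim_vec (lincomb a' (T \<union> C))"
      then have l: "l < n" using lincomb_dim[of "T \<union> C" a'] C Tc fT by simp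
      have "lincomb a' (T \<union> C) $ l = (\<Sum>x\<in>T \<union> C. a' x * x $ l)"
        using lincomb_index[OF l, of "T \<union> C" a'] C Tc by simp
      also have "\<dots> = (\<Sum>x\<in>T. a' x * x $ l)"
        using C fT by (intro sum.mono_neutral_right) (auto simp: a'_def)
      also have "\<dots> = (\<Sum>x\<in>T. a x * x $ l)" by (rule sum.cong) (simp_all add: a'_def)
      also have "\<dots> = w $ l" unfolding a using lincomb_index[OF l Tc, of a] by simp
      finally show "w $ l = lincomb a' (T \<union> C) $ l" by (rule sym)
    qed
    then have "w = P *\<^sub>v vec n (\<lambda>i. a' (col P i))"
      using mat_mult_eq_lincomb[OF P, of a'] colsP xs by simp
    then have "Q *\<^sub>v w = vec n (\<lambda>i. a' (col P i))"
      using Q P assoc_mult_mat_vec[of Q n n P n "vec n (\<lambda>i. a' (col P i))"] by simp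
    then have "(Q *\<^sub>v w) $ i = a' (xs ! i)" using i colP by simp
    moreover have "xs ! i \<in> C" using i dts lxs cs unfolding xs_def
      by (auto simp: nth_append intro!: nth_mem)
    ultimately show ?thesis using C by (auto simp: a'_def)
  qed
  show ?thesis using that[OF P Q d0 dn zero unitP] .
qed

section \<open>Representations and Schur's lemma\<close>

locale finite_group = group G for G (structure) +
  assumes fin [simp]: "finite (carrier G)"
begin

lemma card_pos: "0 < card (carrier G)" using fin one_closed by (auto simp: card_gt_0_iff simp del: one_closed)

lemma inv_mult_cancel [simp]:
  assumes "x \<in> carrier G" "y \<in> carrier G"
  shows "inv x \<otimes> (x \<otimes> y) = y" "x \<otimes> (inv x \<otimes> y) = y"
  using assms by (simp_all flip: m_assoc)

lemma complex_repD:
  assumes "complex_rep G n \<rho>"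
  shows "g \<in> carrier G \<Longrightarrow> \<rho> g \<in> carrier_mat n n"
    and "g \<in> carrier G \<Longrightarrow> h \<in> carrier G \<Longrightarrow> \<rho> (g \<otimes> h) = \<rho> g * \<rho> h"
    and "\<rho> \<one> = 1\<^sub>m n"
proof -
  let ?U = "units_of (ring_mat TYPE(complex) n ())"
  have hom: "\<rho> \<in> hom G ?U" using assms by (simp add: complex_rep_def)
  have unit: "\<rho> g \<in> Units (ring_mat TYPE(complex) n ())" if "g \<in> carrier G" for g
    using hom that by (auto simp: hom_def units_of_def)
  then show c: "\<rho> g \<in> carrier_mat n n" if "g \<in> carrier G" for g
    using that by (auto simp: Units_def ring_mat_simps)
  show m: "\<rho> (g \<otimes> h) = \<rho> g * \<rho> h" if "g \<in> carrier G" "h \<in> carrier G" for g h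
    using hom that by (auto simp: hom_def units_of_def ring_mat_simps)
  obtain B where B: "B \<in> carrier_mat n n" "B * \<rho> \<one> = 1\<^sub>m n"
    using unit[of \<one>] by (auto simp: Units_def ring_mat_simps)
  have "\<rho> \<one> = (B * \<rho> \<one>) * \<rho> \<one>" using B c[of \<one>] by simp
  also have "\<dots> = B * (\<rho> \<one> * \<rho> \<one>)" using B c[of \<one>] by (intro assoc_mult_mat) auto
  also have "\<dots> = 1\<^sub>m n" using B m[of \<one> \<one>] by simp
  finally show "\<rho> \<one> = 1\<^sub>m n" .
qed

lemma complex_repI:
  assumes c: "\<And>g. g \<in> carrier G \<Longrightarrow> \<rho> g \<in> carrier_mat n n"
    and m: "\<And>g h. g \<in> carrier G \<Longrightarrow> h \<in> carrier G \<Longrightarrow> \<rho> (g \<otimes> h) = \<rho> g * \<rho> h"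
    and one: "\<rho> \<one> = 1\<^sub>m n"
  shows "complex_rep G n \<rho>"
proof -
  have "\<rho> g \<in> Units (ring_mat TYPE(complex) n ())" if g: "g \<in> carrier G" for g
  proof -
    have "\<rho> (inv g) * \<rho> g = 1\<^sub>m n" "\<rho> g * \<rho> (inv g) = 1\<^sub>m n"
      using m[of "inv g" g] m[of g "inv g"] g one by auto
    then show ?thesis using c g by (auto simp: Units_def ring_mat_simps)
  qed
  then show ?thesis unfolding complex_rep_def hom_def
    using m by (auto simp: units_of_def ring_mat_simps)
qed

lemma irreducibleD:
  assumes "irreducible_rep G n \<rho>"
  shows "complex_rep G n \<rho>" "0 < n"
    and "invariant_subspace G n \<rho> W \<Longrightarrow> W = {0\<^sub>v n} \<or> W = carrier_vec n"
  using assms by (auto simp: irreducible_rep_def)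

lemma rep_inverse:
  assumes "complex_rep G n \<rho>" "g \<in> carrier G"
  shows "\<rho> g * \<rho> (inv g) = 1\<^sub>m n" "\<rho> (inv g) * \<rho> g = 1\<^sub>m n"
  using complex_repD(2,3)[OF assms(1)] assms(2) by (metis inv_closed r_inv, metis inv_closed l_inv)

text \<open>An eigenspace of \<open>X\<close> is invariant and nonzero, hence everything.\<close>

lemma schur_scalar:
  assumes irr: "irreducible_rep G n \<rho>" and X: "X \<in> carrier_mat n n"
    and comm: "\<And>g. g \<in> carrier G \<Longrightarrow> \<rho> g * X = X * \<rho> g"
  obtains c where "X = c \<cdot>\<^sub>m 1\<^sub>m n"
proof -
  note rep = complex_repD[OF irreducibleD(1)[OF irr]]
  obtain c v where v: "eigenvector X v c"
    using spectrum_non_empty[OF X irreducibleD(2)[OF irr]]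
    by (auto simp: spectrum_def eigenvalue_def)
  define W where "W = {v \<in> carrier_vec n. X *\<^sub>v v = c \<cdot>\<^sub>v v}"
  interpret vec_space "TYPE(complex)" n .
  have sub: "VectorSpace.subspace class_ring W (module_vec TYPE(complex) n)"
    unfolding VectorSpace.subspace_def submodule_def
    using vec_vs vec_module X
    by (auto simp: W_def mult_add_distrib_mat_vec[of _ n n] smult_add_distrib_vec mult_mat_vec[of _ n n]
        smult_smult_assoc mult.commute module_vec_simps class_ring_simps)
  have "invariant_subspace G n \<rho> W"
    unfolding invariant_subspace_def
  proof (intro conjI sub ballI)
    fix g w assume g: "g \<in> carrier G" and w: "w \<in> W"
    then have wc: "w \<in> carrier_vec n" and Xw: "X *\<^sub>v w = c \<cdot>\<^sub>v w" by (auto simp: W_def)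
    have "X *\<^sub>v (\<rho> g *\<^sub>v w) = (X * \<rho> g) *\<^sub>v w" using X rep(1)[OF g] wc by (intro assoc_mult_mat_vec[symmetric])
    also have "\<dots> = (\<rho> g * X) *\<^sub>v w" using comm[OF g] by simp
    also have "\<dots> = \<rho> g *\<^sub>v (X *\<^sub>v w)" using X rep(1)[OF g] wc by (intro assoc_mult_mat_vec)
    also have "\<dots> = c \<cdot>\<^sub>v (\<rho> g *\<^sub>v w)" unfolding Xw using rep(1)[OF g] wc by (rule mult_mat_vec)
    finally show "\<rho> g *\<^sub>v w \<in> W" using rep(1)[OF g] wc by (auto simp: W_def)
  qed
  moreover have "v \<in> W" "v \<noteq> 0\<^sub>v n" using v X by (auto simp: W_def eigenvector_def)
  ultimately have W: "W = carrier_vec n" using irreducibleD(3)[OF irr, of W] by auto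
  have "X = c \<cdot>\<^sub>m 1\<^sub>m n"
  proof (rule eq_matI)
    fix i j assume "i < dim_row (c \<cdot>\<^sub>m 1\<^sub>m n)" "j < dim_col (c \<cdot>\<^sub>m 1\<^sub>m n)"
    then have ij: "i < n" "j < n" by auto
    have "unit_vec n j \<in> W" using W by simp
    then have "X *\<^sub>v unit_vec n j = c \<cdot>\<^sub>v unit_vec n j" by (simp add: W_def)
    then have "(X *\<^sub>v unit_vec n j) $ i = (c \<cdot>\<^sub>v unit_vec n j) $ i" by simp
    then show "X $$ (i, j) = (c \<cdot>\<^sub>m 1\<^sub>m n) $$ (i, j)" using ij X by (auto simp: mult_mat_vec_def)
  qed (use X in auto)
  then show thesis by (rule that)
qed

text \<open>Averaging \<open>Y\<close> over the group turns an arbitrary matrix into an intertwiner of the two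
representations.\<close>

definition average :: "nat \<Rightarrow> nat \<Rightarrow> ('a \<Rightarrow> complex mat) \<Rightarrow> ('a \<Rightarrow> complex mat) \<Rightarrow> complex mat \<Rightarrow> complex mat" where
  "average n m \<rho> \<sigma> Y = mat_sum n m (carrier G) (\<lambda>g. \<rho> g * Y * \<sigma> (inv g))"

lemma bij_left_mult: "h \<in> carrier G \<Longrightarrow> bij_betw (\<lambda>g. h \<otimes> g) (carrier G) (carrier G)"
  by (rule bij_betwI[where g = "\<lambda>g. inv h \<otimes> g"]) (auto simp: m_assoc[symmetric])

lemma average_carrier [simp]: "average n m \<rho> \<sigma> Y \<in> carrier_mat n m"
  by (simp add: average_def)

lemma average_intertwines:
  assumes \<rho>: "complex_rep G n \<rho>" and \<sigma>: "complex_rep G m \<sigma>"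
    and Y: "Y \<in> carrier_mat n m" and h: "h \<in> carrier G"
  shows "\<rho> h * average n m \<rho> \<sigma> Y = average n m \<rho> \<sigma> Y * \<sigma> h"
proof -
  note r = complex_repD[OF \<rho>] and s = complex_repD[OF \<sigma>]
  have tc: "\<rho> x * Y * \<sigma> y \<in> carrier_mat n m" if "x \<in> carrier G" "y \<in> carrier G" for x y
    using r(1)[OF that(1)] s(1)[OF that(2)] Y by simp
  have "average n m \<rho> \<sigma> Y = mat_sum n m (carrier G) (\<lambda>g. \<rho> (h \<otimes> g) * Y * \<sigma> (inv (h \<otimes> g)))"
    unfolding average_def by (rule mat_sum_reindex_bij[OF bij_left_mult[OF h], symmetric])
  then have "average n m \<rho> \<sigma> Y * \<sigma> h
      = mat_sum n m (carrier G) (\<lambda>g. \<rho> (h \<otimes> g) * Y * \<sigma> (inv (h \<otimes> g)) * \<sigma> h)"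
    using h tc s(1)[OF h] by (auto intro!: mat_sum_mult)
  also have "\<dots> = mat_sum n m (carrier G) (\<lambda>g. \<rho> h * (\<rho> g * Y * \<sigma> (inv g)))"
  proof (rule mat_sum_cong)
    fix g assume g: "g \<in> carrier G"
    have "\<sigma> (inv (h \<otimes> g)) * \<sigma> h = \<sigma> (inv g)"
      using g h s(2)[of "inv (h \<otimes> g)" h] by (simp add: inv_mult_group m_assoc)
    moreover have "\<rho> (h \<otimes> g) * Y * \<sigma> (inv (h \<otimes> g)) * \<sigma> h
        = \<rho> (h \<otimes> g) * Y * (\<sigma> (inv (h \<otimes> g)) * \<sigma> h)"
      using g h r(1)[of "h \<otimes> g"] s(1)[of "inv (h \<otimes> g)"] s(1)[of h] Y by (intro assoc_mult_mat) auto
    moreover have "\<rho> h * \<rho> g * Y * \<sigma> (inv g) = \<rho> h * (\<rho> g * Y * \<sigma> (inv g))"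
      using g h r(1)[of g] r(1)[of h] s(1)[of "inv g"] Y
      by (simp add: assoc_mult_mat[of _ n n _ n _ m] assoc_mult_mat[of _ n n _ m _ m])
    ultimately show "\<rho> (h \<otimes> g) * Y * \<sigma> (inv (h \<otimes> g)) * \<sigma> h = \<rho> h * (\<rho> g * Y * \<sigma> (inv g))"
      using r(2)[OF h g] by simp
  qed
  also have "\<dots> = \<rho> h * average n m \<rho> \<sigma> Y"
    unfolding average_def using r(1)[OF h] tc by (auto intro!: mult_mat_sum[symmetric])
  finally show ?thesis by simp
qed

text \<open>The trace detects that an average is nonzero: each summand contributes the same trace when it is
multiplied by an intertwiner in the opposite direction.\<close>

lemma trace_average_mult:
  assumes \<rho>: "complex_rep G n \<rho>" and \<sigma>: "complex_rep G m \<sigma>"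
    and Y: "Y \<in> carrier_mat m n" and X: "X \<in> carrier_mat n m"
    and comm: "\<And>g. g \<in> carrier G \<Longrightarrow> \<rho> g * X = X * \<sigma> g"
  shows "mat_trace (average m n \<sigma> \<rho> Y * X) = of_nat (card (carrier G)) * mat_trace (Y * X)"
proof -
  note r = complex_repD[OF \<rho>] and s = complex_repD[OF \<sigma>]
  have "mat_trace (average m n \<sigma> \<rho> Y * X)
      = (\<Sum>g\<in>carrier G. mat_trace (\<sigma> g * Y * \<rho> (inv g) * X))"
  proof -
    have "\<sigma> g * Y * \<rho> (inv g) \<in> carrier_mat m n" if "g \<in> carrier G" for g
      using r(1)[of "inv g"] s(1)[of g] that Y by simp
    then show ?thesis unfolding average_def using X
      by (subst mat_sum_mult[of _ _ m]) (auto intro!: trace_mat_sum intro: mult_carrier_mat[OF _ X])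
  qed
  also have "\<dots> = (\<Sum>g\<in>carrier G. mat_trace (Y * X))"
  proof (rule sum.cong)
    fix g assume g: "g \<in> carrier G"
    have "\<sigma> g * Y * \<rho> (inv g) * X = \<sigma> g * Y * (\<rho> (inv g) * X)"
      using g r(1)[of "inv g"] s(1)[of g] X Y by (intro assoc_mult_mat) auto
    also have "\<rho> (inv g) * X = X * \<sigma> (inv g)" using comm g by simp
    also have "\<sigma> g * Y * (X * \<sigma> (inv g)) = \<sigma> g * (Y * X) * \<sigma> (inv g)"
      using g s(1)[of "inv g"] s(1)[of g] X Y
      by (simp add: assoc_mult_mat[of _ m m _ n _ m] assoc_mult_mat[of _ m n _ m _ m] assoc_mult_mat[of _ m m _ m _ m])
    also have "mat_trace \<dots> = mat_trace (Y * X)"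
      using g s(1)[of "inv g"] s(1)[of g] X Y rep_inverse[OF \<sigma> g] by (intro trace_conj[of _ m]) auto
    finally show "mat_trace (\<sigma> g * Y * \<rho> (inv g) * X) = mat_trace (Y * X)" .
  qed simp
  finally show ?thesis by simp
qed

end

text \<open>The matrix units. Averages of matrix units have products of matrix coefficients as entries,
which is how orthogonality of coefficients follows from Schur's lemma.\<close>

definition elem_mat :: "nat \<Rightarrow> nat \<Rightarrow> nat \<Rightarrow> nat \<Rightarrow> complex mat" where
  "elem_mat r c k l = mat r c (\<lambda>(i, j). of_bool (i = k \<and> j = l))"

lemma elem_mat_carrier [simp]: "elem_mat r c k l \<in> carrier_mat r c"
  by (simp add: elem_mat_def)

lemma sandwich_elem_mat:
  assumes "A \<in> carrier_mat n r" "B \<in> carrier_mat c m" "i < n" "j < m" "k < r" "l < c"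
  shows "(A * elem_mat r c k l * B) $$ (i, j) = A $$ (i, k) * B $$ (l, j)"
proof -
  have *: "(A * elem_mat r c k l) $$ (i, b) = A $$ (i, k) * of_bool (b = l)" if "b < c" for b
  proof -
    have "(A * elem_mat r c k l) $$ (i, b) = (\<Sum>a<r. A $$ (i, a) * of_bool (a = k \<and> b = l))"
      using mult_index[OF assms(1) elem_mat_carrier assms(3) that, of k l] that by (simp add: elem_mat_def)
    also have "\<dots> = (\<Sum>a<r. if a = k then A $$ (i, k) * of_bool (b = l) else 0)"
      by (rule sum.cong) auto
    finally show ?thesis using assms(5) by simp
  qed
  have "(A * elem_mat r c k l * B) $$ (i, j) = (\<Sum>b<c. (A * elem_mat r c k l) $$ (i, b) * B $$ (b, j))"
    by (rule mult_index[of _ n c _ m]) (use assms in auto)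
  also have "\<dots> = (\<Sum>b<c. if b = l then A $$ (i, k) * B $$ (l, j) else 0)"
    by (rule sum.cong) (auto simp: *)
  finally show ?thesis using assms(6) by simp
qed

lemma trace_elem_mat_mult:
  assumes "X \<in> carrier_mat n m" "i < n" "j < m"
  shows "mat_trace (elem_mat m n j i * X) = X $$ (i, j)"
proof -
  have "mat_trace (elem_mat m n j i * X) = (\<Sum>a<m. (1\<^sub>m m * elem_mat m n j i * X) $$ (a, a))"
    by (simp only: left_mult_one_mat[OF elem_mat_carrier] trace_eq[OF mult_carrier_mat[OF elem_mat_carrier assms(1)]])
  also have "\<dots> = (\<Sum>a<m. if a = j then X $$ (i, j) else 0)"
  proof (rule sum.cong)
    fix a assume "a \<in> {..<m}"
    then show "(1\<^sub>m m * elem_mat m n j i * X) $$ (a, a) = (if a = j then X $$ (i, j) else 0)"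
      using assms sandwich_elem_mat[of "1\<^sub>m m" m m X n m a a j i] by auto
  qed simp
  finally show ?thesis using assms by simp
qed

context finite_group begin

text \<open>Images and dimensions are avoided: \<open>X\<close> is composed with an averaged matrix \<open>X'\<close> in the other
direction, chosen so that \<open>X' * X\<close> has nonzero trace. Both products are scalar by \<open>schur_scalar\<close>,
and the two scalars agree; so conjugating by \<open>X\<close> identifies the traces.\<close>

lemma schur_intertwiner:
  assumes \<rho>: "irreducible_rep G n \<rho>" and \<sigma>: "irreducible_rep G m \<sigma>"
    and X: "X \<in> carrier_mat n m" and nz: "X \<noteq> 0\<^sub>m n m"
    and comm: "\<And>g. g \<in> carrier G \<Longrightarrow> \<rho> g * X = X * \<sigma> g"
  shows "character_of G \<rho> = character_of G \<sigma>"
proof -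
  note \<rho>' = irreducibleD(1)[OF \<rho>] and \<sigma>' = irreducibleD(1)[OF \<sigma>]
  note r = complex_repD[OF \<rho>'] and s = complex_repD[OF \<sigma>']
  obtain i j where ij: "i < n" "j < m" "X $$ (i, j) \<noteq> 0"
    using nz X by (metis carrier_matD eq_matI index_zero_mat)
  \<comment> \<open>this matrix unit picks out the nonzero entry of \<open>X\<close> as the trace of the product\<close>
  define X' where "X' = average m n \<sigma> \<rho> (elem_mat m n j i)"
  have X': "X' \<in> carrier_mat m n" by (simp add: X'_def)
  have comm': "\<sigma> g * X' = X' * \<rho> g" if "g \<in> carrier G" for g
    unfolding X'_def by (rule average_intertwines[OF \<sigma>' \<rho>' _ that]) simp
  have tr: "mat_trace (X' * X) = of_nat (card (carrier G)) * X $$ (i, j)"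
    unfolding X'_def using trace_average_mult[OF \<rho>' \<sigma>' _ X comm] trace_elem_mat_mult[OF X ij(1,2)] by simp
  have trnz: "mat_trace (X' * X) \<noteq> 0" using tr ij card_pos by (metis mult_eq_0_iff of_nat_eq_0_iff less_irrefl)
  have "\<sigma> g * (X' * X) = X' * X * \<sigma> g" if g: "g \<in> carrier G" for g
  proof -
    have "\<sigma> g * (X' * X) = (\<sigma> g * X') * X" using s(1)[OF g] X X' by simp
    also have "\<dots> = X' * (\<rho> g * X)" unfolding comm'[OF g] using r(1)[OF g] X X' by (intro assoc_mult_mat)
    also have "\<dots> = X' * X * \<sigma> g" unfolding comm[OF g] using s(1)[OF g] X X' by simp
    finally show ?thesis .
  qed
  then obtain c where c: "X' * X = c \<cdot>\<^sub>m 1\<^sub>m m" using schur_scalar[OF \<sigma>, of "X' * X"] X X' by auto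
  have "\<rho> g * (X * X') = X * X' * \<rho> g" if g: "g \<in> carrier G" for g
  proof -
    have "\<rho> g * (X * X') = (\<rho> g * X) * X'" using r(1)[OF g] X X' by simp
    also have "\<dots> = X * (\<sigma> g * X')" unfolding comm[OF g] using s(1)[OF g] X X' by (intro assoc_mult_mat)
    also have "\<dots> = X * X' * \<rho> g" unfolding comm'[OF g] using r(1)[OF g] X X' by simp
    finally show ?thesis .
  qed
  then obtain c' where c': "X * X' = c' \<cdot>\<^sub>m 1\<^sub>m n" using schur_scalar[OF \<rho>, of "X * X'"] X X' by auto
  have c0: "c \<noteq> 0" using trnz c by (auto simp: trace_smult[of _ m] trace_one)
  have "c \<cdot>\<^sub>m X = X * (X' * X)" using X X' unfolding c by (simp add: scalar_mat_mult(2)[OF X])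
  also have "\<dots> = (X * X') * X" using X X' by simp
  also have "\<dots> = c' \<cdot>\<^sub>m X" using X X' unfolding c' by (simp add: scalar_mat_mult(1)[OF X])
  finally have "(c \<cdot>\<^sub>m X) $$ (i, j) = (c' \<cdot>\<^sub>m X) $$ (i, j)" by simp
  then have cc: "c' = c" using ij X by simp
  have "mat_trace (\<rho> g) = mat_trace (\<sigma> g)" if g: "g \<in> carrier G" for g
  proof -
    have "c * mat_trace (\<sigma> g) = mat_trace (X' * X * \<sigma> g)"
      unfolding c using s(1)[OF g] by (simp add: trace_smult[of _ m] scalar_mat_mult)
    also have "X' * X * \<sigma> g = X' * (\<rho> g * X)" unfolding comm[OF g] using s(1)[OF g] X X' by simp
    also have "mat_trace \<dots> = mat_trace (\<rho> g * X * X')"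
      using r(1)[OF g] X X' by (intro trace_mult_comm[of _ m n]) auto
    also have "\<rho> g * X * X' = \<rho> g * (X * X')" using r(1)[OF g] X X' by (intro assoc_mult_mat)
    also have "mat_trace \<dots> = c * mat_trace (\<rho> g)"
      unfolding c' cc using r(1)[OF g] by (simp add: trace_smult[of _ n] scalar_mat_mult)
    finally show ?thesis using c0 by simp
  qed
  then show ?thesis by (auto simp: character_of_def)
qed

section \<open>Characters and orthogonality of rows\<close>

lemma IrrE:
  assumes "\<psi> \<in> Irr G"
  obtains n \<rho> where "irreducible_rep G n \<rho>" "complex_rep G n \<rho>" "0 < n" "\<psi> = character_of G \<rho>" "\<psi> \<one> = of_nat n"
    "\<And>g. g \<in> carrier G \<Longrightarrow> \<psi> g = mat_trace (\<rho> g)"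
proof -
  obtain n \<rho> where *: "irreducible_rep G n \<rho>" "\<psi> = character_of G \<rho>" using assms by (auto simp: Irr_def)
  then show thesis
    using irreducibleD(1,2)[OF *(1)] complex_repD(3)[OF irreducibleD(1)[OF *(1)]]
    by (intro that[of n \<rho>]) (auto simp: character_of_def trace_one)
qed

lemma IrrI: "irreducible_rep G n \<rho> \<Longrightarrow> character_of G \<rho> \<in> Irr G"
  by (auto simp: Irr_def)

lemma char_conj:
  assumes "\<psi> \<in> Irr G" "g \<in> carrier G" "h \<in> carrier G"
  shows "\<psi> (h \<otimes> g \<otimes> inv h) = \<psi> g"
proof -
  obtain n \<rho> where \<rho>: "complex_rep G n \<rho>" and \<psi>: "\<And>g. g \<in> carrier G \<Longrightarrow> \<psi> g = mat_trace (\<rho> g)"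
    using IrrE[OF assms(1)] by metis
  note r = complex_repD[OF \<rho>]
  have "\<rho> (h \<otimes> g \<otimes> inv h) = \<rho> h * \<rho> g * \<rho> (inv h)" using assms r(2) by simp
  then show ?thesis
    using \<psi> assms trace_conj[OF r(1) r(1) r(1) rep_inverse(2)[OF \<rho>], of g h] by simp
qed

text \<open>Expanding both traces expresses the sum through entries of averages of matrix units. For
different characters these averages vanish, for equal ones they are scalar matrices of known trace.\<close>

theorem row_orthogonality:
  assumes "\<psi> \<in> Irr G" "\<phi> \<in> Irr G"
  shows "(\<Sum>g\<in>carrier G. \<psi> g * \<phi> (inv g)) = (if \<psi> = \<phi> then of_nat (card (carrier G)) else 0)"
proof -
  have expand: "(\<Sum>g\<in>carrier G. \<psi> g * \<phi> (inv g))
      = (\<Sum>i<n. \<Sum>j<m. average n m \<rho> \<sigma> (elem_mat n m i j) $$ (i, j))"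
    if \<rho>: "complex_rep G n \<rho>" and \<sigma>: "complex_rep G m \<sigma>"
      and \<psi>: "\<And>g. g \<in> carrier G \<Longrightarrow> \<psi> g = mat_trace (\<rho> g)"
      and \<phi>: "\<And>g. g \<in> carrier G \<Longrightarrow> \<phi> g = mat_trace (\<sigma> g)" for n m \<rho> \<sigma>
  proof -
    note r = complex_repD[OF \<rho>] and s = complex_repD[OF \<sigma>]
    have "(\<Sum>g\<in>carrier G. \<psi> g * \<phi> (inv g))
        = (\<Sum>g\<in>carrier G. \<Sum>i<n. \<Sum>j<m. \<rho> g $$ (i, i) * \<sigma> (inv g) $$ (j, j))"
      by (rule sum.cong) (auto simp: \<psi> \<phi> trace_eq[OF r(1)] trace_eq[OF s(1)] sum_product)
    also have "\<dots> = (\<Sum>i<n. \<Sum>g\<in>carrier G. \<Sum>j<m. \<rho> g $$ (i, i) * \<sigma> (inv g) $$ (j, j))"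
      by (rule sum.swap)
    also have "\<dots> = (\<Sum>i<n. \<Sum>j<m. \<Sum>g\<in>carrier G. \<rho> g $$ (i, i) * \<sigma> (inv g) $$ (j, j))"
      by (intro sum.cong refl sum.swap)
    also have "\<dots> = (\<Sum>i<n. \<Sum>j<m. average n m \<rho> \<sigma> (elem_mat n m i j) $$ (i, j))"
      by (intro sum.cong refl)
        (use r(1) s(1) in \<open>auto simp: average_def mat_sum_index sandwich_elem_mat[of _ n n _ m m] intro!: sum.cong\<close>)
    finally show ?thesis .
  qed
  obtain n \<rho> where \<rho>: "irreducible_rep G n \<rho>" "complex_rep G n \<rho>" "0 < n" "\<psi> = character_of G \<rho>"
    "\<And>g. g \<in> carrier G \<Longrightarrow> \<psi> g = mat_trace (\<rho> g)" using IrrE[OF assms(1)] by metis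
  obtain m \<sigma> where \<sigma>: "irreducible_rep G m \<sigma>" "complex_rep G m \<sigma>" "0 < m" "\<phi> = character_of G \<sigma>"
    "\<And>g. g \<in> carrier G \<Longrightarrow> \<phi> g = mat_trace (\<sigma> g)" using IrrE[OF assms(2)] by metis
  show ?thesis
  proof (cases "\<psi> = \<phi>")
    case False
    have zero: "average n m \<rho> \<sigma> Y = 0\<^sub>m n m" if Y: "Y \<in> carrier_mat n m" for Y
      using schur_intertwiner[OF \<rho>(1) \<sigma>(1) average_carrier _ average_intertwines[OF \<rho>(2) \<sigma>(2) Y]] False \<rho>(4) \<sigma>(4)
      by metis
    show ?thesis using expand[OF \<rho>(2) \<sigma>(2) \<rho>(5) \<sigma>(5)] False by (simp add: zero)
  next
    case True
    have entry: "average n n \<rho> \<rho> (elem_mat n n i j) $$ (i, j) = (if i = j then of_nat (card (carrier G)) / of_nat n else 0)"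
      if ij: "i < n" "j < n" for i j
    proof (cases "i = j")
      case ne: False
      obtain c where c: "average n n \<rho> \<rho> (elem_mat n n i j) = c \<cdot>\<^sub>m 1\<^sub>m n"
        using schur_scalar[OF \<rho>(1) average_carrier average_intertwines[OF \<rho>(2) \<rho>(2) elem_mat_carrier]] by metis
      then show ?thesis using ij ne by simp
    next
      case eq: True
      obtain c where c: "average n n \<rho> \<rho> (elem_mat n n i j) = c \<cdot>\<^sub>m 1\<^sub>m n"
        using schur_scalar[OF \<rho>(1) average_carrier average_intertwines[OF \<rho>(2) \<rho>(2) elem_mat_carrier]] by metis
      have "c * of_nat n = mat_trace (average n n \<rho> \<rho> (elem_mat n n i j) * 1\<^sub>m n)"
        unfolding c by (simp add: trace_smult[of _ n] trace_one)
      also have "\<dots> = of_nat (card (carrier G)) * mat_trace (elem_mat n n i j * 1\<^sub>m n)"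
        using complex_repD(1)[OF \<rho>(2)]
        by (intro trace_average_mult[OF \<rho>(2) \<rho>(2)]) (auto simp: left_mult_one_mat[of _ n n] right_mult_one_mat[of _ n n])
      also have "\<dots> = of_nat (card (carrier G))" using trace_elem_mat_mult[of "1\<^sub>m n" n n j i] ij eq by simp
      finally show ?thesis unfolding c using ij \<rho>(3) eq by (simp add: field_simps)
    qed
    have "(\<Sum>g\<in>carrier G. \<psi> g * \<phi> (inv g)) = (\<Sum>i<n. \<Sum>j<n. if i = j then of_nat (card (carrier G)) / of_nat n else 0)"
      using expand[OF \<rho>(2) \<rho>(2) \<rho>(5)] True \<rho>(5) by (auto simp: entry intro!: sum.cong)
    also have "\<dots> = of_nat (card (carrier G))" using \<rho>(3) by simp
    finally show ?thesis using True by simp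
  qed
qed

end

section \<open>Irreducible characters separate class functions\<close>

lemma sum_lessThan_split:
  fixes f :: "nat \<Rightarrow> 'b :: comm_monoid_add"
  assumes "d \<le> n"
  shows "sum f {..<n} = sum f {..<d} + (\<Sum>l<n - d. f (l + d))"
proof -
  have "sum f {..<d + k} = sum f {..<d} + (\<Sum>l<k. f (l + d))" for k
    by (induction k) (simp_all add: add.assoc add.commute[of _ d])
  from this[of "n - d"] show ?thesis using assms by simp
qed

context finite_group begin

text \<open>In a basis adapted to an invariant subspace all matrices become block triangular, and the diagonal
blocks are representations of smaller degree. Only traces matter here, so no invariant complement
is constructed.\<close>

lemma invariant_subspace_blocks:
  assumes rep: "complex_rep G n \<rho>" and inv: "invariant_subspace G n \<rho> W"
    and W: "W \<noteq> {0\<^sub>v n}" "W \<noteq> carrier_vec n"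
  obtains d e \<alpha> \<beta> where "d < n" "e < n" "complex_rep G d \<alpha>" "complex_rep G e \<beta>"
    "\<And>g. g \<in> carrier G \<Longrightarrow> mat_trace (\<rho> g) = mat_trace (\<alpha> g) + mat_trace (\<beta> g)"
proof -
  note r = complex_repD[OF rep]
  have sub: "VectorSpace.subspace class_ring W (module_vec TYPE(complex) n)"
    and stable: "\<And>g w. g \<in> carrier G \<Longrightarrow> w \<in> W \<Longrightarrow> \<rho> g *\<^sub>v w \<in> W"
    using inv by (auto simp: invariant_subspace_def)
  obtain P Q d where P: "P \<in> carrier_mat n n" and Q: "Q \<in> carrier_mat n n"
    and PQ: "P * Q = 1\<^sub>m n" and QP: "Q * P = 1\<^sub>m n" and d: "0 < d" "d < n"
    and zero: "\<And>w i. w \<in> W \<Longrightarrow> d \<le> i \<Longrightarrow> i < n \<Longrightarrow> (Q *\<^sub>v w) $ i = 0"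
    and basis: "\<And>j. j < d \<Longrightarrow> P *\<^sub>v unit_vec n j \<in> W"
    using adapted_basis[OF sub W] by metis
  define R where "R g = Q * \<rho> g * P" for g
  have Rc: "R g \<in> carrier_mat n n" if "g \<in> carrier G" for g
    using P Q r(1)[OF that] by (simp add: R_def)
  have R_mult: "R (g \<otimes> h) = R g * R h" if gh: "g \<in> carrier G" "h \<in> carrier G" for g h
  proof -
    note c = r(1)[OF gh(1)] r(1)[OF gh(2)]
    have "R g * R h = Q * \<rho> g * (P * Q) * \<rho> h * P"
      unfolding R_def using P Q c by (simp add: assoc_mult_mat[of _ n n _ n _ n])
    also have "\<dots> = Q * (\<rho> g * \<rho> h) * P"
      unfolding PQ using P Q c by (simp add: assoc_mult_mat[of _ n n _ n _ n])
    finally show ?thesis using r(2)[OF gh] by (simp add: R_def)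
  qed
  have R_one: "R \<one> = 1\<^sub>m n" using r(3) P Q QP by (simp add: R_def)
  have R_zero: "R g $$ (i, j) = 0" if g: "g \<in> carrier G" and ij: "d \<le> i" "i < n" "j < d" for g i j
  proof -
    note c = r(1)[OF g]
    have jn: "j < n" using ij d by simp
    have "R g $$ (i, j) = (R g *\<^sub>v unit_vec n j) $ i"
      using Rc[OF g] ij jn by (auto simp: mult_mat_vec_def)
    also have "R g *\<^sub>v unit_vec n j = Q *\<^sub>v (\<rho> g *\<^sub>v (P *\<^sub>v unit_vec n j))"
      unfolding R_def using P Q c
      by (simp add: assoc_mult_mat_vec[of _ n n _ n])
    also have "\<dots> $ i = 0" using zero[OF stable[OF g basis[OF ij(3)]] ij(1,2)] .
    finally show ?thesis .
  qed
  define \<alpha> where "\<alpha> g = mat d d (\<lambda>(i, j). R g $$ (i, j))" for g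
  define \<beta> where "\<beta> g = mat (n - d) (n - d) (\<lambda>(i, j). R g $$ (i + d, j + d))" for g
  have dn: "d \<le> n" using d by simp
  have R_entry: "R (g \<otimes> h) $$ (i, j) = (\<Sum>l<d. R g $$ (i, l) * R h $$ (l, j))
      + (\<Sum>l<n - d. R g $$ (i, l + d) * R h $$ (l + d, j))"
    if gh: "g \<in> carrier G" "h \<in> carrier G" and ij: "i < n" "j < n" for g h i j
    unfolding R_mult[OF gh] mult_index[OF Rc[OF gh(1)] Rc[OF gh(2)] ij] by (rule sum_lessThan_split[OF dn])
  have "complex_rep G d \<alpha>"
  proof (rule complex_repI)
    fix g h assume gh: "g \<in> carrier G" "h \<in> carrier G"
    show "\<alpha> (g \<otimes> h) = \<alpha> g * \<alpha> h"
    proof (rule eq_matI)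
      fix i j assume "i < dim_row (\<alpha> g * \<alpha> h)" "j < dim_col (\<alpha> g * \<alpha> h)"
      then have ij: "i < d" "j < d" by (auto simp: \<alpha>_def)
      have "\<alpha> (g \<otimes> h) $$ (i, j) = (\<Sum>l<d. R g $$ (i, l) * R h $$ (l, j))"
        using R_entry[OF gh, of i j] ij d R_zero[OF gh(2), of "_ + d" j] by (simp add: \<alpha>_def)
      also have "\<dots> = (\<alpha> g * \<alpha> h) $$ (i, j)"
        using ij by (subst mult_index[of _ d d _ d]) (auto simp: \<alpha>_def)
      finally show "\<alpha> (g \<otimes> h) $$ (i, j) = (\<alpha> g * \<alpha> h) $$ (i, j)" .
    qed (auto simp: \<alpha>_def)
  qed (use d in \<open>auto simp: \<alpha>_def R_one intro!: eq_matI\<close>)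
  moreover have "complex_rep G (n - d) \<beta>"
  proof (rule complex_repI)
    fix g h assume gh: "g \<in> carrier G" "h \<in> carrier G"
    show "\<beta> (g \<otimes> h) = \<beta> g * \<beta> h"
    proof (rule eq_matI)
      fix i j assume "i < dim_row (\<beta> g * \<beta> h)" "j < dim_col (\<beta> g * \<beta> h)"
      then have ij: "i < n - d" "j < n - d" by (auto simp: \<beta>_def)
      have "\<beta> (g \<otimes> h) $$ (i, j) = (\<Sum>l<n - d. R g $$ (i + d, l + d) * R h $$ (l + d, j + d))"
        using R_entry[OF gh, of "i + d" "j + d"] ij d R_zero[OF gh(1), of "i + d"] by (simp add: \<beta>_def)
      also have "\<dots> = (\<beta> g * \<beta> h) $$ (i, j)"
        using ij by (subst mult_index[of _ "n - d" "n - d" _ "n - d"]) (auto simp: \<beta>_def)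
      finally show "\<beta> (g \<otimes> h) $$ (i, j) = (\<beta> g * \<beta> h) $$ (i, j)" .
    qed (auto simp: \<beta>_def)
  qed (use d in \<open>auto simp: \<beta>_def R_one intro!: eq_matI\<close>)
  moreover have "mat_trace (\<rho> g) = mat_trace (\<alpha> g) + mat_trace (\<beta> g)" if g: "g \<in> carrier G" for g
  proof -
    have "mat_trace (\<rho> g) = (\<Sum>i<n. R g $$ (i, i))"
      using trace_conj[OF r(1)[OF g] P Q PQ] trace_eq[OF Rc[OF g]] by (simp add: R_def)
    also have "\<dots> = mat_trace (\<alpha> g) + mat_trace (\<beta> g)"
      unfolding sum_lessThan_split[OF dn] by (simp add: mat_trace_def \<alpha>_def \<beta>_def)
    finally show ?thesis .
  qed
  ultimately show thesis using d that[of d "n - d" \<alpha> \<beta>] by simp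
qed

text \<open>Every character is a sum of irreducible ones, by induction on the degree; orthogonality to the
irreducible characters passes to such sums.\<close>

lemma orthogonal_to_all_reps:
  assumes orth: "\<And>\<psi>. \<psi> \<in> Irr G \<Longrightarrow> (\<Sum>g\<in>carrier G. F g * \<psi> g) = 0"
    and rep: "complex_rep G n \<rho>"
  shows "(\<Sum>g\<in>carrier G. F g * mat_trace (\<rho> g)) = 0"
  using rep
proof (induction n arbitrary: \<rho> rule: less_induct)
  case (less n)
  consider "n = 0" | "irreducible_rep G n \<rho>"
    | W where "invariant_subspace G n \<rho> W" "W \<noteq> {0\<^sub>v n}" "W \<noteq> carrier_vec n"
    using less.prems by (auto simp: irreducible_rep_def)
  then show ?case
  proof cases
    case 1
    then have "mat_trace (\<rho> g) = 0" if "g \<in> carrier G" for g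
      using trace_eq[OF complex_repD(1)[OF less.prems that]] by simp
    then show ?thesis by (auto intro!: sum.neutral)
  next
    case 2
    from orth[OF IrrI[OF this]] show ?thesis by (simp add: character_of_def cong: sum.cong)
  next
    case 3
    obtain d e \<alpha> \<beta> where *: "d < n" "e < n" "complex_rep G d \<alpha>" "complex_rep G e \<beta>"
      "\<And>g. g \<in> carrier G \<Longrightarrow> mat_trace (\<rho> g) = mat_trace (\<alpha> g) + mat_trace (\<beta> g)"
      using invariant_subspace_blocks[OF less.prems 3] by metis
    show ?thesis using less.IH[OF *(1,3)] less.IH[OF *(2,4)]
      by (simp add: *(5) ring_distribs sum.distrib cong: sum.cong)
  qed
qed

text \<open>The group acts on its own elements by left multiplication, and only \<open>\<one>\<close> has fixed points.\<close>

lemma regular_rep: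
  obtains \<rho> where "complex_rep G (card (carrier G)) \<rho>"
    "\<And>g. g \<in> carrier G \<Longrightarrow> mat_trace (\<rho> g) = (if g = \<one> then of_nat (card (carrier G)) else 0)"
proof -
  let ?N = "card (carrier G)"
  obtain e where e: "bij_betw e {..<?N} (carrier G)"
    using ex_bij_betw_nat_finite[OF fin] by (auto simp: lessThan_atLeast0)
  have ec: "e i \<in> carrier G" if "i < ?N" for i using e that by (auto simp: bij_betw_def)
  have einj: "e i = e j \<longleftrightarrow> i = j" if "i < ?N" "j < ?N" for i j
    using e that by (auto simp: bij_betw_def inj_on_def)
  define \<rho> :: "'a \<Rightarrow> complex mat" where "\<rho> g = mat ?N ?N (\<lambda>(i, j). of_bool (e i = g \<otimes> e j))" for g
  have "complex_rep G ?N \<rho>"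
  proof (rule complex_repI)
    show "\<rho> \<one> = 1\<^sub>m ?N" using ec einj by (auto simp: \<rho>_def intro!: eq_matI)
    fix g h assume gh: "g \<in> carrier G" "h \<in> carrier G"
    show "\<rho> (g \<otimes> h) = \<rho> g * \<rho> h"
    proof (rule eq_matI)
      fix i j assume "i < dim_row (\<rho> g * \<rho> h)" "j < dim_col (\<rho> g * \<rho> h)"
      then have ij: "i < ?N" "j < ?N" by (auto simp: \<rho>_def)
      obtain k where k: "k < ?N" "e k = h \<otimes> e j"
        using e gh ec[OF ij(2)] unfolding bij_betw_def by (metis imageE lessThan_iff m_closed)
      have "(\<rho> g * \<rho> h) $$ (i, j) = (\<Sum>l<?N. of_bool (e i = g \<otimes> e l) * of_bool (e l = h \<otimes> e j))"
        using ij by (subst mult_index[of _ ?N ?N _ ?N]) (auto simp: \<rho>_def)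
      also have "\<dots> = (\<Sum>l<?N. if l = k then of_bool (e i = g \<otimes> e k) else 0)"
        by (rule sum.cong) (use k einj[OF _ k(1)] in auto)
      also have "\<dots> = of_bool (e i = g \<otimes> (h \<otimes> e j))" using k by simp
      finally show "\<rho> (g \<otimes> h) $$ (i, j) = (\<rho> g * \<rho> h) $$ (i, j)"
        using ij gh ec by (simp add: \<rho>_def m_assoc)
    qed (auto simp: \<rho>_def)
  qed (auto simp: \<rho>_def)
  moreover have "mat_trace (\<rho> g) = (if g = \<one> then of_nat ?N else 0)" if "g \<in> carrier G" for g
    using ec that by (auto simp: mat_trace_def \<rho>_def r_cancel_one' intro!: sum.neutral)
  ultimately show thesis by (rule that)
qed

text \<open>The regular character is supported at \<open>\<one>\<close>, so pairing with it reads off the value there.\<close>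

lemma orthogonal_to_Irr_imp_zero_at_one:
  assumes "\<And>\<psi>. \<psi> \<in> Irr G \<Longrightarrow> (\<Sum>g\<in>carrier G. F g * \<psi> g) = 0"
  shows "F \<one> = 0"
proof -
  obtain \<rho> where \<rho>: "complex_rep G (card (carrier G)) \<rho>"
    "\<And>g. g \<in> carrier G \<Longrightarrow> mat_trace (\<rho> g) = (if g = \<one> then of_nat (card (carrier G)) else 0)"
    using regular_rep by metis
  have "(\<Sum>g\<in>carrier G. F g * mat_trace (\<rho> g)) = F \<one> * of_nat (card (carrier G))"
    using \<rho>(2) by (simp add: if_distrib[of "\<lambda>x. F _ * x"] cong: sum.cong if_cong)
  then show ?thesis using orthogonal_to_all_reps[OF assms \<rho>(1)] one_closed by auto
qed

text \<open>The image under \<open>\<rho>\<close> of the element of the group algebra with coefficients \<open>f\<close>.\<close>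

definition rep_sum :: "nat \<Rightarrow> ('a \<Rightarrow> complex mat) \<Rightarrow> ('a \<Rightarrow> complex) \<Rightarrow> complex mat" where
  "rep_sum n \<rho> f = mat_sum n n (carrier G) (\<lambda>g. f g \<cdot>\<^sub>m \<rho> g)"

lemma rep_sum_carrier [simp]: "rep_sum n \<rho> f \<in> carrier_mat n n"
  by (simp add: rep_sum_def)

lemma rep_sum_index:
  assumes "complex_rep G n \<rho>" "i < n" "j < n"
  shows "rep_sum n \<rho> f $$ (i, j) = (\<Sum>g\<in>carrier G. f g * \<rho> g $$ (i, j))"
  unfolding rep_sum_def mat_sum_index[OF assms(2,3)]
proof (rule sum.cong)
  fix g assume "g \<in> carrier G"
  then have "\<rho> g \<in> carrier_mat n n" by (rule complex_repD(1)[OF assms(1)])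
  then show "(f g \<cdot>\<^sub>m \<rho> g) $$ (i, j) = f g * \<rho> g $$ (i, j)" using assms by simp
qed simp

lemma trace_rep_sum:
  assumes "complex_rep G n \<rho>"
  shows "mat_trace (rep_sum n \<rho> f) = (\<Sum>g\<in>carrier G. f g * mat_trace (\<rho> g))"
  unfolding rep_sum_def
  using complex_repD(1)[OF assms]
  by (subst trace_mat_sum) (auto intro!: sum.cong trace_smult[of _ n])

text \<open>An element of the group algebra is determined by its action on all irreducible representations:
its coefficient at \<open>u\<close> is the coefficient at \<open>\<one>\<close> of a translate, which is again killed by all
irreducible representations.\<close>

theorem group_algebra_faithful:
  assumes zero: "\<And>n \<rho>. irreducible_rep G n \<rho> \<Longrightarrow> rep_sum n \<rho> f = 0\<^sub>m n n" and u: "u \<in> carrier G"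
  shows "f u = 0"
proof -
  have "(\<Sum>g\<in>carrier G. f (g \<otimes> u) * \<psi> g) = 0" if \<psi>: "\<psi> \<in> Irr G" for \<psi>
  proof -
    obtain n \<rho> where \<rho>: "irreducible_rep G n \<rho>" "complex_rep G n \<rho>"
      "\<And>g. g \<in> carrier G \<Longrightarrow> \<psi> g = mat_trace (\<rho> g)" using IrrE[OF \<psi>] by metis
    note r = complex_repD[OF \<rho>(2)]
    have "(\<Sum>g\<in>carrier G. f (g \<otimes> u) * \<psi> g) = (\<Sum>g\<in>carrier G. f g * \<psi> (g \<otimes> inv u))"
      by (rule sum.reindex_bij_witness[where i = "\<lambda>g. g \<otimes> inv u" and j = "\<lambda>g. g \<otimes> u"])
        (use u in \<open>auto simp: m_assoc\<close>)
    also have "\<dots> = mat_trace (rep_sum n \<rho> f * \<rho> (inv u))"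
    proof -
      have "rep_sum n \<rho> f * \<rho> (inv u) = mat_sum n n (carrier G) (\<lambda>g. (f g \<cdot>\<^sub>m \<rho> g) * \<rho> (inv u))"
        unfolding rep_sum_def using r(1) u by (intro mat_sum_mult) auto
      also have "mat_trace \<dots> = (\<Sum>g\<in>carrier G. mat_trace ((f g \<cdot>\<^sub>m \<rho> g) * \<rho> (inv u)))"
        using r(1) u by (intro trace_mat_sum mult_carrier_mat[of _ n n]) auto
      also have "\<dots> = (\<Sum>g\<in>carrier G. f g * \<psi> (g \<otimes> inv u))"
      proof (rule sum.cong)
        fix g assume g: "g \<in> carrier G"
        have "(f g \<cdot>\<^sub>m \<rho> g) * \<rho> (inv u) = f g \<cdot>\<^sub>m \<rho> (g \<otimes> inv u)"
          using g u r(1)[OF g] r(1)[of "inv u"] r(2)[of g "inv u"] by (simp add: mult_smult_assoc_mat[of _ n n _ n])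
        then show "mat_trace ((f g \<cdot>\<^sub>m \<rho> g) * \<rho> (inv u)) = f g * \<psi> (g \<otimes> inv u)"
          using g u r(1)[of "g \<otimes> inv u"] \<rho>(3) by (simp add: trace_smult[of _ n])
      qed simp
      finally show ?thesis by simp
    qed
    also have "\<dots> = 0" using zero[OF \<rho>(1)] r(1)[of "inv u"] u by (simp add: trace_zero)
    finally show ?thesis .
  qed
  from orthogonal_to_Irr_imp_zero_at_one[OF this] show ?thesis using u by simp
qed

text \<open>Class functions are the central elements of the group algebra; Schur's lemma makes them act by
scalars, and the trace tells which.\<close>

lemma class_function_rep_sum_scalar:
  assumes irr: "irreducible_rep G n \<rho>"
    and f: "\<And>g h. g \<in> carrier G \<Longrightarrow> h \<in> carrier G \<Longrightarrow> f (h \<otimes> g \<otimes> inv h) = f g"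
  shows "rep_sum n \<rho> f = ((\<Sum>g\<in>carrier G. f g * mat_trace (\<rho> g)) / of_nat n) \<cdot>\<^sub>m 1\<^sub>m n"
proof -
  note \<rho> = irreducibleD(1)[OF irr]
  note r = complex_repD[OF \<rho>]
  have "\<rho> h * rep_sum n \<rho> f = rep_sum n \<rho> f * \<rho> h" if h: "h \<in> carrier G" for h
  proof -
    have b: "bij_betw (\<lambda>g. h \<otimes> g \<otimes> inv h) (carrier G) (carrier G)"
      by (rule bij_betwI[where g = "\<lambda>g. inv h \<otimes> g \<otimes> h"]) (use h in \<open>auto simp: m_assoc\<close>)
    have "rep_sum n \<rho> f * \<rho> h = mat_sum n n (carrier G) (\<lambda>g. f g \<cdot>\<^sub>m \<rho> g * \<rho> h)"
      unfolding rep_sum_def using r(1) h by (intro mat_sum_mult) auto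
    also have "\<dots> = mat_sum n n (carrier G) (\<lambda>g. f g \<cdot>\<^sub>m \<rho> (g \<otimes> h))"
      using r h by (intro mat_sum_cong) (simp add: mult_smult_assoc_mat[of _ n n _ n])
    also have "\<dots> = mat_sum n n (carrier G) (\<lambda>g. f (h \<otimes> g \<otimes> inv h) \<cdot>\<^sub>m \<rho> (h \<otimes> g \<otimes> inv h \<otimes> h))"
      by (rule mat_sum_reindex_bij[OF b, symmetric])
    also have "\<dots> = mat_sum n n (carrier G) (\<lambda>g. \<rho> h * (f g \<cdot>\<^sub>m \<rho> g))"
    proof (rule mat_sum_cong)
      fix g assume g: "g \<in> carrier G"
      have "h \<otimes> g \<otimes> inv h \<otimes> h = h \<otimes> g" using g h by (simp add: m_assoc)
      then show "f (h \<otimes> g \<otimes> inv h) \<cdot>\<^sub>m \<rho> (h \<otimes> g \<otimes> inv h \<otimes> h) = \<rho> h * (f g \<cdot>\<^sub>m \<rho> g)"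
        using f[OF g h] r(1)[OF g] r(1)[OF h] r(2)[OF h g] by (simp add: mult_smult_distrib)
    qed
    also have "\<dots> = \<rho> h * rep_sum n \<rho> f"
      unfolding rep_sum_def using r(1) h by (intro mult_mat_sum[symmetric]) auto
    finally show ?thesis by simp
  qed
  then obtain c where c: "rep_sum n \<rho> f = c \<cdot>\<^sub>m 1\<^sub>m n"
    using schur_scalar[OF irr rep_sum_carrier] by metis
  have "c * of_nat n = (\<Sum>g\<in>carrier G. f g * mat_trace (\<rho> g))"
    using trace_rep_sum[OF \<rho>, of f] unfolding c by (simp add: trace_smult[of _ n] trace_one)
  then have "c = (\<Sum>g\<in>carrier G. f g * mat_trace (\<rho> g)) / of_nat n"
    using irreducibleD(2)[OF irr] by (simp add: field_simps)
  then show ?thesis unfolding c by simp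
qed

lemma class_function_eq_zero:
  assumes f: "\<And>g h. g \<in> carrier G \<Longrightarrow> h \<in> carrier G \<Longrightarrow> f (h \<otimes> g \<otimes> inv h) = f g"
    and orth: "\<And>\<psi>. \<psi> \<in> Irr G \<Longrightarrow> (\<Sum>g\<in>carrier G. f g * \<psi> g) = 0"
    and u: "u \<in> carrier G"
  shows "f u = 0"
proof (rule group_algebra_faithful[OF _ u])
  fix n \<rho> assume irr: "irreducible_rep G n \<rho>"
  have "(\<Sum>g\<in>carrier G. f g * mat_trace (\<rho> g)) = 0"
    using orth[OF IrrI[OF irr]] by (simp add: character_of_def cong: sum.cong)
  then show "rep_sum n \<rho> f = 0\<^sub>m n n" using class_function_rep_sum_scalar[OF irr f] by auto
qed

text \<open>Multiplication in the group algebra is convolution of coefficients.\<close>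

lemma rep_sum_mult:
  assumes "complex_rep G n \<rho>"
  shows "rep_sum n \<rho> f * rep_sum n \<rho> h
    = rep_sum n \<rho> (\<lambda>x. \<Sum>y\<in>carrier G. f y * h (inv y \<otimes> x))"
proof (rule eq_matI)
  note r = complex_repD[OF assms]
  fix i j assume "i < dim_row (rep_sum n \<rho> (\<lambda>x. \<Sum>y\<in>carrier G. f y * h (inv y \<otimes> x)))"
    "j < dim_col (rep_sum n \<rho> (\<lambda>x. \<Sum>y\<in>carrier G. f y * h (inv y \<otimes> x)))"
  then have ij: "i < n" "j < n" by (auto simp: rep_sum_def)
  have "(rep_sum n \<rho> f * rep_sum n \<rho> h) $$ (i, j)
      = (\<Sum>l<n. (\<Sum>y\<in>carrier G. f y * \<rho> y $$ (i, l)) * (\<Sum>z\<in>carrier G. h z * \<rho> z $$ (l, j)))"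
    using ij by (subst mult_index[of _ n n _ n]) (auto simp: rep_sum_index[OF assms] intro!: sum.cong)
  also have "\<dots> = (\<Sum>l<n. \<Sum>y\<in>carrier G. \<Sum>z\<in>carrier G. f y * h z * (\<rho> y $$ (i, l) * \<rho> z $$ (l, j)))"
    by (simp add: sum_product ac_simps)
  also have "\<dots> = (\<Sum>y\<in>carrier G. \<Sum>l<n. \<Sum>z\<in>carrier G. f y * h z * (\<rho> y $$ (i, l) * \<rho> z $$ (l, j)))"
    by (rule sum.swap)
  also have "\<dots> = (\<Sum>y\<in>carrier G. \<Sum>z\<in>carrier G. \<Sum>l<n. f y * h z * (\<rho> y $$ (i, l) * \<rho> z $$ (l, j)))"
    by (intro sum.cong refl sum.swap)
  also have "\<dots> = (\<Sum>y\<in>carrier G. \<Sum>z\<in>carrier G. f y * h z * \<rho> (y \<otimes> z) $$ (i, j))"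
    by (intro sum.cong refl) (simp add: r(2) mult_index[OF r(1) r(1) ij] sum_distrib_left del: index_mult_mat(1))
  also have "\<dots> = (\<Sum>y\<in>carrier G. \<Sum>x\<in>carrier G. f y * h (inv y \<otimes> x) * \<rho> x $$ (i, j))"
  proof (rule sum.cong)
    fix y assume y: "y \<in> carrier G"
    show "(\<Sum>z\<in>carrier G. f y * h z * \<rho> (y \<otimes> z) $$ (i, j)) = (\<Sum>x\<in>carrier G. f y * h (inv y \<otimes> x) * \<rho> x $$ (i, j))"
      by (rule sum.reindex_bij_witness[where j = "\<lambda>z. y \<otimes> z" and i = "\<lambda>x. inv y \<otimes> x"])
        (use y in \<open>auto simp: m_assoc[symmetric]\<close>)
  qed simp
  also have "\<dots> = (\<Sum>x\<in>carrier G. \<Sum>y\<in>carrier G. f y * h (inv y \<otimes> x) * \<rho> x $$ (i, j))"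
    by (rule sum.swap)
  also have "\<dots> = rep_sum n \<rho> (\<lambda>x. \<Sum>y\<in>carrier G. f y * h (inv y \<otimes> x)) $$ (i, j)"
    using ij by (simp add: rep_sum_index[OF assms] sum_distrib_right)
  finally show "(rep_sum n \<rho> f * rep_sum n \<rho> h) $$ (i, j)
    = rep_sum n \<rho> (\<lambda>x. \<Sum>y\<in>carrier G. f y * h (inv y \<otimes> x)) $$ (i, j)" .
qed (auto simp: rep_sum_def)

section \<open>Orthogonality of columns\<close>

text \<open>Counting conjugating elements, and not the elements of centralizers or classes, gives column
orthogonality in one formula: the count is the order of the centralizer of \<open>x\<close> if \<open>x\<close> and \<open>y\<close> are
conjugate, and \<open>0\<close> otherwise.\<close>

definition conjugators :: "'a \<Rightarrow> 'a \<Rightarrow> 'a set" where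
  "conjugators x y = {g \<in> carrier G. g \<otimes> x \<otimes> inv g = y}"

lemma conj_eq_iff: "x \<in> carrier G \<Longrightarrow> y \<in> carrier G \<Longrightarrow> g \<in> carrier G \<Longrightarrow>
    g \<otimes> x \<otimes> inv g = y \<longleftrightarrow> x = inv g \<otimes> y \<otimes> g"
  by (auto simp: m_assoc)

text \<open>For fixed \<open>y\<close> both sides are class functions of \<open>x\<close>. By the orthogonality of rows they pair
equally with every irreducible character, so they coincide.\<close>

theorem column_orthogonality:
  assumes finI: "finite (Irr G)" and x: "x \<in> carrier G" and y: "y \<in> carrier G"
  shows "(\<Sum>\<psi>\<in>Irr G. \<psi> x * \<psi> (inv y)) = of_nat (card (conjugators x y))"
proof -
  define F where "F x = (\<Sum>\<psi>\<in>Irr G. \<psi> x * \<psi> (inv y)) - of_nat (card (conjugators x y))" for x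
  have card_cls: "card (conjugators (h \<otimes> x \<otimes> inv h) y) = card (conjugators x y)"
    if "x \<in> carrier G" "h \<in> carrier G" for x h
  proof (rule bij_betw_same_card[where f = "\<lambda>g. g \<otimes> h"], rule bij_betwI[where g = "\<lambda>g. g \<otimes> inv h"])
    have eq: "(g \<otimes> inv h) \<otimes> (h \<otimes> x \<otimes> inv h) \<otimes> inv (g \<otimes> inv h) = g \<otimes> x \<otimes> inv g"
      "g \<otimes> (h \<otimes> x \<otimes> inv h) \<otimes> inv g = (g \<otimes> h) \<otimes> x \<otimes> inv (g \<otimes> h)" if "g \<in> carrier G" for g
      using that \<open>x \<in> carrier G\<close> \<open>h \<in> carrier G\<close> by (simp_all add: inv_mult_group m_assoc)
    show "(\<lambda>g. g \<otimes> h) \<in> conjugators (h \<otimes> x \<otimes> inv h) y \<rightarrow> conjugators x y"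
      "(\<lambda>g. g \<otimes> inv h) \<in> conjugators x y \<rightarrow> conjugators (h \<otimes> x \<otimes> inv h) y"
      using eq that by (auto simp: conjugators_def)
  qed (use that in \<open>auto simp: conjugators_def m_assoc\<close>)
  have "F (inv (inv x)) = 0"
  proof (rule class_function_eq_zero[where f = "\<lambda>x. F (inv x)"])
    show "F (inv (h \<otimes> g \<otimes> inv h)) = F (inv g)" if gh: "g \<in> carrier G" "h \<in> carrier G" for g h
    proof -
      have "inv (h \<otimes> g \<otimes> inv h) = h \<otimes> inv g \<otimes> inv h" using gh by (simp add: inv_mult_group m_assoc)
      then show ?thesis using gh card_cls[of "inv g" h] by (simp add: F_def char_conj)
    qed
    fix \<phi> assume \<phi>: "\<phi> \<in> Irr G"
    have "(\<Sum>g\<in>carrier G. F (inv g) * \<phi> g) = (\<Sum>g\<in>carrier G. F g * \<phi> (inv g))"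
      by (rule sum.reindex_bij_witness[where i = "\<lambda>g. inv g" and j = "\<lambda>g. inv g"]) auto
    also have "\<dots> = (\<Sum>g\<in>carrier G. \<Sum>\<psi>\<in>Irr G. \<psi> (inv y) * (\<psi> g * \<phi> (inv g)))
        - (\<Sum>g\<in>carrier G. of_nat (card (conjugators g y)) * \<phi> (inv g))"
      by (simp add: F_def left_diff_distrib sum_subtractf sum_distrib_right) (simp add: ac_simps)
    also have "(\<Sum>g\<in>carrier G. \<Sum>\<psi>\<in>Irr G. \<psi> (inv y) * (\<psi> g * \<phi> (inv g)))
        = (\<Sum>\<psi>\<in>Irr G. \<psi> (inv y) * (\<Sum>g\<in>carrier G. \<psi> g * \<phi> (inv g)))"
      by (subst sum.swap) (simp add: sum_distrib_left)
    also have "\<dots> = (\<Sum>\<psi>\<in>Irr G. if \<psi> = \<phi> then \<phi> (inv y) * of_nat (card (carrier G)) else 0)"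
      by (rule sum.cong) (auto simp: row_orthogonality[OF _ \<phi>])
    also have "\<dots> = \<phi> (inv y) * of_nat (card (carrier G))" using finI \<phi> by simp
    also have "(\<Sum>g\<in>carrier G. of_nat (card (conjugators g y)) * \<phi> (inv g))
        = (\<Sum>g\<in>carrier G. \<Sum>h\<in>carrier G. if g = inv h \<otimes> y \<otimes> h then \<phi> (inv g) else 0)"
    proof (rule sum.cong)
      fix g assume g: "g \<in> carrier G"
      have "(\<Sum>h\<in>carrier G. if g = inv h \<otimes> y \<otimes> h then \<phi> (inv g) else 0)
          = of_nat (card {h \<in> carrier G. g = inv h \<otimes> y \<otimes> h}) * \<phi> (inv g)"
        unfolding sum.inter_filter[OF fin, symmetric] by (simp only: sum_constant)
      also have "{h \<in> carrier G. g = inv h \<otimes> y \<otimes> h} = conjugators g y"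
        unfolding conjugators_def using conj_eq_iff[OF g y] by blast
      finally show "of_nat (card (conjugators g y)) * \<phi> (inv g)
        = (\<Sum>h\<in>carrier G. if g = inv h \<otimes> y \<otimes> h then \<phi> (inv g) else 0)" by simp
    qed simp
    also have "\<dots> = (\<Sum>h\<in>carrier G. \<Sum>g\<in>carrier G. if g = inv h \<otimes> y \<otimes> h then \<phi> (inv g) else 0)"
      by (rule sum.swap)
    also have "\<dots> = (\<Sum>h\<in>carrier G. \<phi> (inv y))"
    proof (rule sum.cong)
      fix h assume h: "h \<in> carrier G"
      have "inv (inv h \<otimes> y \<otimes> h) = inv h \<otimes> inv y \<otimes> inv (inv h)"
        using h y by (simp add: inv_mult_group m_assoc)
      then have "\<phi> (inv (inv h \<otimes> y \<otimes> h)) = \<phi> (inv y)"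
        using char_conj[OF \<phi>, of "inv y" "inv h"] h y by simp
      then show "(\<Sum>g\<in>carrier G. if g = inv h \<otimes> y \<otimes> h then \<phi> (inv g) else 0) = \<phi> (inv y)"
        using h y by simp
    qed simp
    also have "\<phi> (inv y) * of_nat (card (carrier G)) - (\<Sum>h\<in>carrier G. \<phi> (inv y)) = 0" by simp
    finally show "(\<Sum>g\<in>carrier G. F (inv g) * \<phi> g) = 0" .
  qed (use x in auto)
  then show ?thesis using x by (simp add: F_def)
qed

section \<open>Multiplicities and degrees\<close>

text \<open>The quotient is the trace of the projection onto the vectors on which \<open>H\<close> acts through the inverse
of \<open>l\<close>, so it is a dimension.\<close>

lemma linear_character_multiplicity:
  assumes H: "subgroup H G" and l1: "l \<one> = 1"
    and lm: "\<And>x y. x \<in> H \<Longrightarrow> y \<in> H \<Longrightarrow> l (x \<otimes> y) = l x * l y"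
    and \<psi>: "\<psi> \<in> Irr G"
  shows "(\<Sum>h\<in>H. l h * \<psi> h) / of_nat (card H) \<in> \<nat>"
proof -
  obtain n \<rho> where \<rho>: "complex_rep G n \<rho>"
    "\<And>g. g \<in> carrier G \<Longrightarrow> \<psi> g = mat_trace (\<rho> g)" using IrrE[OF \<psi>] by metis
  note r = complex_repD[OF \<rho>(1)]
  have HG: "H \<subseteq> carrier G" using H by (rule subgroup.subset)
  then have finH: "finite H" using finite_subset fin by blast
  have H0: "card H > 0" using finH subgroup.one_closed[OF H] by (auto simp: card_gt_0_iff)
  define c where "c = 1 / (of_nat (card H) :: complex)"
  define E where "E = mat_sum n n H (\<lambda>h. (c * l h) \<cdot>\<^sub>m \<rho> h)"
  have Ec: "E \<in> carrier_mat n n" by (simp add: E_def)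
  have absorb: "(l k \<cdot>\<^sub>m \<rho> k) * E = E" if k: "k \<in> H" for k
  proof -
    have kG: "k \<in> carrier G" using k HG by auto
    have "(l k \<cdot>\<^sub>m \<rho> k) * E = mat_sum n n H (\<lambda>h. (l k \<cdot>\<^sub>m \<rho> k) * ((c * l h) \<cdot>\<^sub>m \<rho> h))"
      unfolding E_def using r(1) HG kG by (intro mult_mat_sum) auto
    also have "\<dots> = mat_sum n n H (\<lambda>h. (c * l (k \<otimes> h)) \<cdot>\<^sub>m \<rho> (k \<otimes> h))"
    proof (rule mat_sum_cong)
      fix h assume h: "h \<in> H"
      then have hG: "h \<in> carrier G" using HG by auto
      have "(l k \<cdot>\<^sub>m \<rho> k) * ((c * l h) \<cdot>\<^sub>m \<rho> h) = (l k * (c * l h)) \<cdot>\<^sub>m (\<rho> k * \<rho> h)"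
        using r(1)[OF hG] r(1)[OF kG]
        by (simp add: mult_smult_assoc_mat[of _ n n _ n] mult_smult_distrib[of _ n n _ n] smult_smult_mat ac_simps)
      then show "(l k \<cdot>\<^sub>m \<rho> k) * ((c * l h) \<cdot>\<^sub>m \<rho> h) = (c * l (k \<otimes> h)) \<cdot>\<^sub>m \<rho> (k \<otimes> h)"
        using lm[OF k h] r(2)[OF kG hG] by (simp add: ac_simps)
    qed
    also have "\<dots> = E" unfolding E_def
    proof (rule mat_sum_reindex_bij, rule bij_betwI[where g = "\<lambda>h. inv k \<otimes> h"])
      show "(\<lambda>h. k \<otimes> h) \<in> H \<rightarrow> H" "(\<lambda>h. inv k \<otimes> h) \<in> H \<rightarrow> H"
        using k subgroup.m_closed[OF H] subgroup.m_inv_closed[OF H] by auto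
    qed (use HG kG in auto)
    finally show ?thesis .
  qed
  have "E * E = mat_sum n n H (\<lambda>h. ((c * l h) \<cdot>\<^sub>m \<rho> h) * E)"
    using r(1) HG mat_sum_mult[OF Ec, of H "\<lambda>h. (c * l h) \<cdot>\<^sub>m \<rho> h" n] unfolding E_def by (simp add: subset_iff)
  also have "\<dots> = mat_sum n n H (\<lambda>h. c \<cdot>\<^sub>m E)"
  proof (rule mat_sum_cong)
    fix h assume h: "h \<in> H"
    then have "\<rho> h \<in> carrier_mat n n" using r(1) HG by auto
    then have "((c * l h) \<cdot>\<^sub>m \<rho> h) * E = c \<cdot>\<^sub>m ((l h \<cdot>\<^sub>m \<rho> h) * E)"
      using Ec by (simp add: mult_smult_assoc_mat[of _ n n _ n] smult_smult_mat)
    then show "((c * l h) \<cdot>\<^sub>m \<rho> h) * E = c \<cdot>\<^sub>m E" using absorb[OF h] by simp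
  qed
  also have "\<dots> = E"
    using Ec H0 by (intro eq_matI) (auto simp: mat_sum_index c_def)
  finally have "mat_trace E \<in> \<nat>" by (rule idempotent_trace_Nats[OF Ec])
  also have "mat_trace E = (\<Sum>h\<in>H. c * l h * \<psi> h)"
  proof -
    have "mat_trace E = (\<Sum>h\<in>H. mat_trace ((c * l h) \<cdot>\<^sub>m \<rho> h))"
      unfolding E_def using r(1) HG by (intro trace_mat_sum) auto
    also have "\<dots> = (\<Sum>h\<in>H. c * l h * \<psi> h)"
      by (rule sum.cong) (use r(1) HG \<rho>(2) in \<open>auto simp: trace_smult[of _ n] subset_iff\<close>)
    finally show ?thesis .
  qed
  also have "\<dots> = (\<Sum>h\<in>H. l h * \<psi> h) / of_nat (card H)"
    by (simp add: c_def sum_divide_distrib)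
  finally show ?thesis .
qed

text \<open>A nonzero subspace of a one-dimensional space is everything.\<close>

lemma trivial_in_Irr: "(\<lambda>g\<in>carrier G. 1) \<in> Irr G"
proof -
  define \<rho> :: "'a \<Rightarrow> complex mat" where "\<rho> g = 1\<^sub>m 1" for g
  have rep: "complex_rep G 1 \<rho>" by (rule complex_repI) (auto simp: \<rho>_def)
  have "W = {0\<^sub>v 1} \<or> W = carrier_vec 1" if W: "invariant_subspace G 1 \<rho> W" for W
  proof (rule disjCI)
    assume "W \<noteq> carrier_vec 1"
    have sub: "LinearCombinations.submodule class_ring W (module_vec TYPE(complex) 1)"
      using W by (simp add: invariant_subspace_def VectorSpace.subspace_def)
    have Wc: "W \<subseteq> carrier_vec 1"
      using submodule.subset[OF sub] by (simp add: module_vec_simps)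
    have zW: "0\<^sub>v 1 \<in> W"
      using submodule.zero_closed[OF sub] by (simp add: module_vec_simps)
    have sm: "c \<cdot>\<^sub>v w \<in> W" if "w \<in> W" for c w
      using submodule.smult_closed[OF sub, of c w] that by (simp add: module_vec_simps class_ring_simps)
    have "w = 0\<^sub>v 1" if w: "w \<in> W" for w
    proof (rule ccontr)
      assume "w \<noteq> 0\<^sub>v 1"
      moreover have dw: "dim_vec w = 1" using w Wc by auto
      moreover have "w = 0\<^sub>v 1" if "w $ 0 = 0" using that dw by (intro eq_vecI) auto
      ultimately have w0: "w $ 0 \<noteq> 0" by metis
      have "v \<in> W" if v: "v \<in> carrier_vec 1" for v
      proof -
        have "v = (v $ 0 / w $ 0) \<cdot>\<^sub>v w" using v dw w0 by (intro eq_vecI) auto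
        then show ?thesis using sm[OF w] by metis
      qed
      then show False using Wc \<open>W \<noteq> carrier_vec 1\<close> by (metis subsetI subset_antisym)
    qed
    then show "W = {0\<^sub>v 1}" using zW by (metis is_singletonI' is_singleton_the_elem singletonD empty_iff)
  qed
  moreover have "0 < (1 :: nat)" by simp
  ultimately have "irreducible_rep G 1 \<rho>"
    unfolding irreducible_rep_def using rep by (intro conjI allI impI)
  from IrrI[OF this] show ?thesis by (simp add: character_of_def \<rho>_def trace_one)
qed

lemma char_degree_eq: "\<psi> \<in> Irr G \<Longrightarrow> \<psi> \<one> = of_nat (char_degree G \<psi>)"
proof -
  assume "\<psi> \<in> Irr G"
  then obtain n where n: "\<psi> \<one> = of_nat n" using IrrE by metis
  then have "char_degree G \<psi> = n" unfolding char_degree_def by (intro the_equality) auto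
  then show ?thesis using n by simp
qed

lemma char_degree_pos: "\<psi> \<in> Irr G \<Longrightarrow> 0 < char_degree G \<psi>"
  by (metis IrrE char_degree_eq of_nat_eq_iff)

section \<open>Conjugacy classes and centralizers\<close>

lemma conj_class_eq: "conj_class G x = (\<lambda>g. g \<otimes> x \<otimes> inv g) ` carrier G"
  by (auto simp: conj_class_def orbit_def)

lemma conj_class_closed: "x \<in> carrier G \<Longrightarrow> conj_class G x \<subseteq> carrier G"
  by (auto simp: conj_class_eq)

lemma conj_class_self: "x \<in> carrier G \<Longrightarrow> x \<in> conj_class G x"
  unfolding conj_class_eq by (rule image_eqI[where x = \<one>]) auto

lemma conj_class_conj:
  assumes "x \<in> carrier G" "y \<in> conj_class G x" "g \<in> carrier G"
  shows "g \<otimes> y \<otimes> inv g \<in> conj_class G x"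
proof -
  obtain h where h: "h \<in> carrier G" "y = h \<otimes> x \<otimes> inv h" using assms by (auto simp: conj_class_eq)
  then have "g \<otimes> y \<otimes> inv g = (g \<otimes> h) \<otimes> x \<otimes> inv (g \<otimes> h)" using assms by (simp add: inv_mult_group m_assoc)
  then show ?thesis using h assms by (auto simp: conj_class_eq)
qed

lemma conj_class_sym:
  assumes "x \<in> carrier G" "y \<in> conj_class G x"
  shows "x \<in> conj_class G y"
proof -
  obtain h where h: "h \<in> carrier G" "y = h \<otimes> x \<otimes> inv h" using assms by (auto simp: conj_class_eq)
  then have "x = inv h \<otimes> y \<otimes> inv (inv h)" using assms by (simp add: m_assoc)
  then show ?thesis using h unfolding conj_class_eq by (intro image_eqI[where x = "inv h"]) auto
qed

lemma conj_class_eqI: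
  assumes "x \<in> carrier G" "y \<in> conj_class G x"
  shows "conj_class G y = conj_class G x"
proof -
  have sub: "conj_class G y \<subseteq> conj_class G x" if "x \<in> carrier G" "y \<in> conj_class G x" for x y
    using that conj_class_conj by (auto simp: conj_class_eq[of y])
  have "y \<in> carrier G" using assms conj_class_closed by auto
  then show ?thesis using sub[OF assms] sub[OF _ conj_class_sym[OF assms]] by auto
qed

lemma conj_class_one: "conj_class G \<one> = {\<one>}"
  by (auto simp: conj_class_eq)

lemma one_notin_conj_class: "x \<in> carrier G \<Longrightarrow> x \<noteq> \<one> \<Longrightarrow> \<one> \<notin> conj_class G x"
  using conj_class_sym conj_class_one by blast

lemma char_conj_class: "\<psi> \<in> Irr G \<Longrightarrow> x \<in> carrier G \<Longrightarrow> y \<in> conj_class G x \<Longrightarrow> \<psi> y = \<psi> x"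
  by (auto simp: conj_class_eq char_conj)

lemma conjugators_nonempty_iff: "conjugators x y \<noteq> {} \<longleftrightarrow> y \<in> conj_class G x"
  by (auto simp: conjugators_def conj_class_eq)

lemma finite_conjugators [simp]: "finite (conjugators x y)"
  by (simp add: conjugators_def)

lemma card_conjugators_one:
  assumes "y \<in> carrier G"
  shows "card (conjugators \<one> y) = (if y = \<one> then card (carrier G) else 0)"
proof -
  have "conjugators \<one> y = (if y = \<one> then carrier G else {})" by (auto simp: conjugators_def)
  then show ?thesis by simp
qed

lemma card_conjugators_eq:
  assumes x: "x \<in> carrier G" and y: "y \<in> conj_class G x"
  shows "card (conjugators x y) = card (conjugators x x)"
proof -
  obtain h where h: "h \<in> carrier G" "y = h \<otimes> x \<otimes> inv h" using y by (auto simp: conj_class_eq)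
  show ?thesis
  proof (rule bij_betw_same_card[where f = "\<lambda>g. inv h \<otimes> g"], rule bij_betwI[where g = "\<lambda>g. h \<otimes> g"])
    show "(\<lambda>g. h \<otimes> g) \<in> conjugators x x \<rightarrow> conjugators x y"
    proof
      fix g assume "g \<in> conjugators x x"
      then have g: "g \<in> carrier G" "g \<otimes> x \<otimes> inv g = x" by (auto simp: conjugators_def)
      have "h \<otimes> g \<otimes> x \<otimes> inv (h \<otimes> g) = h \<otimes> (g \<otimes> x \<otimes> inv g) \<otimes> inv h"
        using g(1) h x by (simp add: inv_mult_group m_assoc)
      then show "h \<otimes> g \<in> conjugators x y" using g h by (simp add: conjugators_def)
    qed
    show "(\<lambda>g. inv h \<otimes> g) \<in> conjugators x y \<rightarrow> conjugators x x"
    proof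
      fix g assume "g \<in> conjugators x y"
      then have g: "g \<in> carrier G" "g \<otimes> x \<otimes> inv g = h \<otimes> x \<otimes> inv h" using h by (auto simp: conjugators_def)
      have "inv h \<otimes> g \<otimes> x \<otimes> inv (inv h \<otimes> g) = inv h \<otimes> (g \<otimes> x \<otimes> inv g) \<otimes> h"
        using g(1) h x by (simp add: inv_mult_group m_assoc)
      then show "inv h \<otimes> g \<in> conjugators x x" unfolding g(2) using g(1) h x by (simp add: conjugators_def m_assoc)
    qed
  qed (use h in \<open>auto simp: conjugators_def\<close>)
qed

text \<open>Orbit and stabilizer for conjugation: the group elements are sorted by where they send \<open>x\<close>, and
all fibres are cosets of the centralizer.\<close>

lemma card_class_mult_centralizer:
  assumes x: "x \<in> carrier G"
  shows "card (conj_class G x) * card (conjugators x x) = card (carrier G)"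
proof -
  have "card (carrier G) = (\<Sum>y\<in>conj_class G x. \<Sum>g\<in>{g \<in> carrier G. g \<otimes> x \<otimes> inv g = y}. 1)"
    unfolding conj_class_eq sum.image_gen[OF fin, symmetric] by simp
  also have "\<dots> = (\<Sum>y\<in>conj_class G x. card (conjugators x x))"
    by (rule sum.cong) (simp_all add: card_conjugators_eq[OF x] flip: conjugators_def)
  finally show ?thesis by simp
qed

section \<open>Orders of elements and equal class sizes\<close>

lemma subgroup_finite_group:
  assumes "subgroup H G"
  shows "finite_group (G\<lparr>carrier := H\<rparr>)"
proof -
  have "finite H" using finite_subset[OF subgroup.subset[OF assms] fin] .
  then show ?thesis unfolding finite_group_def finite_group_axioms_def
    using subgroup_imp_group[OF assms] by simp
qed

lemma subgroup_nat_pow_closed: "subgroup H G \<Longrightarrow> x \<in> H \<Longrightarrow> x [^] (n :: nat) \<in> H"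
  by (induction n) (auto simp: subgroup.one_closed subgroup.m_closed)

lemma pow_card_subgroup:
  assumes H: "subgroup H G" and x: "x \<in> H"
  shows "x [^] card H = \<one>"
proof -
  interpret H: group "G\<lparr>carrier := H\<rparr>" by (rule subgroup_imp_group[OF H])
  have "x [^]\<^bsub>G\<lparr>carrier := H\<rparr>\<^esub> Coset.order (G\<lparr>carrier := H\<rparr>) = \<one>"
    using H.pow_order_eq_1[of x] x by simp
  then show ?thesis by (simp add: Coset.order_def flip: nat_pow_consistent)
qed

lemma ord_dvd_card_subgroup: "subgroup H G \<Longrightarrow> x \<in> H \<Longrightarrow> ord x dvd card H"
  using pow_card_subgroup pow_eq_id subgroup.mem_carrier by metis

text \<open>Cauchy's theorem, as the case of exponent one in the existence part of Sylow's theorem.\<close>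

lemma cauchy_subgroup:
  assumes H: "subgroup H G" and q: "prime q" "q dvd card H"
  obtains x where "x \<in> H" "x \<noteq> \<one>" "x [^] q = \<one>"
proof -
  interpret H: finite_group "G\<lparr>carrier := H\<rparr>" by (rule subgroup_finite_group[OF H])
  obtain k where "card H = q ^ 1 * k" using q by auto
  then obtain Q where Q: "subgroup Q (G\<lparr>carrier := H\<rparr>)" "card Q = q ^ 1"
    using sylow_thm[OF q(1) H.is_group, of 1 k] H.fin by (auto simp: Coset.order_def)
  have sub: "subgroup Q G" using Q(1) H incl_subgroup by blast
  have "card Q > 1" using Q(2) prime_gt_1_nat[OF q(1)] by simp
  then have "\<not> Q \<subseteq> {\<one>}" using card_mono[of "{\<one>}" Q] by auto
  then obtain x where x: "x \<in> Q" "x \<noteq> \<one>" by auto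
  then show thesis
    using that[of x] subgroup.subset[OF Q(1)] pow_card_subgroup[OF sub x(1)] Q(2) by auto
qed

lemma conj_pow:
  assumes "g \<in> carrier G" "x \<in> carrier G"
  shows "(g \<otimes> x \<otimes> inv g) [^] (n :: nat) = g \<otimes> x [^] n \<otimes> inv g"
  using assms by (induction n) (simp_all add: m_assoc)

lemma conj_class_pow_eq_one:
  assumes x: "x \<in> carrier G" and y: "y \<in> conj_class G x" and "x [^] (n :: nat) = \<one>"
  shows "y [^] n = \<one>"
  using assms by (auto simp: conj_class_eq conj_pow)

lemma centralizer_subgroup:
  assumes x: "x \<in> carrier G"
  shows "subgroup (conjugators x x) G"
proof (rule subgroupI)
  show "conjugators x x \<noteq> {}" using x by (auto simp: conjugators_def intro!: exI[of _ \<one>])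
  show "inv g \<in> conjugators x x" if "g \<in> conjugators x x" for g
    using that x conj_eq_iff[of x x g] by (auto simp: conjugators_def)
  show "g \<otimes> h \<in> conjugators x x" if "g \<in> conjugators x x" "h \<in> conjugators x x" for g h
  proof -
    have g: "g \<in> carrier G" "g \<otimes> x \<otimes> inv g = x" and h: "h \<in> carrier G" "h \<otimes> x \<otimes> inv h = x"
      using that by (auto simp: conjugators_def)
    have "g \<otimes> h \<otimes> x \<otimes> inv (g \<otimes> h) = g \<otimes> (h \<otimes> x \<otimes> inv h) \<otimes> inv g"
      using g(1) h(1) x by (simp add: inv_mult_group m_assoc)
    then show ?thesis using g h by (simp add: conjugators_def)
  qed
qed (auto simp: conjugators_def)

lemma conjugators_self_iff:
  assumes "x \<in> carrier G"
  shows "g \<in> conjugators x x \<longleftrightarrow> g \<in> carrier G \<and> g \<otimes> x = x \<otimes> g"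
proof -
  have "g \<otimes> x \<otimes> inv g = x \<longleftrightarrow> g \<otimes> x = x \<otimes> g" if "g \<in> carrier G"
  proof
    assume "g \<otimes> x \<otimes> inv g = x"
    then have "g \<otimes> x \<otimes> inv g \<otimes> g = x \<otimes> g" by simp
    then show "g \<otimes> x = x \<otimes> g" using assms that by (simp add: m_assoc)
  next
    assume "g \<otimes> x = x \<otimes> g"
    then show "g \<otimes> x \<otimes> inv g = x" using assms that by (simp add: m_assoc)
  qed
  then show ?thesis by (auto simp: conjugators_def)
qed

text \<open>The common size \<open>s\<close> of the nontrivial classes divides the number of nontrivial elements, since
the classes partition them, and it divides the order of the group. These numbers are
consecutive, so \<open>s = 1\<close>.\<close>

lemma equal_class_sizes_imp_comm:
  assumes size: "\<And>x. x \<in> carrier G \<Longrightarrow> x \<noteq> \<one> \<Longrightarrow> card (conj_class G x) = s"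
    and x: "x \<in> carrier G" and y: "y \<in> carrier G"
  shows "x \<otimes> y = y \<otimes> x"
proof (cases "y = \<one>")
  case False
  let ?C = "conj_class G ` (carrier G - {\<one>})"
  have Un: "\<Union>?C = carrier G - {\<one>}"
    using conj_class_self conj_class_closed one_notin_conj_class by blast
  have "s * card ?C = card (\<Union>?C)"
  proof (rule card_partition)
    show "c1 \<inter> c2 = {}" if c: "c1 \<in> ?C" "c2 \<in> ?C" "c1 \<noteq> c2" for c1 c2
    proof (rule ccontr)
      obtain x1 x2 where x12: "x1 \<in> carrier G" "c1 = conj_class G x1" "x2 \<in> carrier G" "c2 = conj_class G x2"
        using c by auto
      assume "c1 \<inter> c2 \<noteq> {}"
      then obtain z where "z \<in> c1" "z \<in> c2" by auto
      then have "c1 = c2"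
        unfolding x12(2,4) using conj_class_eqI[OF x12(1)] conj_class_eqI[OF x12(3)] by metis
      then show False using c(3) by contradiction
    qed
  qed (use size Un in auto)
  then have "s dvd card (carrier G) - 1" unfolding Un by (metis card_Diff_singleton dvd_triv_left one_closed)
  moreover have "s dvd card (carrier G)"
    using card_class_mult_centralizer[OF y] size[OF y False] by (metis dvd_triv_left)
  moreover have "card (carrier G) - (card (carrier G) - 1) = 1" using card_pos by linarith
  ultimately have "s = 1" using dvd_diff_nat[of s "card (carrier G)" "card (carrier G) - 1"] by simp
  then have "conj_class G y = {y}"
    using size[OF y False] conj_class_self[OF y] by (metis card_1_singletonE singletonD)
  moreover have "x \<otimes> y \<otimes> inv x \<in> conj_class G y"
    unfolding conj_class_eq using x by (rule imageI)
  ultimately have "x \<otimes> y \<otimes> inv x = y" by (simp only: singleton_iff)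
  then have "x \<in> conjugators y y" using x by (simp add: conjugators_def)
  then show ?thesis using conjugators_self_iff[OF y] by simp
qed (use x in simp)

section \<open>Complements of abelian normal subgroups\<close>

text \<open>The abelian case of the theorem of Schur and Zassenhaus. Let \<open>t\<close> choose a representative in each
left coset of \<open>N\<close> and let \<open>T\<close> be the set of representatives. The product \<open>d g\<close> over \<open>x\<in>T\<close> of the
factors \<open>g \<otimes> x \<otimes> inv (t (g \<otimes> x))\<close>, which lie in \<open>N\<close>, satisfies
\<open>d (g \<otimes> h) = (g \<otimes> d h \<otimes> inv g) \<otimes> d g\<close>, and \<open>d n = n [^] card T\<close> for \<open>n \<in> N\<close>. Since \<open>card T\<close> is
prime to \<open>card N\<close>, the crossed homomorphism \<open>d\<close> is a bijection on \<open>N\<close>, so the elements with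
\<open>d g = \<one>\<close> form a subgroup that meets every coset of \<open>N\<close> exactly once.\<close>

theorem abelian_normal_complement:
  assumes N: "subgroup N G" and norm: "\<And>g n. g \<in> carrier G \<Longrightarrow> n \<in> N \<Longrightarrow> g \<otimes> n \<otimes> inv g \<in> N"
    and comm: "\<And>x y. x \<in> N \<Longrightarrow> y \<in> N \<Longrightarrow> x \<otimes> y = y \<otimes> x"
    and cop: "coprime (card N) (card (carrier G) div card N)"
  obtains H where "subgroup H G" "H \<inter> N = {\<one>}"
    "\<And>g. g \<in> carrier G \<Longrightarrow> \<exists>n\<in>N. \<exists>h\<in>H. g = n \<otimes> h"
proof -
  let ?M = "G\<lparr>carrier := N\<rparr>"
  interpret M: comm_group ?M
    using subgroup_imp_group[OF N] comm by (intro group.group_comm_groupI) auto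
  have NG: "x \<in> carrier G" if "x \<in> N" for x using subgroup.mem_carrier[OF N that] .
  have finN: "finite N" using finite_subset[OF subgroup.subset[OF N] fin] .
  define t where "t g = (SOME y. y \<in> g <# N)" for g
  define T where "T = t ` carrier G"
  have t_mem: "t g \<in> g <# N" if "g \<in> carrier G" for g
  proof -
    have "g \<in> g <# N" using that subgroup.one_closed[OF N] by (force simp: l_coset_def)
    then show ?thesis unfolding t_def by (rule someI)
  qed
  have t_obtain: "\<exists>n\<in>N. t g = g \<otimes> n" if "g \<in> carrier G" for g
    using t_mem[OF that] by (auto simp: l_coset_def)
  have t_closed: "t g \<in> carrier G" if "g \<in> carrier G" for g
    using t_obtain[OF that] NG that by auto
  have t_cong: "t (g \<otimes> n) = t g" if "g \<in> carrier G" "n \<in> N" for g n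
  proof -
    have "g \<otimes> n \<in> g <# N" using that by (auto simp: l_coset_def)
    then have "g <# N = (g \<otimes> n) <# N" using l_repr_independence[OF _ that(1) N] by blast
    then show ?thesis by (simp add: t_def)
  qed
  have t_idem: "t (t g) = t g" if "g \<in> carrier G" for g
    using t_obtain[OF that] t_cong[OF that] by auto
  have t_T: "t x = x" if "x \<in> T" for x using that t_idem by (auto simp: T_def)
  have TG: "x \<in> carrier G" if "x \<in> T" for x using that t_closed by (auto simp: T_def)
  have finT: "finite T" by (simp add: T_def)
  have t_mult: "t (g \<otimes> t h) = t (g \<otimes> h)" if g: "g \<in> carrier G" and h: "h \<in> carrier G" for g h
  proof -
    obtain n where n: "n \<in> N" "t h = h \<otimes> n" using t_obtain[OF h] by auto
    then show ?thesis using t_cong[of "g \<otimes> h" n] g h NG by (simp add: m_assoc)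
  qed
  have card_T: "card T * card N = card (carrier G)"
  proof -
    have "card {g \<in> carrier G. t g = x} = card N" if x: "x \<in> T" for x
    proof (rule bij_betw_same_card[where f = "\<lambda>g. inv x \<otimes> g"], rule bij_betwI[where g = "\<lambda>n. x \<otimes> n"])
      show "(\<lambda>n. x \<otimes> n) \<in> N \<rightarrow> {g \<in> carrier G. t g = x}"
        using TG[OF x] NG t_cong t_T[OF x] by auto
      show "(\<lambda>g. inv x \<otimes> g) \<in> {g \<in> carrier G. t g = x} \<rightarrow> N"
      proof
        fix g assume "g \<in> {g \<in> carrier G. t g = x}"
        then have g: "g \<in> carrier G" "t g = x" by auto
        then obtain n where n: "n \<in> N" "x = g \<otimes> n" using t_obtain by auto
        then have "inv x \<otimes> g = inv n" using g NG by (simp add: inv_mult_group m_assoc)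
        then show "inv x \<otimes> g \<in> N" using n subgroup.m_inv_closed[OF N] by simp
      qed
    qed (use TG[OF x] NG in auto)
    moreover have "card (carrier G) = (\<Sum>x\<in>T. \<Sum>g\<in>{g \<in> carrier G. t g = x}. 1)"
      unfolding T_def sum.image_gen[OF fin, symmetric] by simp
    ultimately show ?thesis by simp
  qed
  define f where "f g x = g \<otimes> x \<otimes> inv (t (g \<otimes> x))" for g x
  have f_mem: "f g x \<in> N" if gx: "g \<in> carrier G" "x \<in> carrier G" for g x
  proof -
    obtain n where n: "n \<in> N" "t (g \<otimes> x) = g \<otimes> x \<otimes> n" using t_obtain[of "g \<otimes> x"] gx by auto
    have "f g x = (g \<otimes> x) \<otimes> inv n \<otimes> inv (g \<otimes> x)"
      unfolding f_def n(2) using gx n(1) NG by (simp add: inv_mult_group m_assoc)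
    then show ?thesis using norm[of "g \<otimes> x" "inv n"] n subgroup.m_inv_closed[OF N] gx by simp
  qed
  define d where "d g = finprod ?M (f g) T" for g
  have d_mem: "d g \<in> N" if "g \<in> carrier G" for g
    using M.finprod_closed[of "f g" T] f_mem[OF that] TG by (auto simp: d_def)
  have conj_prod: "finprod ?M (\<lambda>x. g \<otimes> u x \<otimes> inv g) A = g \<otimes> finprod ?M u A \<otimes> inv g"
    if g: "g \<in> carrier G" and u: "u \<in> A \<rightarrow> N" and A: "finite A" for g u and A :: "'a set"
    using A u
  proof (induction A)
    case (insert a A)
    have uN: "u \<in> A \<rightarrow> N" "u a \<in> N" using insert.prems by auto
    then have fN: "finprod ?M u A \<in> N" using M.finprod_closed[of u A] by simp
    have "finprod ?M (\<lambda>x. g \<otimes> u x \<otimes> inv g) (insert a A)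
        = (g \<otimes> u a \<otimes> inv g) \<otimes> (g \<otimes> finprod ?M u A \<otimes> inv g)"
      using insert uN norm[OF g] by (subst M.finprod_insert) auto
    also have "\<dots> = g \<otimes> (u a \<otimes> finprod ?M u A) \<otimes> inv g"
      using g NG[OF uN(2)] NG[OF fN] by (simp add: m_assoc)
    also have "u a \<otimes> finprod ?M u A = finprod ?M u (insert a A)"
      using insert uN by (subst M.finprod_insert) auto
    finally show ?case .
  qed (use g in simp)
  have d_mult: "d (g \<otimes> h) = g \<otimes> d h \<otimes> inv g \<otimes> d g" if g: "g \<in> carrier G" and h: "h \<in> carrier G" for g h
  proof -
    \<comment> \<open>left multiplication by \<open>h\<close> permutes the cosets, hence the representatives\<close>
    have bij: "bij_betw (\<lambda>x. t (h \<otimes> x)) T T"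
    proof (rule bij_betwI[where g = "\<lambda>x. t (inv h \<otimes> x)"])
      show "t (inv h \<otimes> t (h \<otimes> x)) = x" if "x \<in> T" for x
        using t_mult[of "inv h" "h \<otimes> x"] h TG[OF that] t_T[OF that] by simp
      show "t (h \<otimes> t (inv h \<otimes> x)) = x" if "x \<in> T" for x
        using t_mult[of h "inv h \<otimes> x"] h TG[OF that] t_T[OF that] by simp
    qed (use h TG in \<open>auto simp: T_def\<close>)
    have step: "f (g \<otimes> h) x = (g \<otimes> f h x \<otimes> inv g) \<otimes> f g (t (h \<otimes> x))" if x: "x \<in> T" for x
    proof -
      have "t (g \<otimes> t (h \<otimes> x)) = t (g \<otimes> h \<otimes> x)" using t_mult[of g "h \<otimes> x"] g h TG[OF x] by (simp add: m_assoc)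
      then show ?thesis
        unfolding f_def using g h TG[OF x] t_closed[of "h \<otimes> x"] t_closed[of "g \<otimes> h \<otimes> x"] by (simp add: m_assoc)
    qed
    have "d (g \<otimes> h) = finprod ?M (\<lambda>x. (g \<otimes> f h x \<otimes> inv g) \<otimes>\<^bsub>?M\<^esub> f g (t (h \<otimes> x))) T"
      unfolding d_def using f_mem norm g h TG t_closed
      by (intro M.finprod_cong') (auto simp: step intro!: subgroup.m_closed[OF N, of "_ \<otimes> _ \<otimes> inv _"])
    also have "\<dots> = finprod ?M (\<lambda>x. g \<otimes> f h x \<otimes> inv g) T \<otimes>\<^bsub>?M\<^esub> finprod ?M (\<lambda>x. f g (t (h \<otimes> x))) T"
      using f_mem norm g h TG t_closed by (intro M.finprod_multf) auto
    also have "finprod ?M (\<lambda>x. f g (t (h \<otimes> x))) T = finprod ?M (f g) ((\<lambda>x. t (h \<otimes> x)) ` T)"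
      using bij f_mem[OF g] TG by (intro M.finprod_reindex[symmetric]) (auto simp: bij_betw_def)
    also have "\<dots> = d g" using bij by (simp add: bij_betw_def d_def)
    also have "finprod ?M (\<lambda>x. g \<otimes> f h x \<otimes> inv g) T = g \<otimes> d h \<otimes> inv g"
      unfolding d_def using f_mem[OF h] TG g finT by (intro conj_prod) auto
    finally show ?thesis by simp
  qed
  have d_N: "d n = n [^] card T" if n: "n \<in> N" for n
  proof -
    have "f n x = n" if x: "x \<in> T" for x
    proof -
      have "n \<otimes> x = x \<otimes> (inv x \<otimes> n \<otimes> inv (inv x))" using NG[OF n] TG[OF x] by (simp add: m_assoc)
      then have "t (n \<otimes> x) = t x" using t_cong[OF TG[OF x] norm[of "inv x" n]] n TG[OF x] by simp
      then show ?thesis using NG[OF n] TG[OF x] t_T[OF x] by (simp add: f_def m_assoc)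
    qed
    then have "d n = finprod ?M (\<lambda>x. n) T"
      unfolding d_def using n by (intro M.finprod_cong') auto
    also have "\<dots> = n [^] card T" using M.finprod_const[of n T] n by (simp flip: nat_pow_consistent)
    finally show ?thesis .
  qed
  have copT: "coprime (card T) (card N)"
  proof -
    have "card N > 0" using finN subgroup.one_closed[OF N] by (auto simp: card_gt_0_iff)
    then have "card (carrier G) div card N = card T" using card_T by (metis nonzero_mult_div_cancel_right less_irrefl)
    then show ?thesis using cop by (simp add: coprime_commute)
  qed
  define H where "H = {g \<in> carrier G. d g = \<one>}"
  have "subgroup H G"
  proof (rule subgroupI)
    have d1: "d \<one> = \<one>" using d_N[OF subgroup.one_closed[OF N]] by simp
    then show "H \<noteq> {}" by (auto simp: H_def)
    show "g \<otimes> h \<in> H" if "g \<in> H" "h \<in> H" for g h using that d_mult[of g h] by (auto simp: H_def)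
    show "inv g \<in> H" if "g \<in> H" for g
    proof -
      have g: "g \<in> carrier G" "d g = \<one>" using that by (auto simp: H_def)
      have "d (inv g) \<in> carrier G" using d_mem[of "inv g"] g NG by simp
      then have "d (inv g) = \<one>" using d_mult[of "inv g" g] g d1 by simp
      then show ?thesis using g by (simp add: H_def)
    qed
  qed (auto simp: H_def)
  moreover have "H \<inter> N = {\<one>}"
  proof -
    have "x = \<one>" if "x \<in> H" "x \<in> N" for x
    proof -
      have "ord x dvd card T" using that d_N[of x] pow_eq_id[of x "card T"] by (auto simp: H_def)
      moreover have "ord x dvd card N" using ord_dvd_card_subgroup[OF N that(2)] .
      ultimately have "ord x = 1" using copT by (meson coprime_common_divisor_nat)
      then show ?thesis using ord_eq_1[of x] NG[OF that(2)] by simp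
    qed
    then show ?thesis using calculation N subgroup.one_closed by blast
  qed
  moreover have "\<exists>n\<in>N. \<exists>h\<in>H. g = n \<otimes> h" if g: "g \<in> carrier G" for g
  proof -
    have "card T \<noteq> 0" using card_T card_pos by (metis mult_zero_left less_irrefl)
    then obtain u v where uv: "card T * u = card N * v + 1"
      using bezout_nat[of "card T" "card N"] copT by auto
    \<comment> \<open>as \<open>u\<close> inverts \<open>card T\<close> modulo \<open>card N\<close>, this element solves \<open>d n = inv (d g)\<close>\<close>
    define n where "n = inv (d g) [^] u"
    have dN: "inv (d g) \<in> N" using d_mem[OF g] subgroup.m_inv_closed[OF N] by simp
    have n: "n \<in> N" unfolding n_def using subgroup_nat_pow_closed[OF N dN] .
    have "n [^] card T = inv (d g) [^] (card T * u)"
      unfolding n_def using NG[OF dN] by (simp add: nat_pow_pow mult.commute)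
    also have "\<dots> = inv (d g)"
      unfolding uv using NG[OF dN] pow_card_subgroup[OF N dN]
      by (simp add: nat_pow_pow[symmetric] nat_pow_mult[symmetric])
    finally have "d n = inv (d g)" using d_N[OF n] by simp
    have "d (n \<otimes> g) = n \<otimes> d g \<otimes> inv n \<otimes> d n" using d_mult NG[OF n] g by simp
    also have "n \<otimes> d g \<otimes> inv n = d g" using comm[OF n d_mem[OF g]] NG[OF n] NG[OF d_mem[OF g]] by (simp add: m_assoc)
    also have "d g \<otimes> d n = \<one>" using \<open>d n = inv (d g)\<close> NG[OF d_mem[OF g]] by simp
    finally have "n \<otimes> g \<in> H" using NG[OF n] g by (simp add: H_def)
    moreover have "g = inv n \<otimes> (n \<otimes> g)" using NG[OF n] g by simp
    ultimately show ?thesis using n subgroup.m_inv_closed[OF N] by metis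
  qed
  ultimately show thesis by (rule that)
qed

lemma conj_set_iff:
  "x \<in> g <# H #> inv g \<longleftrightarrow> (\<exists>h\<in>H. x = g \<otimes> h \<otimes> inv g)"
  by (auto simp: l_coset_def r_coset_def)

lemma card_mult_complement:
  assumes N: "subgroup N G" and H: "subgroup H G" and int: "H \<inter> N = {\<one>}"
    and fact: "\<And>g. g \<in> carrier G \<Longrightarrow> \<exists>n\<in>N. \<exists>h\<in>H. g = n \<otimes> h"
  shows "card N * card H = card (carrier G)"
proof -
  have NG: "x \<in> carrier G" if "x \<in> N" for x using subgroup.mem_carrier[OF N that] .
  have HG: "x \<in> carrier G" if "x \<in> H" for x using subgroup.mem_carrier[OF H that] .
  have "bij_betw (\<lambda>(n, h). n \<otimes> h) (N \<times> H) (carrier G)"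
    unfolding bij_betw_def
  proof
    show "inj_on (\<lambda>(n, h). n \<otimes> h) (N \<times> H)"
    proof (rule inj_onI, clarsimp)
      fix n h n' h' assume mem: "n \<in> N" "h \<in> H" "n' \<in> N" "h' \<in> H" and eq: "n \<otimes> h = n' \<otimes> h'"
      have "inv n' \<otimes> n \<otimes> h \<otimes> inv h = inv n' \<otimes> (n' \<otimes> h') \<otimes> inv h"
        using mem NG HG eq by (simp add: m_assoc)
      then have *: "inv n' \<otimes> n = h' \<otimes> inv h" using mem NG HG by (simp add: m_assoc)
      have "inv n' \<otimes> n \<in> N" using mem subgroup.m_closed[OF N] subgroup.m_inv_closed[OF N] by simp
      moreover have "h' \<otimes> inv h \<in> H" using mem subgroup.m_closed[OF H] subgroup.m_inv_closed[OF H] by simp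
      ultimately have "inv n' \<otimes> n = \<one>" "h' \<otimes> inv h = \<one>" using * int by auto
      then show "n = n' \<and> h = h'" using mem NG HG
        by (metis inv_closed inv_equality inv_inv)
    qed
    show "(\<lambda>(n, h). n \<otimes> h) ` (N \<times> H) = carrier G"
      using fact NG HG by (force simp: image_iff)
  qed
  then show ?thesis using bij_betw_same_card card_cartesian_product by metis
qed

end

section \<open>Eigenvalues of a group element\<close>

lemma obtain_root_of_unity:
  assumes "1 < p"
  obtains \<zeta> :: complex where "\<zeta> ^ p = 1" "\<zeta> \<noteq> 1" "(\<Sum>j<p. \<zeta> ^ j) = 0"
proof -
  have card: "card {z :: complex. z ^ p = 1} = p" using card_roots_unity_eq[of p] assms by simp
  have "\<not> {z :: complex. z ^ p = 1} \<subseteq> {1}"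
  proof
    assume "{z :: complex. z ^ p = 1} \<subseteq> {1}"
    then have "card {z :: complex. z ^ p = 1} \<le> card {1 :: complex}" by (rule card_mono[rotated]) simp
    then show False using card assms by simp
  qed
  then obtain \<zeta> :: complex where \<zeta>: "\<zeta> ^ p = 1" "\<zeta> \<noteq> 1" by auto
  then have "(\<Sum>j<p. \<zeta> ^ j) = 0" by (simp add: geometric_sum)
  with \<zeta> show thesis by (rule that)
qed

lemma power_mod_exponent:
  fixes z :: complex
  assumes "z ^ p = 1"
  shows "z ^ (n mod p) = z ^ n"
proof -
  have "z ^ n = z ^ (p * (n div p) + n mod p)" by simp
  then show ?thesis using assms by (simp only: power_add power_mult power_one mult_1)
qed

context finite_group begin

lemma pow_mod_ord:
  assumes "x \<in> carrier G"
  shows "x [^] (n mod ord x) = x [^] n"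
proof -
  have "x [^] n = x [^] (ord x * (n div ord x) + n mod ord x)" by simp
  also have "\<dots> = (x [^] ord x) [^] (n div ord x) \<otimes> x [^] (n mod ord x)"
    using assms by (simp only: nat_pow_mult[symmetric] nat_pow_pow)
  finally show ?thesis using assms by simp
qed

text \<open>This is \<open>linear_character_multiplicity\<close> for the cyclic group of \<open>x\<close> and its linear character that
sends \<open>x\<close> to \<open>z\<close>: the quotient is the multiplicity of \<open>inverse z\<close> as an eigenvalue of \<open>x\<close>.\<close>

lemma cyclic_eigenvalue_multiplicity:
  assumes \<psi>: "\<psi> \<in> Irr G" and x: "x \<in> carrier G" and z: "z ^ ord x = 1"
  shows "(\<Sum>j<ord x. z ^ j * \<psi> (x [^] j)) / of_nat (ord x) \<in> \<nat>"
proof -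
  let ?p = "ord x"
  have p: "0 < ?p" using ord_ge_1[OF fin x] by simp
  define H where "H = (\<lambda>j. x [^] j) ` {..<?p}"
  have inj: "inj_on (\<lambda>j. x [^] j) {..<?p}"
    using ord_inj[OF x] p by (auto simp: inj_on_def)
  \<comment> \<open>the linear character with \<open>l (x [^] j) = z ^ j\<close>, through the discrete logarithm to base \<open>x\<close>\<close>
  define l where "l y = z ^ inv_into {..<?p} (\<lambda>j. x [^] j) y" for y
  have l: "l (x [^] j) = z ^ j" for j
  proof -
    have "l (x [^] (j mod ?p)) = z ^ (j mod ?p)" unfolding l_def using inj p by simp
    then show ?thesis using pow_mod_ord[OF x] power_mod_exponent[OF z] by metis
  qed
  have powH: "x [^] j \<in> H" for j :: nat
    unfolding H_def using pow_mod_ord[OF x, of j] p by (metis imageI lessThan_iff mod_less_divisor)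
  have HE: "\<exists>j. y = x [^] (j :: nat)" if "y \<in> H" for y using that by (auto simp: H_def)
  have "subgroup H G"
  proof (rule subgroupI)
    show "H \<subseteq> carrier G" "H \<noteq> {}" using x p by (auto simp: H_def)
    show "u \<otimes> v \<in> H" if "u \<in> H" "v \<in> H" for u v
      using HE[OF that(1)] HE[OF that(2)] powH x by (auto simp: nat_pow_mult)
    show "inv u \<in> H" if u: "u \<in> H" for u
    proof -
      obtain j where j: "j < ?p" "u = x [^] j" using u by (auto simp: H_def)
      have "u \<otimes> x [^] (?p - j) = \<one>" using j x by (simp add: nat_pow_mult)
      then have "inv u = x [^] (?p - j)" using j x by (intro inv_equality[OF _ _ ]) (auto simp: nat_pow_mult)
      then show ?thesis using powH by simp
    qed
  qed
  moreover have "l \<one> = 1" using l[of 0] by simp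
  moreover have "l (u \<otimes> v) = l u * l v" if "u \<in> H" "v \<in> H" for u v
    using HE[OF that(1)] HE[OF that(2)] x by (auto simp: nat_pow_mult l power_add)
  ultimately have "(\<Sum>h\<in>H. l h * \<psi> h) / of_nat (card H) \<in> \<nat>"
    by (rule linear_character_multiplicity[OF _ _ _ \<psi>])
  moreover have "card H = ?p" unfolding H_def using inj by (simp add: card_image)
  moreover have "(\<Sum>h\<in>H. l h * \<psi> h) = (\<Sum>j<?p. z ^ j * \<psi> (x [^] j))"
    unfolding H_def using sum.reindex[OF inj, of "\<lambda>h. l h * \<psi> h"] by (simp add: l)
  ultimately show ?thesis by simp
qed

end

section \<open>A column that differs from the degrees in one row\<close>

text \<open>The situation of a CD1-group once one of the two classes is known to be that of \<open>\<one>\<close>. The element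
\<open>b\<close> and the row \<open>\<chi>\<close> are parameters, so that uniqueness can be expressed by two interpretations.\<close>

locale cd1_column = finite_group G for G (structure) +
  fixes \<chi> :: "'a \<Rightarrow> complex" and b :: 'a
  assumes finite_Irr: "finite (Irr G)"
    and card_gt_2: "card (carrier G) > 2"
    and \<chi>: "\<chi> \<in> Irr G" and b: "b \<in> carrier G" "b \<noteq> \<one>"
    and differ: "\<chi> \<one> \<noteq> \<chi> b"
    and agree: "\<And>\<psi>. \<psi> \<in> Irr G \<Longrightarrow> \<psi> \<noteq> \<chi> \<Longrightarrow> \<psi> \<one> = \<psi> b"
begin

definition deg :: nat where "deg = char_degree G \<chi>"
definition m :: nat where "m = card (conj_class G b)"
definition N :: "'a set" where "N = insert \<one> (conj_class G b)"

lemma \<chi>_one: "\<chi> \<one> = of_nat deg" by (simp add: deg_def char_degree_eq \<chi>)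
lemma deg_pos: "0 < deg" by (simp add: deg_def char_degree_pos \<chi>)

lemma class_subset: "conj_class G b \<subseteq> carrier G" using conj_class_closed b by simp
lemma N_subset: "N \<subseteq> carrier G" using class_subset by (auto simp: N_def)
lemma finite_class [simp]: "finite (conj_class G b)" using class_subset finite_subset fin by blast
lemma finite_N [simp]: "finite N" by (simp add: N_def)
lemma m_pos: "0 < m" using conj_class_self[OF b(1)] by (auto simp: m_def card_gt_0_iff)
lemma one_notin_class: "\<one> \<notin> conj_class G b" using one_notin_conj_class b by simp
lemma card_N: "card N = m + 1" using one_notin_class by (simp add: N_def m_def)

text \<open>Pair the difference of the columns of \<open>\<one>\<close> and \<open>b\<close> with the column of \<open>y\<close>: only the row \<open>\<chi>\<close> survives
on one side, and column orthogonality counts conjugating elements on the other.\<close>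

lemma column_difference:
  assumes y: "y \<in> carrier G"
  shows "(of_nat deg - \<chi> b) * \<chi> (inv y)
    = of_nat (card (conjugators \<one> y)) - of_nat (card (conjugators b y))"
proof -
  have "(\<Sum>\<psi>\<in>Irr G. \<psi> \<one> * \<psi> (inv y)) - (\<Sum>\<psi>\<in>Irr G. \<psi> b * \<psi> (inv y))
      = (\<Sum>\<psi>\<in>Irr G. (\<psi> \<one> - \<psi> b) * \<psi> (inv y))"
    by (simp add: left_diff_distrib sum_subtractf)
  also have "\<dots> = (\<Sum>\<psi>\<in>{\<chi>}. (\<psi> \<one> - \<psi> b) * \<psi> (inv y))"
    using finite_Irr \<chi> agree by (intro sum.mono_neutral_right) auto
  finally show ?thesis
    using column_orthogonality[OF finite_Irr _ y] b by (simp add: \<chi>_one)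
qed

lemma order_eq: "(of_nat deg - \<chi> b) * of_nat deg = of_nat (card (carrier G))"
proof -
  have "conjugators b \<one> = {}" using conjugators_nonempty_iff[of b \<one>] one_notin_class by auto
  then show ?thesis using column_difference[of \<one>] by (simp add: card_conjugators_one \<chi>_one)
qed

lemma sum_squares: "(\<Sum>\<psi>\<in>Irr G. (char_degree G \<psi>)\<^sup>2) = card (carrier G)"
proof -
  have "(\<Sum>\<psi>\<in>Irr G. \<psi> \<one> * \<psi> (inv \<one>)) = of_nat (\<Sum>\<psi>\<in>Irr G. (char_degree G \<psi>)\<^sup>2)"
    by (simp add: char_degree_eq power2_eq_square)
  then show ?thesis using column_orthogonality[OF finite_Irr, of \<one> \<one>]
    by (simp add: card_conjugators_one del: of_nat_sum of_nat_power)
qed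

lemma sum_other_squares: "(\<Sum>\<psi>\<in>Irr G - {\<chi>}. (char_degree G \<psi>)\<^sup>2) + deg\<^sup>2 = card (carrier G)"
  using sum_squares sum.remove[OF finite_Irr \<chi>, of "\<lambda>\<psi>. (char_degree G \<psi>)\<^sup>2"] by (simp add: deg_def)

lemma trivial_other: "(\<lambda>g\<in>carrier G. 1) \<in> Irr G - {\<chi>}"
  using trivial_in_Irr differ b by auto

lemma degree_trivial: "char_degree G (\<lambda>g\<in>carrier G. 1) = 1"
  using char_degree_eq[OF trivial_in_Irr] by simp

text \<open>Otherwise the square of \<open>\<chi>(\<one>)\<close> alone would exhaust the sum of the squares of all degrees, leaving
no room for the trivial character.\<close>

lemma \<chi>_b_nonzero: "\<chi> b \<noteq> 0"
proof
  assume "\<chi> b = 0"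
  then have "(of_nat (deg * deg) :: complex) = of_nat (card (carrier G))" using order_eq by simp
  then have "deg\<^sup>2 = card (carrier G)" by (simp only: of_nat_eq_iff power2_eq_square)
  then have "(\<Sum>\<psi>\<in>Irr G - {\<chi>}. (char_degree G \<psi>)\<^sup>2) = 0" using sum_other_squares by simp
  then show False using trivial_other degree_trivial finite_Irr by auto
qed

lemma difference_nonzero: "of_nat deg - \<chi> b \<noteq> 0"
  using differ by (simp add: \<chi>_one)

text \<open>The column difference at \<open>inv b\<close> would vanish if \<open>inv b\<close> were not conjugate to \<open>b\<close>. This makes the
values of \<open>\<chi>\<close> at \<open>b\<close> and \<open>inv b\<close> agree, which replaces an argument with complex conjugates.\<close>

lemma inv_b_conj: "inv b \<in> conj_class G b"
proof -
  have "inv b \<noteq> \<one>" using b by simp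
  then have "(of_nat deg - \<chi> b) * \<chi> b = - of_nat (card (conjugators b (inv b)))"
    using column_difference[of "inv b"] b by (simp add: card_conjugators_one)
  then have "card (conjugators b (inv b)) \<noteq> 0" using \<chi>_b_nonzero difference_nonzero
    by (metis mult_eq_0_iff neg_equal_0_iff_equal of_nat_0)
  then show ?thesis using conjugators_nonempty_iff[of b "inv b"] by fastforce
qed

text \<open>Compare the column difference at \<open>b\<close> with that at \<open>\<one>\<close>, which is the order of \<open>G\<close>.\<close>

lemma m_mult_\<chi>_b: "of_nat m * \<chi> b = - of_nat deg"
proof -
  have "\<chi> (inv b) = \<chi> b" using char_conj_class[OF \<chi> b(1) inv_b_conj] .
  then have "(of_nat deg - \<chi> b) * \<chi> b = - of_nat (card (conjugators b b))"
    using column_difference[of b] b by (simp add: card_conjugators_one)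
  then have "of_nat m * ((of_nat deg - \<chi> b) * \<chi> b) = - of_nat (m * card (conjugators b b))" by simp
  also have "\<dots> = - ((of_nat deg - \<chi> b) * of_nat deg)"
    using card_class_mult_centralizer[OF b(1)] order_eq by (simp add: m_def del: of_nat_mult)
  finally have "(of_nat deg - \<chi> b) * (of_nat m * \<chi> b + of_nat deg) = 0" by (simp add: algebra_simps)
  then show ?thesis using difference_nonzero by (simp add: eq_neg_iff_add_eq_0)
qed

lemma inv_class: "y \<in> conj_class G b \<Longrightarrow> inv y \<in> conj_class G b"
proof -
  assume "y \<in> conj_class G b"
  then obtain h where h: "h \<in> carrier G" "y = h \<otimes> b \<otimes> inv h" by (auto simp: conj_class_eq)
  then have "inv y = h \<otimes> inv b \<otimes> inv h" using b by (simp add: inv_mult_group m_assoc)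
  then show ?thesis using conj_class_conj[OF b(1) inv_b_conj h(1)] by simp
qed

lemma vanish_outside_N:
  assumes y: "y \<in> carrier G - N"
  shows "\<chi> y = 0"
proof -
  have "inv y \<noteq> \<one>" using y by (auto simp: N_def)
  moreover have "inv y \<notin> conj_class G b"
    using inv_class[of "inv y"] y by (auto simp: N_def)
  then have "conjugators b (inv y) = {}" using conjugators_nonempty_iff[of b "inv y"] by auto
  ultimately have "(of_nat deg - \<chi> b) * \<chi> y = 0"
    using column_difference[of "inv y"] y by (simp add: card_conjugators_one)
  then show ?thesis using difference_nonzero by simp
qed

lemma deg_square_eq: "deg\<^sup>2 * (m + 1) = m * card (carrier G)"
proof -
  have "(of_nat (m * card (carrier G)) :: complex) = of_nat m * ((of_nat deg - \<chi> b) * of_nat deg)"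
    by (simp add: order_eq)
  also have "\<dots> = of_nat m * of_nat deg * of_nat deg - (of_nat m * \<chi> b) * of_nat deg"
    by (simp add: algebra_simps)
  also have "\<dots> = of_nat (deg\<^sup>2 * (m + 1))" unfolding m_mult_\<chi>_b by (simp add: power2_eq_square algebra_simps)
  finally show ?thesis by (simp only: of_nat_eq_iff)
qed

text \<open>The squares of the other degrees add up to the square of \<open>deg\<close> divided by \<open>m\<close>. A degree as large as
\<open>deg\<close> would use up this sum alone; it would belong to the trivial character, and \<open>G\<close> would have
order \<open>2\<close>.\<close>

lemma degree_less_deg:
  assumes \<psi>: "\<psi> \<in> Irr G" "\<psi> \<noteq> \<chi>"
  shows "char_degree G \<psi> < deg"
proof (rule ccontr)
  assume "\<not> char_degree G \<psi> < deg"
  then have ge: "deg\<^sup>2 \<le> (char_degree G \<psi>)\<^sup>2" by (simp add: power2_nat_le_eq_le)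
  define S where "S = (\<Sum>\<psi>\<in>Irr G - {\<chi>}. (char_degree G \<psi>)\<^sup>2)"
  have "deg\<^sup>2 * (m + 1) = m * (S + deg\<^sup>2)"
    using deg_square_eq sum_other_squares by (simp add: S_def)
  then have Sm: "S * m = deg\<^sup>2" by (simp add: algebra_simps)
  have S: "S = (char_degree G \<psi>)\<^sup>2 + (\<Sum>\<phi>\<in>Irr G - {\<chi>} - {\<psi>}. (char_degree G \<phi>)\<^sup>2)"
    unfolding S_def using \<psi> finite_Irr by (intro sum.remove) auto
  have "S \<le> deg\<^sup>2" using Sm m_pos by (metis One_nat_def Suc_leI mult_le_mono2 mult.right_neutral)
  then have eq: "S = deg\<^sup>2" "(char_degree G \<psi>)\<^sup>2 = deg\<^sup>2"
    and rest: "(\<Sum>\<phi>\<in>Irr G - {\<chi>} - {\<psi>}. (char_degree G \<phi>)\<^sup>2) = 0"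
    using ge S by linarith+
  have "(\<lambda>g\<in>carrier G. 1) = \<psi>"
  proof (rule ccontr)
    assume "(\<lambda>g\<in>carrier G. 1) \<noteq> \<psi>"
    then have "(\<lambda>g\<in>carrier G. 1) \<in> Irr G - {\<chi>} - {\<psi>}" using trivial_other by auto
    then show False using rest degree_trivial finite_Irr by auto
  qed
  then have "deg\<^sup>2 = 1" using eq(2) degree_trivial by simp
  then have "card (carrier G) = 2" using sum_other_squares eq(1) unfolding S_def[symmetric] by simp
  then show False using card_gt_2 by simp
qed

lemma \<chi>_is_last:
  assumes "irr_enumeration G k \<xi>"
  shows "\<xi> k = \<chi>"
proof -
  have bij: "bij_betw \<xi> {1..k} (Irr G)" and mono: "mono_on {1..k} (\<lambda>i. char_degree G (\<xi> i))"
    using assms by (auto simp: irr_enumeration_def)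
  obtain j where j: "j \<in> {1..k}" "\<xi> j = \<chi>" using bij \<chi> by (metis bij_betw_imp_surj_on imageE)
  then have k: "k \<in> {1..k}" by simp
  have "char_degree G (\<xi> j) \<le> char_degree G (\<xi> k)"
    using mono j k by (auto simp: mono_on_def)
  moreover have "\<xi> k \<in> Irr G" using bij k by (auto simp: bij_betw_def)
  ultimately show ?thesis using degree_less_deg[of "\<xi> k"] j by (auto simp: deg_def)
qed

section \<open>The normal subgroup attached to the column\<close>

lemma N_conj: "x \<in> N \<Longrightarrow> g \<in> carrier G \<Longrightarrow> g \<otimes> x \<otimes> inv g \<in> N"
  using conj_class_conj[OF b(1)] by (auto simp: N_def)

lemma N_conj_iff: "x \<in> carrier G \<Longrightarrow> g \<in> carrier G \<Longrightarrow> g \<otimes> x \<otimes> inv g \<in> N \<longleftrightarrow> x \<in> N"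
proof
  assume x: "x \<in> carrier G" and g: "g \<in> carrier G" and *: "g \<otimes> x \<otimes> inv g \<in> N"
  show "x \<in> N" using N_conj[OF *, of "inv g"] x g by (simp add: m_assoc)
qed (rule N_conj)

lemma sum_char_N:
  assumes \<psi>: "\<psi> \<in> Irr G"
  shows "(\<Sum>x\<in>N. \<psi> x) = (if \<psi> = \<chi> then 0 else of_nat (m + 1) * \<psi> \<one>)"
proof -
  have "(\<Sum>x\<in>N. \<psi> x) = \<psi> \<one> + (\<Sum>x\<in>conj_class G b. \<psi> b)"
    using char_conj_class[OF \<psi> b(1)] one_notin_class by (simp add: N_def)
  also have "\<dots> = \<psi> \<one> + of_nat m * \<psi> b" by (simp add: m_def)
  finally show ?thesis using m_mult_\<chi>_b \<chi>_one agree[OF \<psi>] by (auto simp: algebra_simps)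
qed

text \<open>The sum of the elements of \<open>N\<close> is central, and its scalar is read off from \<open>sum_char_N\<close>.\<close>

lemma sum_N_scalar:
  assumes irr: "irreducible_rep G n \<rho>"
  shows "rep_sum n \<rho> (\<lambda>g. of_bool (g \<in> N))
    = (if character_of G \<rho> = \<chi> then 0 else of_nat (m + 1)) \<cdot>\<^sub>m 1\<^sub>m n"
proof -
  have "(\<Sum>g\<in>carrier G. of_bool (g \<in> N) * mat_trace (\<rho> g)) = (\<Sum>g\<in>N. character_of G \<rho> g)"
    using N_subset by (intro sum.mono_neutral_cong_right) (auto simp: character_of_def)
  also have "\<dots> = (if character_of G \<rho> = \<chi> then 0 else of_nat (m + 1)) * of_nat n"
  proof -
    have "character_of G \<rho> \<one> = of_nat n"
      using complex_repD(3)[OF irreducibleD(1)[OF irr]] by (simp add: character_of_def trace_one)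
    then show ?thesis unfolding sum_char_N[OF IrrI[OF irr]] by simp
  qed
  finally have "(\<Sum>g\<in>carrier G. of_bool (g \<in> N) * mat_trace (\<rho> g)) / of_nat n
      = (if character_of G \<rho> = \<chi> then 0 else of_nat (m + 1))"
    using irreducibleD(2)[OF irr] by simp
  then show ?thesis using class_function_rep_sum_scalar[OF irr, of "\<lambda>g. of_bool (g \<in> N)"]
    by (simp add: N_conj_iff)
qed

text \<open>In each irreducible representation the sum of \<open>N\<close> acts by \<open>0\<close> or by \<open>m + 1\<close>, and both numbers satisfy
\<open>c * c = (m + 1) * c\<close>. So the identity holds in the group algebra.\<close>

lemma N_convolution:
  assumes x: "x \<in> carrier G"
  shows "(\<Sum>y\<in>carrier G. of_bool (y \<in> N) * of_bool (inv y \<otimes> x \<in> N))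
    = (of_nat (m + 1) * of_bool (x \<in> N) :: complex)"
proof -
  let ?e = "\<lambda>g. of_bool (g \<in> N) :: complex"
  define f where "f x = (\<Sum>y\<in>carrier G. ?e y * ?e (inv y \<otimes> x)) - of_nat (m + 1) * ?e x" for x
  have "f x = 0"
  proof (rule group_algebra_faithful[OF _ x])
    fix n \<rho> assume irr: "irreducible_rep G n \<rho>"
    note rep = irreducibleD(1)[OF irr]
    define c where "c = (if character_of G \<rho> = \<chi> then 0 else of_nat (m + 1) :: complex)"
    have T: "rep_sum n \<rho> ?e = c \<cdot>\<^sub>m 1\<^sub>m n" using sum_N_scalar[OF irr] by (simp add: c_def)
    have "rep_sum n \<rho> f = rep_sum n \<rho> ?e * rep_sum n \<rho> ?e - of_nat (m + 1) \<cdot>\<^sub>m rep_sum n \<rho> ?e"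
      unfolding rep_sum_mult[OF rep]
    proof (rule eq_matI)
      fix i j
      assume "i < dim_row (rep_sum n \<rho> (\<lambda>x. \<Sum>y\<in>carrier G. ?e y * ?e (inv y \<otimes> x)) - of_nat (m + 1) \<cdot>\<^sub>m rep_sum n \<rho> ?e)"
        "j < dim_col (rep_sum n \<rho> (\<lambda>x. \<Sum>y\<in>carrier G. ?e y * ?e (inv y \<otimes> x)) - of_nat (m + 1) \<cdot>\<^sub>m rep_sum n \<rho> ?e)"
      then have ij: "i < n" "j < n" by (auto simp: rep_sum_def)
      have dims: "dim_row (rep_sum n \<rho> f) = n" "dim_col (rep_sum n \<rho> f) = n" for f
        by (simp_all add: rep_sum_def)
      have "rep_sum n \<rho> f $$ (i, j) = rep_sum n \<rho> (\<lambda>x. \<Sum>y\<in>carrier G. ?e y * ?e (inv y \<otimes> x)) $$ (i, j)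
          - of_nat (m + 1) * rep_sum n \<rho> ?e $$ (i, j)"
        unfolding rep_sum_index[OF rep ij] f_def
        by (simp only: left_diff_distrib sum_subtractf sum_distrib_left mult.assoc)
      then show "rep_sum n \<rho> f $$ (i, j)
        = (rep_sum n \<rho> (\<lambda>x. \<Sum>y\<in>carrier G. ?e y * ?e (inv y \<otimes> x)) - of_nat (m + 1) \<cdot>\<^sub>m rep_sum n \<rho> ?e) $$ (i, j)"
        using ij by (simp add: dims)
    qed (simp_all add: rep_sum_def)
    also have "\<dots> = (c * c - of_nat (m + 1) * c) \<cdot>\<^sub>m 1\<^sub>m n"
      unfolding T by (rule eq_matI) (auto simp: scalar_mat_mult(1)[of _ n n] algebra_simps)
    also have "c * c - of_nat (m + 1) * c = 0" by (simp add: c_def)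
    finally show "rep_sum n \<rho> f = 0\<^sub>m n n" by auto
  qed
  then show ?thesis by (simp add: f_def)
qed

text \<open>By \<open>N_convolution\<close> an element outside \<open>N\<close> is a product of two elements of \<open>N\<close> in zero ways.\<close>

lemma N_subgroup: "subgroup N G"
proof (rule subgroupI)
  show "N \<subseteq> carrier G" by (rule N_subset)
  show "N \<noteq> {}" by (simp add: N_def)
  show "inv x \<in> N" if "x \<in> N" for x using that inv_class by (auto simp: N_def)
  show "x \<otimes> y \<in> N" if x: "x \<in> N" and y: "y \<in> N" for x y
  proof (rule ccontr)
    assume xy: "x \<otimes> y \<notin> N"
    have xG: "x \<in> carrier G" and yG: "y \<in> carrier G" using x y N_subset by auto
    have "(\<Sum>z\<in>carrier G. of_bool (z \<in> N) * of_bool (inv z \<otimes> (x \<otimes> y) \<in> N)) = (0 :: complex)"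
      using N_convolution[of "x \<otimes> y"] xG yG xy by simp
    then have "(of_nat (\<Sum>z\<in>carrier G. of_bool (z \<in> N) * of_bool (inv z \<otimes> (x \<otimes> y) \<in> N)) :: complex) = 0"
      by simp
    then have "(\<Sum>z\<in>carrier G. of_bool (z \<in> N) * of_bool (inv z \<otimes> (x \<otimes> y) \<in> N)) = (0 :: nat)"
      by (simp only: of_nat_eq_0_iff)
    then have "of_bool (x \<in> N) * of_bool (inv x \<otimes> (x \<otimes> y) \<in> N) = (0 :: nat)"
      unfolding sum_eq_0_iff[OF fin] using xG by (rule bspec)
    then show False using x y xG yG by simp
  qed
qed

text \<open>The sum of \<open>N\<close> acts as the nonzero scalar \<open>m + 1\<close> and absorbs \<open>\<rho> x\<close>, since \<open>N\<close> is a group.\<close>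

lemma N_in_kernel:
  assumes irr: "irreducible_rep G n \<rho>" and ne: "character_of G \<rho> \<noteq> \<chi>" and x: "x \<in> N"
  shows "\<rho> x = 1\<^sub>m n"
proof -
  note r = complex_repD[OF irreducibleD(1)[OF irr]]
  have xG: "x \<in> carrier G" using x N_subset by auto
  let ?T = "rep_sum n \<rho> (\<lambda>g. of_bool (g \<in> N))"
  have "?T = of_nat (m + 1) \<cdot>\<^sub>m 1\<^sub>m n" using sum_N_scalar[OF irr] ne by simp
  moreover have T: "?T = mat_sum n n N \<rho>"
    unfolding rep_sum_def mat_sum_def
  proof (rule eq_matI)
    fix i j assume ij: "i < dim_row (mat n n (\<lambda>ij. \<Sum>s\<in>N. \<rho> s $$ ij))" "j < dim_col (mat n n (\<lambda>ij. \<Sum>s\<in>N. \<rho> s $$ ij))"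
    have "(\<Sum>s\<in>carrier G. (of_bool (s \<in> N) \<cdot>\<^sub>m \<rho> s) $$ (i, j)) = (\<Sum>s\<in>N. \<rho> s $$ (i, j))"
    proof (rule sum.mono_neutral_cong_right)
      have "dim_row (\<rho> s) = n" "dim_col (\<rho> s) = n" if "s \<in> carrier G" for s using r(1)[OF that] by auto
      then show "\<forall>s\<in>carrier G - N. (of_bool (s \<in> N) \<cdot>\<^sub>m \<rho> s) $$ (i, j) = 0"
        and "\<And>s. s \<in> N \<Longrightarrow> (of_bool (s \<in> N) \<cdot>\<^sub>m \<rho> s) $$ (i, j) = \<rho> s $$ (i, j)"
        using ij N_subset by auto
    qed (use N_subset in auto)
    then show "mat n n (\<lambda>ij. \<Sum>s\<in>carrier G. (of_bool (s \<in> N) \<cdot>\<^sub>m \<rho> s) $$ ij) $$ (i, j)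
      = mat n n (\<lambda>ij. \<Sum>s\<in>N. \<rho> s $$ ij) $$ (i, j)" using ij by simp
  qed simp_all
  moreover have "\<rho> x * mat_sum n n N \<rho> = mat_sum n n N \<rho>"
  proof -
    have "\<rho> x * mat_sum n n N \<rho> = mat_sum n n N (\<lambda>y. \<rho> x * \<rho> y)"
      using r(1) xG N_subset by (intro mult_mat_sum) auto
    also have "\<dots> = mat_sum n n N (\<lambda>y. \<rho> (x \<otimes> y))"
      using r(2) xG N_subset by (intro mat_sum_cong) auto
    also have "\<dots> = mat_sum n n N \<rho>"
    proof (rule mat_sum_reindex_bij, rule bij_betwI[where g = "\<lambda>y. inv x \<otimes> y"])
      show "(\<lambda>y. x \<otimes> y) \<in> N \<rightarrow> N" "(\<lambda>y. inv x \<otimes> y) \<in> N \<rightarrow> N"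
        using x subgroup.m_closed[OF N_subgroup] subgroup.m_inv_closed[OF N_subgroup] by auto
    qed (use N_subset xG in auto)
    finally show ?thesis .
  qed
  ultimately have "\<rho> x * (of_nat (m + 1) \<cdot>\<^sub>m 1\<^sub>m n) = of_nat (m + 1) \<cdot>\<^sub>m 1\<^sub>m n" by simp
  then have eq: "of_nat (m + 1) \<cdot>\<^sub>m \<rho> x = of_nat (m + 1) \<cdot>\<^sub>m 1\<^sub>m n"
    using scalar_mat_mult(2)[OF r(1)[OF xG]] by simp
  show ?thesis
  proof (rule eq_matI)
    fix i j assume ij: "i < dim_row (1\<^sub>m n)" "j < dim_col (1\<^sub>m n)"
    have "(of_nat (m + 1) \<cdot>\<^sub>m \<rho> x) $$ (i, j) = (of_nat (m + 1) \<cdot>\<^sub>m 1\<^sub>m n) $$ (i, j)" using eq by simp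
    then have "of_nat (m + 1) * \<rho> x $$ (i, j) = of_nat (m + 1) * 1\<^sub>m n $$ (i, j)"
      using ij r(1)[OF xG] by simp
    moreover have "(of_nat (m + 1) :: complex) \<noteq> 0" by (simp only: of_nat_eq_0_iff)
    ultimately show "\<rho> x $$ (i, j) = 1\<^sub>m n $$ (i, j)" by (simp only: mult_cancel_left) simp
  qed (use r(1)[OF xG] in auto)
qed

lemma char_mult_N:
  assumes \<psi>: "\<psi> \<in> Irr G" "\<psi> \<noteq> \<chi>" and x: "x \<in> N" and g: "g \<in> carrier G"
  shows "\<psi> (x \<otimes> g) = \<psi> g"
proof -
  obtain n \<rho> where \<rho>: "irreducible_rep G n \<rho>" "\<psi> = character_of G \<rho>"
    "\<And>g. g \<in> carrier G \<Longrightarrow> \<psi> g = mat_trace (\<rho> g)" using IrrE[OF \<psi>(1)] by metis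
  note r = complex_repD[OF irreducibleD(1)[OF \<rho>(1)]]
  have xG: "x \<in> carrier G" using x N_subset by auto
  have "\<rho> (x \<otimes> g) = \<rho> g"
    using r(1)[OF g] r(2)[OF xG g] N_in_kernel[OF \<rho>(1) _ x] \<psi>(2) \<rho>(2) by simp
  then show ?thesis using \<rho>(3) xG g by simp
qed

section \<open>When the exceptional value is minus one\<close>

lemma ord_gt_1: "1 < ord b"
  using ord_ge_1[OF fin b(1)] ord_eq_1[OF b(1)] b(2) by linarith

lemma b_in_N: "b \<in> N" using conj_class_self[OF b(1)] by (simp add: N_def)

text \<open>All nontrivial elements of \<open>N\<close> are conjugate to \<open>b\<close>, in particular the nontrivial powers of \<open>b\<close>.\<close>

lemma pow_in_class:
  assumes "\<not> ord b dvd j"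
  shows "b [^] (j :: nat) \<in> conj_class G b"
  using subgroup_nat_pow_closed[OF N_subgroup b_in_N, of j] pow_eq_id[OF b(1), of j] assms by (auto simp: N_def)

lemma not_dvd_of_minus_one:
  assumes "\<chi> b = -1"
  shows "\<not> ord b dvd deg"
proof
  assume dvd: "ord b dvd deg"
  have "(of_nat m :: complex) = of_nat deg" using m_mult_\<chi>_b assms by simp
  then have "ord b dvd m" using dvd by simp
  moreover have "ord b dvd m + 1" using ord_dvd_card_subgroup[OF N_subgroup b_in_N] by (simp add: card_N)
  ultimately have "ord b dvd 1" by (metis dvd_add_right_iff)
  then show False using ord_gt_1 by simp
qed

text \<open>As \<open>\<chi>\<close> is constant on the nontrivial powers of \<open>b\<close>, an eigenvalue of \<open>b\<close> other than \<open>1\<close> has multiplicity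
\<open>(deg - \<chi> b) / ord b = deg * (m + 1) / (m * ord b)\<close>. This is a natural number, and \<open>m\<close> is
prime to \<open>m + 1\<close>.\<close>

lemma m_dvd_deg: "m dvd deg"
proof -
  obtain \<zeta> :: complex where \<zeta>: "\<zeta> ^ ord b = 1" "\<zeta> \<noteq> 1" "(\<Sum>j<ord b. \<zeta> ^ j) = 0"
    using obtain_root_of_unity[OF ord_gt_1] by metis
  obtain r where r: "(\<Sum>j<ord b. \<zeta> ^ j * \<chi> (b [^] j)) / of_nat (ord b) = of_nat r"
    using cyclic_eigenvalue_multiplicity[OF \<chi> b(1) \<zeta>(1)] by (auto elim: Nats_cases)
  have "(\<Sum>j<ord b. \<zeta> ^ j * \<chi> (b [^] j)) = (\<Sum>j<ord b. \<zeta> ^ j * \<chi> b + (if j = 0 then of_nat deg - \<chi> b else 0))"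
  proof (rule sum.cong)
    fix j assume j: "j \<in> {..<ord b}"
    show "\<zeta> ^ j * \<chi> (b [^] j) = \<zeta> ^ j * \<chi> b + (if j = 0 then of_nat deg - \<chi> b else 0)"
    proof (cases "j = 0")
      case False
      then have "\<not> ord b dvd j" using j by (auto dest: dvd_imp_le)
      from char_conj_class[OF \<chi> b(1) pow_in_class[OF this]] show ?thesis using False by simp
    qed (simp add: \<chi>_one)
  qed simp
  also have "\<dots> = of_nat deg - \<chi> b"
    using \<zeta>(3) ord_gt_1 by (simp add: sum.distrib sum_distrib_right[symmetric])
  finally have "of_nat deg - \<chi> b = of_nat r * of_nat (ord b)"
    using r ord_gt_1 by (simp add: field_simps)
  then have "of_nat m * (of_nat r * of_nat (ord b)) = of_nat m * of_nat deg - of_nat m * \<chi> b"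
    by (metis right_diff_distrib)
  then have "(of_nat (m * (r * ord b)) :: complex) = of_nat (deg * (m + 1))"
    unfolding m_mult_\<chi>_b by (simp add: algebra_simps)
  then have "m * (r * ord b) = deg * (m + 1)" by (simp only: of_nat_eq_iff)
  then have "m dvd deg * (m + 1)" by (metis dvd_triv_left)
  then show ?thesis by (simp add: coprime_dvd_mult_left_iff)
qed

text \<open>All nontrivial elements of \<open>N\<close> are conjugate and so have the same order; a proper divisor of \<open>ord b\<close>
would be the order of a power of \<open>b\<close>.\<close>

lemma prime_ord: "prime (ord b)"
  unfolding prime_nat_iff
proof (intro conjI allI impI)
  show "1 < ord b" by (rule ord_gt_1)
  fix u assume "u dvd ord b"
  then obtain v where uv: "ord b = u * v" by auto
  show "u = 1 \<or> u = ord b"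
  proof (rule ccontr)
    assume "\<not> (u = 1 \<or> u = ord b)"
    then have "0 < u" "u < ord b" "0 < v" "v < ord b"
      using uv ord_gt_1 by (auto intro!: Nat.gr0I simp: nat_neq_iff)
    then have "\<not> ord b dvd u" "\<not> ord b dvd v" by (auto dest: dvd_imp_le)
    then have *: "b [^] u \<in> conj_class G b" by (intro pow_in_class)
    have "(b [^] u) [^] v = \<one>" using b uv by (simp add: nat_pow_pow flip: uv)
    then have "b [^] v = \<one>" using conj_class_pow_eq_one[of "b [^] u" b v] conj_class_sym[OF b(1) *] b by simp
    then show False using \<open>\<not> ord b dvd v\<close> pow_eq_id[OF b(1)] by simp
  qed
qed

text \<open>Multiplication by \<open>b\<close> does not change the rows other than \<open>\<chi>\<close>, and \<open>\<chi>\<close> vanishes at both elements.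
Elements with equal columns are conjugate by column orthogonality.\<close>

lemma same_column_outside_N:
  assumes x: "x \<in> carrier G - N"
  shows "b \<otimes> x \<in> conj_class G x"
proof -
  have xG: "x \<in> carrier G" using x by simp
  have bxG: "b \<otimes> x \<in> carrier G" using b xG by simp
  have bx: "b \<otimes> x \<notin> N"
  proof
    assume "b \<otimes> x \<in> N"
    then have "inv b \<otimes> (b \<otimes> x) \<in> N"
      using subgroup.m_inv_closed[OF N_subgroup b_in_N] subgroup.m_closed[OF N_subgroup] by blast
    then show False using b x by simp
  qed
  have "\<psi> (b \<otimes> x) = \<psi> x" if "\<psi> \<in> Irr G" for \<psi>
    using char_mult_N[OF that _ b_in_N xG] vanish_outside_N x bx bxG by (cases "\<psi> = \<chi>") auto
  then have "(\<Sum>\<psi>\<in>Irr G. \<psi> (b \<otimes> x) * \<psi> (inv x)) = (\<Sum>\<psi>\<in>Irr G. \<psi> x * \<psi> (inv x))"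
    by (intro sum.cong) auto
  then have "card (conjugators (b \<otimes> x) x) = card (conjugators x x)"
    using column_orthogonality[OF finite_Irr bxG xG] column_orthogonality[OF finite_Irr xG xG] by simp
  moreover have "\<one> \<in> conjugators x x" using xG by (simp add: conjugators_def)
  ultimately have "conjugators (b \<otimes> x) x \<noteq> {}" by (metis card.empty card_eq_0_iff empty_iff finite_conjugators)
  then show ?thesis using conjugators_nonempty_iff conj_class_sym[OF bxG] by simp
qed

lemma minus_one_of_not_dvd:
  assumes ndvd: "\<not> ord b dvd deg"
  shows "\<chi> b = -1"
proof -
  obtain t where t: "deg = m * t" using m_dvd_deg by auto
  have t0: "0 < t" using deg_pos t by (auto intro: Nat.gr0I)
  have "of_nat m * \<chi> b = of_nat m * (- of_nat t)" using m_mult_\<chi>_b t by simp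
  then have \<chi>_b: "\<chi> b = - of_nat t"
    unfolding mult_cancel_left of_nat_eq_0_iff using m_pos by (elim disjE) auto
  let ?C = "conjugators b b"
  have C: "subgroup ?C G" by (rule centralizer_subgroup[OF b(1)])
  have "m * card ?C = card (carrier G)" using card_class_mult_centralizer[OF b(1)] by (simp add: m_def)
  then have "(m * t)\<^sup>2 * (m + 1) = (m * m) * card ?C"
    using deg_square_eq unfolding t by (simp add: mult.assoc)
  moreover have "(m * t)\<^sup>2 * (m + 1) = (m * m) * (t\<^sup>2 * (m + 1))"
    by (simp add: power2_eq_square algebra_simps)
  ultimately have "(m * m) * (t\<^sup>2 * (m + 1)) = (m * m) * card ?C" by (simp only:)
  then have card_C: "card ?C = t\<^sup>2 * (m + 1)" unfolding mult_cancel1 mult_is_0 using m_pos by auto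
  have "t = 1"
  proof (rule ccontr)
    assume "t \<noteq> 1"
    then obtain q where q: "prime q" "q dvd t" using prime_factor_nat by auto
    have "q dvd card ?C" unfolding card_C using q(2) by (simp add: power2_eq_square)
    then obtain x where x: "x \<in> ?C" "x \<noteq> \<one>" "x [^] q = \<one>" using cauchy_subgroup[OF C q(1)] by metis
    have xG: "x \<in> carrier G" and comm: "b \<otimes> x = x \<otimes> b"
      using x conjugators_self_iff[OF b(1)] by auto
    have "\<not> ord b dvd q"
    proof
      assume "ord b dvd q"
      then have "ord b = q" using prime_ord q(1) by (simp add: primes_dvd_imp_eq)
      then show False using ndvd t q(2) by simp
    qed
    then have bq: "b [^] q \<noteq> \<one>" using pow_eq_id[OF b(1)] by simp
    have "x \<notin> N"
    proof
      assume "x \<in> N"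
      then have "x \<in> conj_class G b" using x by (simp add: N_def)
      then show False using conj_class_pow_eq_one[OF xG conj_class_sym[OF b(1)]] x(3) bq by blast
    qed
    then have "b \<otimes> x \<in> conj_class G x" using same_column_outside_N xG by simp
    then have "(b \<otimes> x) [^] q = \<one>" using conj_class_pow_eq_one[OF xG _ x(3)] by simp
    then show False using pow_mult_distrib[OF comm b(1) xG] x(3) b bq by simp
  qed
  then show ?thesis using \<chi>_b by simp
qed

section \<open>From the column to the Frobenius group\<close>

text \<open>Conjugation by an element of \<open>G\<close> that moves \<open>b\<close> to \<open>z\<close> maps the class of \<open>b\<close> in \<open>N\<close> onto that of \<open>z\<close>, so
\<open>equal_class_sizes_imp_comm\<close> applies to \<open>N\<close>.\<close>

lemma N_comm:
  assumes x: "x \<in> N" and y: "y \<in> N"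
  shows "x \<otimes> y = y \<otimes> x"
proof -
  let ?M = "G\<lparr>carrier := N\<rparr>"
  interpret M: finite_group ?M by (rule subgroup_finite_group[OF N_subgroup])
  have NG: "z \<in> carrier G" if "z \<in> N" for z using that N_subset by auto
  have cls: "conj_class ?M z = (\<lambda>g. g \<otimes> z \<otimes> inv g) ` N" for z
    unfolding M.conj_class_eq using N_subgroup by (auto intro!: image_cong)
  have "card (conj_class ?M z) = card (conj_class ?M b)" if z: "z \<in> N" "z \<noteq> \<one>" for z
  proof -
    obtain k where k: "k \<in> carrier G" "z = k \<otimes> b \<otimes> inv k" using z by (auto simp: N_def conj_class_eq)
    have "conj_class ?M z = (\<lambda>y. k \<otimes> y \<otimes> inv k) ` conj_class ?M b"
      unfolding cls image_image
    proof (intro Set.set_eqI iffI)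
      fix w assume "w \<in> (\<lambda>g. g \<otimes> z \<otimes> inv g) ` N"
      then obtain g where g: "g \<in> N" "w = g \<otimes> z \<otimes> inv g" by auto
      let ?g = "inv k \<otimes> g \<otimes> inv (inv k)"
      have "w = k \<otimes> (?g \<otimes> b \<otimes> inv ?g) \<otimes> inv k"
        using g k b NG by (simp add: inv_mult_group m_assoc)
      moreover have "?g \<in> N" using N_conj[OF g(1), of "inv k"] k by simp
      ultimately show "w \<in> (\<lambda>x. k \<otimes> (x \<otimes> b \<otimes> inv x) \<otimes> inv k) ` N" by blast
    next
      fix w assume "w \<in> (\<lambda>x. k \<otimes> (x \<otimes> b \<otimes> inv x) \<otimes> inv k) ` N"
      then obtain g where g: "g \<in> N" "w = k \<otimes> (g \<otimes> b \<otimes> inv g) \<otimes> inv k" by auto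
      let ?g = "k \<otimes> g \<otimes> inv k"
      have "w = ?g \<otimes> z \<otimes> inv ?g"
        using g k b NG by (simp add: inv_mult_group m_assoc)
      moreover have "?g \<in> N" using N_conj[OF g(1), of k] k by simp
      ultimately show "w \<in> (\<lambda>g. g \<otimes> z \<otimes> inv g) ` N" by blast
    qed
    moreover have "inj_on (\<lambda>y. k \<otimes> y \<otimes> inv k) (conj_class ?M b)"
    proof (rule inj_onI)
      fix u v assume "u \<in> conj_class ?M b" "v \<in> conj_class ?M b"
      then have "u \<in> carrier G" "v \<in> carrier G" using b NG by (auto simp: cls)
      then show "k \<otimes> u \<otimes> inv k = k \<otimes> v \<otimes> inv k \<Longrightarrow> u = v" using k by simp
    qed
    ultimately show ?thesis by (simp add: card_image)
  qed
  then show ?thesis using M.equal_class_sizes_imp_comm[of "card (conj_class ?M b)" x y] x y by simp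
qed

text \<open>Everything rests on the fact \<open>cent\<close> below: a nontrivial element of \<open>N\<close> commutes with elements of
\<open>N\<close> only. It makes the conjugates of \<open>H\<close> meet trivially; and if \<open>h \<notin> N\<close>, it makes the map
\<open>u \<mapsto> u \<otimes> h \<otimes> inv u \<otimes> inv h\<close> injective and hence surjective on \<open>N\<close>, so that the conjugates of \<open>H\<close> cover
everything outside \<open>N\<close>.\<close>

lemma frobenius_of_minus_one:
  assumes "\<chi> b = -1"
  obtains H where "frobenius_group G N H" "card H = card N - 1"
proof -
  have "(of_nat m :: complex) = of_nat deg" using m_mult_\<chi>_b assms by simp
  then have "deg = m" by simp
  then have card_G: "card (carrier G) = (m + 1) * m" using deg_square_eq m_pos by (simp add: power2_eq_square ac_simps)
  have m2: "m \<ge> 2"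
  proof (rule ccontr)
    assume "\<not> m \<ge> 2"
    then have "m = 1" using m_pos by simp
    then show False using card_G card_gt_2 by simp
  qed
  have NG: "x \<in> carrier G" if "x \<in> N" for x using that N_subset by auto
  have "coprime (card N) (card (carrier G) div card N)"
    unfolding card_N card_G nonzero_mult_div_cancel_left[of "m + 1", OF Suc_not_Zero[unfolded Suc_eq_plus1]]
    by simp
  then obtain H where H: "subgroup H G" "H \<inter> N = {\<one>}"
    and fact: "\<And>g. g \<in> carrier G \<Longrightarrow> \<exists>n\<in>N. \<exists>h\<in>H. g = n \<otimes> h"
    using abelian_normal_complement[OF N_subgroup N_conj N_comm] by metis
  have HG: "x \<in> carrier G" if "x \<in> H" for x using subgroup.mem_carrier[OF H(1) that] .
  have "(m + 1) * card H = (m + 1) * m"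
    using card_mult_complement[OF N_subgroup H fact] by (simp only: card_N card_G)
  then have card_H: "card H = m" by (simp only: mult_cancel1) simp
  have HN: "x = \<one>" if "x \<in> H" "x \<in> N" for x using that H(2) by auto
  have cent: "h \<in> N" if n: "n \<in> N" "n \<noteq> \<one>" and h: "h \<in> carrier G" "h \<otimes> n = n \<otimes> h" for n h
  proof -
    have nG: "n \<in> carrier G" using NG[OF n(1)] .
    have "conj_class G n = conj_class G b" using n conj_class_eqI[OF b(1)] by (simp add: N_def)
    then have "m * card (conjugators n n) = m * (m + 1)"
      using card_class_mult_centralizer[OF nG] card_G by (simp add: m_def ac_simps)
    then have "card (conjugators n n) = card N"
      unfolding mult_cancel1 card_N using m_pos by linarith
    moreover have "N \<subseteq> conjugators n n"
      using conjugators_self_iff[OF nG] N_comm[OF _ n(1)] NG by auto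
    ultimately have "N = conjugators n n" by (simp add: card_subset_eq)
    then show ?thesis using conjugators_self_iff[OF nG] h by simp
  qed
  have "frobenius_group G N H"
    unfolding frobenius_group_def
  proof (intro conjI ballI)
    show "H \<noteq> {\<one>}" using card_H m2 by auto
    have "card H < card (carrier G)" unfolding card_H card_G using m_pos by simp
    then show "H \<noteq> carrier G" by auto
    show "H \<inter> (g <# H #> inv g) = {\<one>}" if g: "g \<in> carrier G - H" for g
    proof -
      have "x = \<one>" if xH: "x \<in> H" and xg: "x \<in> g <# H #> inv g" for x
      proof -
        obtain h where h: "h \<in> H" "x = g \<otimes> h \<otimes> inv g" using xg unfolding conj_set_iff by auto
        obtain n k where nk: "n \<in> N" "k \<in> H" "g = n \<otimes> k" using fact g by blast
        define y where "y = k \<otimes> h \<otimes> inv k"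
        have yH: "y \<in> H"
          unfolding y_def using h nk subgroup.m_closed[OF H(1)] subgroup.m_inv_closed[OF H(1)] by simp
        note c = NG[OF nk(1)] HG[OF nk(2)] HG[OF h(1)] HG[OF yH]
        have x: "x = n \<otimes> y \<otimes> inv n"
          unfolding h(2) nk(3) y_def using c by (simp add: inv_mult_group m_assoc)
        have n1: "n \<noteq> \<one>" using nk g HG by auto
        \<comment> \<open>this quotient lies in \<open>H\<close>, and as a commutator of \<open>n\<close> and \<open>y\<close> also in \<open>N\<close>\<close>
        have "x \<otimes> inv y \<in> H" using xH yH subgroup.m_closed[OF H(1)] subgroup.m_inv_closed[OF H(1)] by simp
        moreover have "x \<otimes> inv y = n \<otimes> (y \<otimes> inv n \<otimes> inv y)" unfolding x using c by (simp add: m_assoc)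
        then have "x \<otimes> inv y \<in> N"
          using N_conj[OF subgroup.m_inv_closed[OF N_subgroup nk(1)] c(4)] subgroup.m_closed[OF N_subgroup nk(1)] by simp
        ultimately have "x \<otimes> inv y = \<one>" by (rule HN)
        then have xy: "x = y" using HG[OF xH] c(4) by (metis inv_closed inv_equality inv_inv)
        have "x \<otimes> n = n \<otimes> y" unfolding x using c by (simp add: m_assoc)
        then have "y \<in> N" using cent[OF nk(1) n1 c(4)] xy by simp
        then show ?thesis using HN[OF yH] xy by simp
      qed
      moreover have "\<one> \<in> H \<inter> (g <# H #> inv g)"
        using g subgroup.one_closed[OF H(1)] unfolding conj_set_iff Int_iff by (auto intro!: bexI[of _ \<one>])
      ultimately show ?thesis by blast
    qed
    show "N = insert \<one> (carrier G - (\<Union>g\<in>carrier G. g <# H #> inv g))"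
    proof (intro Set.set_eqI iffI)
      fix x assume x: "x \<in> N"
      show "x \<in> insert \<one> (carrier G - (\<Union>g\<in>carrier G. g <# H #> inv g))"
      proof (rule ccontr)
        assume "x \<notin> insert \<one> (carrier G - (\<Union>g\<in>carrier G. g <# H #> inv g))"
        then obtain g h where gh: "g \<in> carrier G" "h \<in> H" "x = g \<otimes> h \<otimes> inv g" and x1: "x \<noteq> \<one>"
          using NG[OF x] conj_set_iff by auto
        have "h \<in> N" using N_conj_iff[of h g] gh x HG by simp
        then show False using HN[OF gh(2)] gh(1,3) x1 by simp
      qed
    next
      fix x assume "x \<in> insert \<one> (carrier G - (\<Union>g\<in>carrier G. g <# H #> inv g))"
      then consider "x = \<one>" | "x \<in> carrier G" "\<And>g h. g \<in> carrier G \<Longrightarrow> h \<in> H \<Longrightarrow> x \<noteq> g \<otimes> h \<otimes> inv g"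
        using conj_set_iff by auto
      then show "x \<in> N"
      proof cases
        case 2
        show ?thesis
        proof (rule ccontr)
          assume xN: "x \<notin> N"
          obtain n h where nh: "n \<in> N" "h \<in> H" "x = n \<otimes> h" using fact 2 by blast
          have hN: "h \<notin> N" using xN nh subgroup.m_closed[OF N_subgroup] by auto
          have hG: "h \<in> carrier G" using HG nh by simp
          define f where "f u = u \<otimes> (h \<otimes> inv u \<otimes> inv h)" for u
          have "f ` N \<subseteq> N"
            using N_conj[OF subgroup.m_inv_closed[OF N_subgroup] hG] subgroup.m_closed[OF N_subgroup] by (auto simp: f_def)
          moreover have "inj_on f N"
          proof (rule inj_onI)
            fix u v assume uv: "u \<in> N" "v \<in> N" "f u = f v"
            note c = NG[OF uv(1)] NG[OF uv(2)] hG
            have "inv v \<otimes> (f u \<otimes> h) \<otimes> u = inv v \<otimes> (f v \<otimes> h) \<otimes> u" using uv by simp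
            then have comm: "h \<otimes> (inv v \<otimes> u) = (inv v \<otimes> u) \<otimes> h" unfolding f_def using c by (simp add: m_assoc)
            have "inv v \<otimes> u \<in> N" using uv subgroup.m_closed[OF N_subgroup] subgroup.m_inv_closed[OF N_subgroup] by simp
            then have "inv v \<otimes> u = \<one>" using cent[OF _ _ hG comm] hN by blast
            then show "u = v" using c by (metis inv_closed inv_equality inv_inv)
          qed
          ultimately have "f ` N = N" by (simp add: endo_inj_surj)
          then obtain u where u: "u \<in> N" "f u = n" using nh(1) by (metis imageE)
          have "x = u \<otimes> h \<otimes> inv u"
            unfolding nh(3) u(2)[symmetric] f_def using hG NG[OF u(1)] by (simp add: m_assoc)
          then show False using 2(2)[OF NG[OF u(1)] nh(2)] by simp
        qed
      qed (simp add: N_def)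
    qed
  qed (use H is_group fin in auto)
  then show thesis using that[of H] card_H card_N by simp
qed

end

section \<open>From the Frobenius group to the column\<close>

context finite_group begin

text \<open>The set \<open>S x\<close> of all \<open>g\<close> that conjugate \<open>x\<close> into \<open>H\<close> gives the permutation character on the cosets of
\<open>H\<close>, namely \<open>card (S x) / card H\<close>. Its values are the index of \<open>H\<close> at \<open>\<one>\<close>, \<open>0\<close> on the rest of
\<open>F\<close>, and \<open>1\<close> elsewhere. By Frobenius reciprocity the multiplicity \<open>c \<psi>\<close> of \<open>\<psi>\<close> in it is the
multiplicity of the trivial character in the restriction of \<open>\<psi>\<close> to \<open>H\<close>.\<close>

lemma doubly_transitive_frobenius_column:
  assumes finI: "finite (Irr G)" and frob: "frobenius_group G F H" and card_H: "card H = card F - 1"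
  obtains \<theta> b where "cd1_column G \<theta> b" "\<theta> b = -1" "F = insert \<one> (conj_class G b)"
proof -
  define conjs where "conjs = (\<Union>g\<in>carrier G. g <# H #> inv g)"
  have H: "subgroup H G" "H \<noteq> {\<one>}"
    and disj: "\<And>g. g \<in> carrier G - H \<Longrightarrow> H \<inter> (g <# H #> inv g) = {\<one>}"
    and F: "F = insert \<one> (carrier G - conjs)"
    using frob by (auto simp: frobenius_group_def conjs_def)
  have conjs_iff: "x \<in> conjs \<longleftrightarrow> (\<exists>g\<in>carrier G. \<exists>y\<in>H. x = g \<otimes> y \<otimes> inv g)" for x
    unfolding conjs_def using conj_set_iff by simp
  have HG: "x \<in> carrier G" if "x \<in> H" for x using subgroup.mem_carrier[OF H(1) that] .
  have finH: "finite H" using finite_subset[OF subgroup.subset[OF H(1)] fin] .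
  have oneH: "\<one> \<in> H" using subgroup.one_closed[OF H(1)] .
  have FG: "F \<subseteq> carrier G" using F by auto
  then have finF: "finite F" using finite_subset[OF _ fin] by simp
  have oneF: "\<one> \<in> F" using F by simp
  define h where "h = card H"
  have h2: "2 \<le> h"
  proof (rule ccontr)
    assume "\<not> 2 \<le> h"
    then have "card H \<le> card {\<one>}" by (simp add: h_def)
    then have "{\<one>} = H" using oneH finH by (intro card_seteq) auto
    then show False using H(2) by simp
  qed
  have card_F: "card F = h + 1" using card_H h2 by (simp add: h_def)
  have malnormal: "g \<in> H" if "g \<in> carrier G" "x \<in> H" "x \<noteq> \<one>" "g \<otimes> x \<otimes> inv g \<in> H" for g x
  proof (rule ccontr)
    assume "g \<notin> H"
    then have "g \<otimes> x \<otimes> inv g \<in> {\<one>}" using disj[of g] that conj_set_iff[of "g \<otimes> x \<otimes> inv g" g H] by blast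
    then have "g \<otimes> x = g" using that HG by (metis inv_solve_right' l_one one_closed singletonD m_closed)
    then show False using that HG by simp
  qed
  define S where "S x = {g \<in> carrier G. g \<otimes> x \<otimes> inv g \<in> H}" for x
  have S_one: "card (S \<one>) = card (carrier G)"
  proof -
    have "S \<one> = carrier G" using oneH by (auto simp: S_def)
    then show ?thesis by simp
  qed
  have S_H: "card (S x) = h" if x: "x \<in> H" "x \<noteq> \<one>" for x
  proof -
    have "g \<otimes> x \<otimes> inv g \<in> H" if "g \<in> H" for g
      using subgroup.m_closed[OF H(1)] subgroup.m_inv_closed[OF H(1)] that x by simp
    then have "S x = H" using malnormal[OF _ x] HG by (auto simp: S_def)
    then show ?thesis by (simp add: h_def)
  qed
  have S_conj: "card (S (k \<otimes> x \<otimes> inv k)) = card (S x)" if k: "k \<in> carrier G" and x: "x \<in> carrier G" for k x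
  proof (rule bij_betw_same_card[where f = "\<lambda>g. g \<otimes> k"], rule bij_betwI[where g = "\<lambda>g. g \<otimes> inv k"])
    have eq: "(g \<otimes> k) \<otimes> x \<otimes> inv (g \<otimes> k) = g \<otimes> (k \<otimes> x \<otimes> inv k) \<otimes> inv g"
      "(g \<otimes> inv k) \<otimes> (k \<otimes> x \<otimes> inv k) \<otimes> inv (g \<otimes> inv k) = g \<otimes> x \<otimes> inv g" if "g \<in> carrier G" for g
      using that k x by (simp_all add: inv_mult_group m_assoc)
    show "(\<lambda>g. g \<otimes> k) \<in> S (k \<otimes> x \<otimes> inv k) \<rightarrow> S x" "(\<lambda>g. g \<otimes> inv k) \<in> S x \<rightarrow> S (k \<otimes> x \<otimes> inv k)"
      using eq k by (auto simp: S_def)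
  qed (use k in \<open>auto simp: S_def m_assoc\<close>)
  have S_conjs: "card (S x) = h" if x: "x \<in> conjs" "x \<noteq> \<one>" for x
  proof -
    obtain g y where gy: "g \<in> carrier G" "y \<in> H" "x = g \<otimes> y \<otimes> inv g" using x conjs_iff by auto
    then have "y \<noteq> \<one>" using x by auto
    then show ?thesis using S_conj[OF gy(1) HG[OF gy(2)]] S_H[OF gy(2)] gy(3) by simp
  qed
  have S_F: "card (S x) = 0" if x: "x \<in> F" "x \<noteq> \<one>" for x
  proof -
    have xG: "x \<in> carrier G" "x \<notin> conjs" using x F by auto
    have "S x = {}"
    proof (rule ccontr)
      assume "S x \<noteq> {}"
      then obtain g where g: "g \<in> carrier G" "g \<otimes> x \<otimes> inv g \<in> H" by (auto simp: S_def)
      have "x = inv g \<otimes> (g \<otimes> x \<otimes> inv g) \<otimes> inv (inv g)" using g(1) xG by (simp add: m_assoc)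
      then show False using xG(2) g conjs_iff[of x] by (metis inv_closed)
    qed
    then show ?thesis by simp
  qed
  have sum_S: "(\<Sum>x\<in>carrier G. card (S x)) = card (carrier G) * h"
  proof -
    have "(\<Sum>x\<in>carrier G. card (S x)) = (\<Sum>x\<in>carrier G. \<Sum>g\<in>carrier G. of_bool (g \<otimes> x \<otimes> inv g \<in> H))"
      by (simp add: S_def Int_def)
    also have "\<dots> = (\<Sum>g\<in>carrier G. \<Sum>x\<in>carrier G. of_bool (g \<otimes> x \<otimes> inv g \<in> H))"
      by (rule sum.swap)
    also have "\<dots> = (\<Sum>g\<in>carrier G. h)"
    proof (rule sum.cong)
      fix g assume g: "g \<in> carrier G"
      have "(\<Sum>x\<in>carrier G. of_bool (g \<otimes> x \<otimes> inv g \<in> H)) = (\<Sum>y\<in>carrier G. of_bool (y \<in> H) :: nat)"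
        by (rule sum.reindex_bij_witness[where j = "\<lambda>x. g \<otimes> x \<otimes> inv g" and i = "\<lambda>y. inv g \<otimes> y \<otimes> g"])
          (use g in \<open>auto simp: m_assoc\<close>)
      also have "\<dots> = card (carrier G \<inter> H)" by (simp add: Int_def)
      also have "carrier G \<inter> H = H" using HG by auto
      finally show "(\<Sum>x\<in>carrier G. of_bool (g \<otimes> x \<otimes> inv g \<in> H)) = h" by (simp add: h_def)
    qed simp
    finally show ?thesis by simp
  qed
  \<comment> \<open>the average of the permutation character is \<open>1\<close>; its values then give the order of \<open>F\<close> as the
    index of \<open>H\<close>\<close>
  have card_G: "card (carrier G) = (h + 1) * h"
  proof -
    have "(\<Sum>x\<in>carrier G. card (S x)) = (\<Sum>x\<in>carrier G - F. card (S x)) + (\<Sum>x\<in>F. card (S x))"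
      using FG fin by (rule sum.subset_diff)
    also have "(\<Sum>x\<in>carrier G - F. card (S x)) = (\<Sum>x\<in>carrier G - F. h)"
      using F by (intro sum.cong refl S_conjs) auto
    also have "(\<Sum>x\<in>F. card (S x)) = card (S \<one>) + (\<Sum>x\<in>F - {\<one>}. card (S x))"
      using finF F by (intro sum.remove) auto
    also have "(\<Sum>x\<in>F - {\<one>}. card (S x)) = 0" using S_F by simp
    finally have "card (carrier G) * h = (card (carrier G) - (h + 1)) * h + card (carrier G)"
      using sum_S S_one FG card_F by (simp add: card_Diff_subset finF)
    moreover have "h + 1 \<le> card (carrier G)" using card_mono[OF fin FG] card_F by simp
    ultimately show ?thesis
      by (metis add_diff_cancel_left' diff_diff_cancel diff_le_self diff_mult_distrib mult.commute mult_le_mono2)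
  qed
  obtain b where b: "b \<in> F" "b \<noteq> \<one>"
  proof -
    have "\<not> F \<subseteq> {\<one>}"
    proof
      assume "F \<subseteq> {\<one>}"
      then have "card F \<le> card {\<one>}" by (rule card_mono[rotated]) simp
      then show False using card_F h2 by simp
    qed
    then show thesis using that by auto
  qed
  have bG: "b \<in> carrier G" using b FG by auto
  have F_conj: "g \<otimes> x \<otimes> inv g \<in> F - {\<one>}" if x: "x \<in> F - {\<one>}" and g: "g \<in> carrier G" for g x
  proof -
    have xG: "x \<in> carrier G" "x \<notin> conjs" using x F by auto
    have inv: "x = inv g \<otimes> (g \<otimes> x \<otimes> inv g) \<otimes> g" using g xG by (simp add: m_assoc)
    then have ne: "g \<otimes> x \<otimes> inv g \<noteq> \<one>" using x g by auto
    have "g \<otimes> x \<otimes> inv g \<notin> conjs"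
    proof
      assume "g \<otimes> x \<otimes> inv g \<in> conjs"
      then obtain k y where ky: "k \<in> carrier G" "y \<in> H" "g \<otimes> x \<otimes> inv g = k \<otimes> y \<otimes> inv k" using conjs_iff by auto
      have "x = (inv g \<otimes> k) \<otimes> y \<otimes> inv (inv g \<otimes> k)"
        using inv unfolding ky(3) using g ky(1) HG[OF ky(2)] by (simp add: inv_mult_group m_assoc)
      then show False using xG(2) conjs_iff g ky by (metis inv_closed m_closed)
    qed
    then show ?thesis using ne F g xG by auto
  qed
  \<comment> \<open>\<open>H\<close> acts freely on \<open>F - {\<one>}\<close> by conjugation, and both sets have \<open>h\<close> elements\<close>
  have F_class: "F - {\<one>} = conj_class G b"
  proof
    show "conj_class G b \<subseteq> F - {\<one>}" using F_conj b by (auto simp: conj_class_eq)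
    have "(\<lambda>k. k \<otimes> b \<otimes> inv k) ` H = F - {\<one>}"
    proof (rule card_subset_eq)
      show "(\<lambda>k. k \<otimes> b \<otimes> inv k) ` H \<subseteq> F - {\<one>}"
        using b HG by (intro image_subsetI F_conj) auto
      have "inj_on (\<lambda>k. k \<otimes> b \<otimes> inv k) H"
      proof (rule inj_onI)
        fix u v assume uv: "u \<in> H" "v \<in> H" and eq: "u \<otimes> b \<otimes> inv u = v \<otimes> b \<otimes> inv v"
        note c = HG[OF uv(1)] HG[OF uv(2)] bG
        let ?w = "inv v \<otimes> u"
        have wH: "?w \<in> H" using uv subgroup.m_closed[OF H(1)] subgroup.m_inv_closed[OF H(1)] by simp
        have "inv v \<otimes> (u \<otimes> b \<otimes> inv u) \<otimes> u = inv v \<otimes> (v \<otimes> b \<otimes> inv v) \<otimes> u" using eq by simp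
        then have "?w \<otimes> b = b \<otimes> ?w" using c by (simp add: m_assoc)
        then have "b \<otimes> ?w \<otimes> inv b = ?w" using c by (metis inv_closed inv_solve_right' m_closed)
        moreover have "b \<notin> H"
        proof
          assume "b \<in> H"
          moreover have "b = \<one> \<otimes> b \<otimes> inv \<one>" using bG by simp
          ultimately have "b \<in> conjs" using conjs_iff[of b] by blast
          then show False using b F by simp
        qed
        ultimately have "?w = \<one>" using malnormal[OF bG wH] wH by auto
        then show "u = v" using c by (metis inv_closed inv_equality inv_inv)
      qed
      then show "card ((\<lambda>k. k \<otimes> b \<otimes> inv k) ` H) = card (F - {\<one>})"
        using card_F by (simp add: card_image card_Diff_singleton[OF oneF] h_def)
    qed (use finF in simp)
    then show "F - {\<one>} \<subseteq> conj_class G b" using HG by (auto simp: conj_class_eq)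
  qed
  then have F_eq: "F = insert \<one> (conj_class G b)" using F by auto
  have hc: "(of_nat h :: complex) \<noteq> 0" using h2 by simp
  have "\<exists>c. (\<Sum>x\<in>H. \<psi> x) / of_nat h = (of_nat c :: complex)" if "\<psi> \<in> Irr G" for \<psi>
    using linear_character_multiplicity[OF H(1), of "\<lambda>_. 1" \<psi>] that by (auto simp: h_def elim: Nats_cases)
  then obtain c :: "('a \<Rightarrow> complex) \<Rightarrow> nat" where
    c: "\<And>\<psi>. \<psi> \<in> Irr G \<Longrightarrow> (\<Sum>x\<in>H. \<psi> x) / of_nat h = of_nat (c \<psi>)" by metis
  have perm_char: "(\<Sum>\<psi>\<in>Irr G. of_nat (c \<psi>) * \<psi> y) = of_nat (card (S y)) / of_nat h"
    if y: "y \<in> carrier G" for y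
  proof -
    have "(\<Sum>\<psi>\<in>Irr G. of_nat (c \<psi>) * \<psi> y) = (\<Sum>\<psi>\<in>Irr G. \<Sum>x\<in>H. \<psi> y * \<psi> (inv (inv x)) / of_nat h)"
      by (intro sum.cong refl) (use HG in \<open>simp add: c[symmetric] sum_divide_distrib sum_distrib_left mult.commute\<close>)
    also have "\<dots> = (\<Sum>x\<in>H. (\<Sum>\<psi>\<in>Irr G. \<psi> y * \<psi> (inv (inv x))) / of_nat h)"
      by (subst sum.swap) (simp add: sum_divide_distrib)
    also have "\<dots> = (\<Sum>x\<in>H. of_nat (card (conjugators y (inv x))) / of_nat h)"
      by (intro sum.cong refl) (simp only: column_orthogonality[OF finI y inv_closed[OF HG]])
    also have "\<dots> = (\<Sum>x\<in>H. of_nat (card (conjugators y (inv x)))) / of_nat h"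
      by (simp only: sum_divide_distrib)
    also have "(\<Sum>x\<in>H. of_nat (card (conjugators y (inv x)))) = (of_nat (\<Sum>x\<in>H. card (conjugators y (inv x))) :: complex)"
      by simp
    also have "(\<Sum>x\<in>H. card (conjugators y (inv x))) = (\<Sum>x\<in>H. card (conjugators y x))"
      by (rule sum.reindex_bij_witness[where i = "\<lambda>x. inv x" and j = "\<lambda>x. inv x"])
        (use HG subgroup.m_inv_closed[OF H(1)] in auto)
    also have "\<dots> = card (\<Union>x\<in>H. conjugators y x)"
      using finH by (intro card_UN_disjoint[symmetric]) (auto simp: conjugators_def)
    also have "(\<Union>x\<in>H. conjugators y x) = S y" by (auto simp: conjugators_def S_def)
    finally show ?thesis .
  qed
  \<comment> \<open>the action on the cosets is doubly transitive\<close>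
  have sum_sq: "(\<Sum>\<psi>\<in>Irr G. (c \<psi>)\<^sup>2) = 2"
  proof -
    have "(of_nat (\<Sum>\<psi>\<in>Irr G. (c \<psi>)\<^sup>2) :: complex) = (\<Sum>\<psi>\<in>Irr G. of_nat (c \<psi>) * ((\<Sum>x\<in>H. \<psi> x) / of_nat h))"
      by (simp add: c power2_eq_square)
    also have "\<dots> = (\<Sum>\<psi>\<in>Irr G. \<Sum>x\<in>H. of_nat (c \<psi>) * \<psi> x / of_nat h)"
      by (simp add: sum_distrib_left sum_divide_distrib)
    also have "\<dots> = (\<Sum>x\<in>H. (\<Sum>\<psi>\<in>Irr G. of_nat (c \<psi>) * \<psi> x) / of_nat h)"
      by (subst sum.swap) (simp add: sum_divide_distrib)
    also have "\<dots> = (\<Sum>x\<in>H. of_nat (card (S x))) / of_nat h / of_nat h"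
      using perm_char HG by (simp add: sum_divide_distrib)
    also have "(\<Sum>x\<in>H. of_nat (card (S x))) = (of_nat (\<Sum>x\<in>H. card (S x)) :: complex)" by simp
    also have "(\<Sum>x\<in>H. card (S x)) = card (S \<one>) + (\<Sum>x\<in>H - {\<one>}. card (S x))"
      using finH oneH by (rule sum.remove)
    also have "(\<Sum>x\<in>H - {\<one>}. card (S x)) = (h - 1) * h"
      using S_H oneH finH by (simp add: h_def)
    also have "card (S \<one>) + (h - 1) * h = 2 * h * h"
      unfolding S_one card_G using h2 by (cases h) (auto simp: algebra_simps)
    finally have "(of_nat (\<Sum>\<psi>\<in>Irr G. (c \<psi>)\<^sup>2) :: complex) = of_nat 2" using hc by simp
    then show ?thesis by (simp only: of_nat_eq_iff)
  qed
  define triv :: "'a \<Rightarrow> complex" where "triv = (\<lambda>g\<in>carrier G. 1)"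
  have triv: "triv \<in> Irr G" unfolding triv_def by (rule trivial_in_Irr)
  have triv_val: "triv g = 1" if "g \<in> carrier G" for g using that by (simp add: triv_def)
  have "(of_nat (c triv) :: complex) = of_nat 1"
    using c[OF triv] triv_val HG hc by (simp add: h_def)
  then have c_triv: "c triv = 1" by (simp only: of_nat_eq_iff)
  then have "(\<Sum>\<psi>\<in>Irr G - {triv}. (c \<psi>)\<^sup>2) = 1"
    using sum_sq sum.remove[OF finI triv, of "\<lambda>\<psi>. (c \<psi>)\<^sup>2"] by simp
  then have "\<exists>\<theta>\<in>Irr G - {triv}. (c \<theta>)\<^sup>2 = 1 \<and> (\<forall>\<psi>\<in>Irr G - {triv}. \<theta> \<noteq> \<psi> \<longrightarrow> (c \<psi>)\<^sup>2 = 0)"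
    using sum_eq_1_iff[of "Irr G - {triv}" "\<lambda>\<psi>. (c \<psi>)\<^sup>2"] finI by simp
  then obtain \<theta> where *: "\<theta> \<in> Irr G - {triv}" "(c \<theta>)\<^sup>2 = 1"
    "\<forall>\<psi>\<in>Irr G - {triv}. \<theta> \<noteq> \<psi> \<longrightarrow> (c \<psi>)\<^sup>2 = 0"
    by blast
  then have \<theta>: "\<theta> \<in> Irr G" "\<theta> \<noteq> triv" "c \<theta> = 1"
    and others: "\<And>\<psi>. \<psi> \<in> Irr G \<Longrightarrow> \<psi> \<noteq> triv \<Longrightarrow> \<psi> \<noteq> \<theta> \<Longrightarrow> c \<psi> = 0"
    by auto
  have \<theta>_val: "\<theta> y = of_nat (card (S y)) / of_nat h - 1" if y: "y \<in> carrier G" for y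
  proof -
    have "(\<Sum>\<psi>\<in>Irr G. of_nat (c \<psi>) * \<psi> y) = (\<Sum>\<psi>\<in>{triv, \<theta>}. of_nat (c \<psi>) * \<psi> y)"
      using finI triv \<theta> others by (intro sum.mono_neutral_right) auto
    also have "\<dots> = 1 + \<theta> y" using \<theta> c_triv triv_val[OF y] by simp
    finally show ?thesis using perm_char[OF y] by simp
  qed
  have \<theta>_one: "\<theta> \<one> = of_nat h"
    using \<theta>_val[of \<one>] hc by (simp add: S_one card_G field_simps)
  have \<theta>_F: "\<theta> x = -1" if "x \<in> F - {\<one>}" for x
    using \<theta>_val[of x] S_F[of x] that FG by auto
  have \<theta>_conjs: "\<theta> x = 0" if "x \<in> carrier G - F" for x
    using \<theta>_val[of x] S_conjs[of x] that F hc by auto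
  have F_inv: "inv x \<in> F - {\<one>}" if x: "x \<in> F - {\<one>}" for x
  proof -
    have xG: "x \<in> carrier G" "x \<notin> conjs" using x F by auto
    have "inv x \<notin> conjs"
    proof
      assume "inv x \<in> conjs"
      then obtain k y where ky: "k \<in> carrier G" "y \<in> H" "inv x = k \<otimes> y \<otimes> inv k" using conjs_iff by auto
      have "x = inv (inv x)" using xG by simp
      also have "\<dots> = k \<otimes> inv y \<otimes> inv k"
        unfolding ky(3) using ky(1) HG[OF ky(2)] by (simp add: inv_mult_group m_assoc)
      finally show False using xG(2) conjs_iff ky subgroup.m_inv_closed[OF H(1)] by blast
    qed
    then show ?thesis using x F xG by auto
  qed
  have agree: "\<psi> \<one> = \<psi> b" if \<psi>: "\<psi> \<in> Irr G" "\<psi> \<noteq> \<theta>" for \<psi>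
  proof -
    have "0 = (\<Sum>g\<in>carrier G. \<theta> g * \<psi> (inv g))" using row_orthogonality[OF \<theta>(1) \<psi>(1)] \<psi>(2) by auto
    also have "\<dots> = (\<Sum>g\<in>F. \<theta> g * \<psi> (inv g))"
      using FG \<theta>_conjs by (intro sum.mono_neutral_right) auto
    also have "\<dots> = \<theta> \<one> * \<psi> (inv \<one>) + (\<Sum>g\<in>F - {\<one>}. \<theta> g * \<psi> (inv g))"
      using finF F by (intro sum.remove) auto
    also have "(\<Sum>g\<in>F - {\<one>}. \<theta> g * \<psi> (inv g)) = (\<Sum>g\<in>F - {\<one>}. - \<psi> b)"
    proof (rule sum.cong)
      fix g assume g: "g \<in> F - {\<one>}"
      then have "inv g \<in> conj_class G b" using F_inv[OF g] by (simp only: F_class)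
      then show "\<theta> g * \<psi> (inv g) = - \<psi> b" using \<theta>_F[OF g] char_conj_class[OF \<psi>(1) bG] by simp
    qed simp
    also have "\<dots> = - (of_nat h * \<psi> b)"
      by (simp add: card_Diff_singleton[OF oneF] card_F del: card_Diff_insert)
    finally have "of_nat h * \<psi> \<one> + - (of_nat h * \<psi> b) = 0" by (simp only: \<theta>_one inv_one)
    then have "of_nat h * (\<psi> \<one> - \<psi> b) = 0" unfolding right_diff_distrib by simp
    then have "\<psi> \<one> - \<psi> b = 0" using hc unfolding mult_eq_0_iff by blast
    then show ?thesis by simp
  qed
  have \<theta>_b: "\<theta> b = -1" using \<theta>_F b by simp
  have "card (carrier G) > 2"
  proof -
    have "3 * 2 \<le> (h + 1) * h" using h2 by (intro mult_le_mono) auto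
    then show ?thesis by (simp add: card_G)
  qed
  moreover have "\<theta> \<one> \<noteq> \<theta> b"
  proof
    assume "\<theta> \<one> = \<theta> b"
    then have "of_nat (h + 1) = (0 :: complex)" using \<theta>_one \<theta>_b by simp
    then show False by (simp only: of_nat_eq_0_iff)
  qed
  ultimately have "cd1_column G \<theta> b"
    using finI \<theta>(1) bG b(2) agree by unfold_locales auto
  then show thesis using \<theta>_b F_eq by (rule that)
qed

section \<open>The two classes of a CD1-group\<close>

text \<open>Pairing the difference of the two columns with the column of \<open>\<one>\<close> leaves a nonzero multiple of
\<open>\<chi> \<one>\<close>, whereas column orthogonality gives \<open>0\<close> unless \<open>\<one>\<close> belongs to one of the classes.\<close>

lemma columns_differ_once_one:
  assumes finI: "finite (Irr G)" and "columns_differ_once G x y"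
  shows "x = \<one> \<or> y = \<one>"
proof -
  obtain \<chi> where xy: "x \<in> carrier G" "y \<in> carrier G" and \<chi>: "\<chi> \<in> Irr G" "\<chi> x \<noteq> \<chi> y"
    and agree: "\<And>\<psi>. \<psi> \<in> Irr G - {\<chi>} \<Longrightarrow> \<psi> x = \<psi> y"
    using assms(2) by (auto simp: columns_differ_once_def)
  have "(\<Sum>\<psi>\<in>Irr G. \<psi> x * \<psi> (inv \<one>)) - (\<Sum>\<psi>\<in>Irr G. \<psi> y * \<psi> (inv \<one>))
      = (\<Sum>\<psi>\<in>Irr G. (\<psi> x - \<psi> y) * \<psi> (inv \<one>))"
    by (simp add: left_diff_distrib sum_subtractf)
  also have "\<dots> = (\<Sum>\<psi>\<in>{\<chi>}. (\<psi> x - \<psi> y) * \<psi> (inv \<one>))"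
    using finI \<chi>(1) agree by (intro sum.mono_neutral_right) auto
  finally have "card (conjugators x \<one>) \<noteq> 0 \<or> card (conjugators y \<one>) \<noteq> 0"
    using column_orthogonality[OF finI xy(1), of \<one>] column_orthogonality[OF finI xy(2), of \<one>]
      \<chi>(2) char_degree_eq[OF \<chi>(1)] char_degree_pos[OF \<chi>(1)] by auto
  then have "\<one> \<in> conj_class G x \<or> \<one> \<in> conj_class G y"
    using conjugators_nonempty_iff[of x \<one>] conjugators_nonempty_iff[of y \<one>] by fastforce
  then show ?thesis using one_notin_conj_class xy by blast
qed

lemma columns_differ_once_sym:
  "columns_differ_once G x y \<Longrightarrow> columns_differ_once G y x"
  unfolding columns_differ_once_def using conj_class_sym by metis

lemma cd1_column_iff:
  assumes "finite (Irr G)" "card (carrier G) > 2"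
  shows "columns_differ_once G \<one> b \<longleftrightarrow> (\<exists>\<chi>. cd1_column G \<chi> b)"
proof
  assume "columns_differ_once G \<one> b"
  then show "\<exists>\<chi>. cd1_column G \<chi> b"
    unfolding columns_differ_once_def cd1_column_def cd1_column_axioms_def
    using assms finite_group_axioms by (auto simp: conj_class_one)
next
  assume "\<exists>\<chi>. cd1_column G \<chi> b"
  then obtain \<chi> where "cd1_column G \<chi> b" by auto
  then interpret cd1_column G \<chi> b .
  show "columns_differ_once G \<one> b"
    unfolding columns_differ_once_def using b \<chi> differ agree by (auto simp: conj_class_one)
qed

text \<open>In both situations the exceptional row has the strictly largest degree, so it is the same row;
and that row vanishes outside \<open>\<one>\<close> and the class of \<open>b\<close>, but not at \<open>b'\<close>.\<close>

lemma cd1_column_unique: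
  assumes "cd1_column G \<chi> b" "cd1_column G \<chi>' b'"
  shows "conj_class G b' = conj_class G b"
proof -
  interpret X: cd1_column G \<chi> b by fact
  interpret Y: cd1_column G \<chi>' b' by fact
  have "\<chi>' = \<chi>"
  proof (rule ccontr)
    assume ne: "\<chi>' \<noteq> \<chi>"
    from X.degree_less_deg[OF Y.\<chi> ne] Y.degree_less_deg[OF X.\<chi> ne[symmetric]]
    show False by (simp add: X.deg_def Y.deg_def)
  qed
  then have "\<chi> b' \<noteq> 0" using Y.\<chi>_b_nonzero by simp
  then have "b' \<in> X.N" using X.vanish_outside_N Y.b by blast
  then have "b' \<in> conj_class G b" using Y.b by (simp add: X.N_def)
  then show ?thesis by (rule conj_class_eqI[OF X.b(1)])
qed

lemma CD1_class_eq:
  assumes "finite (Irr G)" "cd1_column G \<chi> b"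
  shows "CD1_class G = conj_class G b"
  unfolding CD1_class_def
proof (rule the_equality)
  interpret cd1_column G \<chi> b by fact
  show "\<exists>b'. columns_differ_once G \<one> b' \<and> conj_class G b = conj_class G b'"
    using cd1_column_iff[OF finite_Irr card_gt_2] assms(2) by blast
  show "C = conj_class G b" if "\<exists>b'. columns_differ_once G \<one> b' \<and> C = conj_class G b'" for C
    using that cd1_column_iff[OF finite_Irr card_gt_2] cd1_column_unique[OF assms(2)] by auto
qed

lemma cd1_column_conj:
  assumes "cd1_column G \<chi> b" "b' \<in> conj_class G b"
  shows "cd1_column G \<chi> b'"
proof -
  interpret cd1_column G \<chi> b by fact
  have b': "b' \<in> carrier G" "b' \<noteq> \<one>" using assms(2) class_subset one_notin_class by auto
  have same: "\<psi> b' = \<psi> b" if "\<psi> \<in> Irr G" for \<psi> using char_conj_class[OF that b(1) assms(2)] .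
  have "\<psi> \<one> = \<psi> b'" if "\<psi> \<in> Irr G" "\<psi> \<noteq> \<chi>" for \<psi> using agree[OF that] same[OF that(1)] by simp
  moreover have "\<chi> \<one> \<noteq> \<chi> b'" using differ same[OF \<chi>] by simp
  ultimately show ?thesis using b' finite_Irr card_gt_2 \<chi> by unfold_locales
qed

lemma CD1_group_iff:
  assumes finI: "finite (Irr G)"
  shows "CD1_group G \<longleftrightarrow> (\<exists>\<chi> b. cd1_column G \<chi> b)"
proof
  assume CD1: "CD1_group G"
  then have "card (carrier G) > 2" by (simp add: CD1_group_def Coset.order_def)
  moreover obtain x y where "columns_differ_once G x y" using CD1 by (auto simp: CD1_group_def)
  then have "\<exists>b. columns_differ_once G \<one> b"
    using columns_differ_once_one[OF finI] columns_differ_once_sym by blast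
  ultimately show "\<exists>\<chi> b. cd1_column G \<chi> b" using cd1_column_iff[OF finI] by blast
next
  assume "\<exists>\<chi> b. cd1_column G \<chi> b"
  then obtain \<chi> b where *: "cd1_column G \<chi> b" by auto
  then interpret cd1_column G \<chi> b .
  show "CD1_group G"
    unfolding CD1_group_def Coset.order_def
    using is_group fin card_gt_2 cd1_column_iff[OF finI card_gt_2] * by blast
qed

end

section \<open>The equivalence\<close>

theorem proposition3p1:
  fixes G :: "('a, 'c) monoid_scheme"
    and \<chi> :: "nat \<Rightarrow> 'a \<Rightarrow> complex"
    and k :: nat
    and b :: 'a
  assumes "group G" and "finite (carrier G)"
    and "irr_enumeration G k \<chi>"
    and "CD1_group G \<Longrightarrow> b \<in> CD1_class G"
  shows "((CD1_group G \<and> \<chi> k b = -1) \<longleftrightarrow>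
            (CD1_group G \<and> \<not> group.ord G b dvd char_degree G (\<chi> k))) \<and>
         ((CD1_group G \<and> \<chi> k b = -1) \<longleftrightarrow> (\<exists>F. doubly_transitive_frobenius G F)) \<and>
         (\<forall>F. doubly_transitive_frobenius G F \<longrightarrow> F = {\<one>\<^bsub>G\<^esub>} \<union> conj_class G b)"
proof -
  interpret finite_group G using assms(1,2) by (simp add: finite_group_def finite_group_axioms_def)
  have finI: "finite (Irr G)"
    using assms(3) by (auto simp: irr_enumeration_def dest: bij_betw_finite)
  have column: "cd1_column G (\<chi> k) b" if CD1: "CD1_group G"
  proof -
    obtain \<theta> c where c: "cd1_column G \<theta> c" using CD1 CD1_group_iff[OF finI] by auto
    have "b \<in> conj_class G c" using assms(4)[OF CD1] CD1_class_eq[OF finI c] by simp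
    from cd1_column_conj[OF c this] have "cd1_column G \<theta> b" .
    then show ?thesis using cd1_column.\<chi>_is_last[OF _ assms(3)] by metis
  qed
  have "\<chi> k b = -1 \<longleftrightarrow> \<not> group.ord G b dvd char_degree G (\<chi> k)" if "CD1_group G"
  proof -
    interpret cd1_column G "\<chi> k" b by (rule column[OF that])
    show ?thesis using not_dvd_of_minus_one minus_one_of_not_dvd by (auto simp: deg_def)
  qed
  moreover have "\<exists>F. doubly_transitive_frobenius G F" if "CD1_group G" "\<chi> k b = -1"
    using cd1_column.frobenius_of_minus_one[OF column[OF that(1)] that(2)]
    unfolding doubly_transitive_frobenius_def by metis
  moreover have "CD1_group G \<and> \<chi> k b = -1 \<and> F = {\<one>\<^bsub>G\<^esub>} \<union> conj_class G b"
    if dt: "doubly_transitive_frobenius G F" for F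
  proof -
    obtain H where "frobenius_group G F H" "card H = card F - 1"
      using dt by (auto simp: doubly_transitive_frobenius_def)
    then obtain \<theta> c where c: "cd1_column G \<theta> c" "\<theta> c = -1" "F = insert \<one>\<^bsub>G\<^esub> (conj_class G c)"
      using doubly_transitive_frobenius_column[OF finI] by metis
    then have CD1: "CD1_group G" using CD1_group_iff[OF finI] by auto
    have bc: "b \<in> conj_class G c" using assms(4)[OF CD1] CD1_class_eq[OF finI c(1)] by simp
    have "\<chi> k = \<theta>" using cd1_column.\<chi>_is_last[OF c(1) assms(3)] .
    moreover have "c \<in> carrier G" "\<theta> \<in> Irr G" using c(1) by (auto dest: cd1_column.b cd1_column.\<chi>)
    ultimately have "\<chi> k b = -1" "conj_class G b = conj_class G c"
      using char_conj_class[of \<theta> c b] conj_class_eqI[of c b] bc c(2) by simp_all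
    then show ?thesis using CD1 c(3) by simp
  qed
  ultimately show ?thesis by blast
qed

end
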